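(* Let $k$ be a field, let $A$ be a $k$-algebra, $C$ a $k$-coalgebra with coproduct $\Delta$ and counit $\epsilon$, and let $(A,C)_\psi$ be an entwining structure such that the entwining map $\psi:C\otimes A\to A\otimes C$ is bijective. Let $q\in k$ be non-zero, and let $$W:A\otimes A\to A\otimes A,\qquad a\otimes b\mapsto q^{-1}\,ba\otimes 1+q\,1\otimes ba-q^{-1}\,b\otimes a,$$ $$Z:C\otimes C\to C\otimes C,\qquad c\otimes d\mapsto q\,\epsilon(c)\sum d_{(1)}\otimes d_{(2)}+q^{-1}\,\epsilon(d)\sum c_{(1)}\otimes c_{(2)}-q^{-1}\,d\otimes c.$$ Let $R=W\circ\tau_{A,A}$ and $R'=Z\circ\tau_{C,C}$, and define a linear map $$R\oplus_\psi R':(A\oplus C)\otimes(A\oplus C)\to(A\oplus C)\otimes(A\oplus C)$$ by $R\oplus_\psi R'|_{A\otimes A}=R$, $R\oplus_\psi R'|_{C\otimes C}=R'$, and, for all $a\in A$, $c\in C$, $$(R\oplus_\psi R')(a\otimes c)=\psi^{-1}(a\otimes c),\qquad (R\oplus_\psi R')(c\otimes a)=\psi(c\otimes a)+(q-q^{-1})\,c\otimes a.$$ Then $R\oplus_\psi R'$ is a $q$-Hecke operator.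
   Context: Throughout, $k$ is a field, $\otimes=\otimes_k$, all algebras are associative unital $k$-algebras and all coalgebras are coassociative counital $k$-coalgebras. $I_V$ (or $I$) denotes the identity map on $V$. Sweedler's notation: $\Delta(c)=\sum c_{(1)}\otimes c_{(2)}$. For vector spaces $V,W$, $\tau_{V,W}:V\otimes W\to W\otimes V$ is the flip $v\otimes w\mapsto w\otimes v$. Entwining structure: for an algebra $A$ with product $\mu$ and unit map $\iota:k\to A$, and a coalgebra $C$ with coproduct $\Delta$ and counit $\epsilon$, $(A,C)_\psi$ is an entwining structure with entwining map $\psi:C\otimes A\to A\otimes C$ (a linear map) if (1) $\psi\circ(I_C\otimes\mu)=(\mu\otimes I_C)\circ(I_A\otimes\psi)\circ(\psi\otimes I_A)$; (2) $(I_A\otimes\Delta)\circ\psi=(\psi\otimes I_C)\circ(I_C\otimes\psi)\circ(\Delta\otimes I_A)$; (3) $\psi\circ(I_C\otimes\iota)=\iota\otimes I_C$, i.e. $\psi(c\otimes 1)=1\otimes c$ for all $c\in C$; (4) $(I_A\otimes\epsilon)\circ\psi=\epsilon\otimes I_A$, i.e. $(I_A\otimes\epsilon)(\psi(c\otimes a))=\epsilon(c)a$ for all $a\in A$, $c\in C$. Yang-Baxter operator: an invertible linear map $T:V\otimes V\to V\otimes V$ satisfying the braid equation $T_{12}\circ T_{23}\circ T_{12}=T_{23}\circ T_{12}\circ T_{23}$ on $V\otimes V\otimes V$, where $T_{12}=T\otimes I_V$ and $T_{23}=I_V\otimes T$. $q$-Hecke operator (for non-zero $q\in k$): a Yang-Baxter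 operator $T$ on $V$ such that $(T+q^{-1}I)\circ(T-qI)=0$. The space $(A\oplus C)\otimes(A\oplus C)$ is identified with $(A\otimes A)\oplus(A\otimes C)\oplus(C\otimes A)\oplus(C\otimes C)$. *)

theory Defs
  imports "HOL-Algebra.Module" "HOL-Algebra.AbelCoset"
begin

text \<open>
  Vector spaces over a field \<open>K\<close> are HOL-Algebra modules over \<open>K\<close>. For a space that is
  only a module, the ring fields \<open>mult\<close> and \<open>one\<close> of the module record carry no meaning and
  are left unspecified. Maps between spaces are HOL functions of which only the values on the
  carrier matter; equalities of maps are therefore stated on carriers.
\<close>

definition linear_map ::
  "('k, 'm) ring_scheme \<Rightarrow> ('k, 'v) module \<Rightarrow> ('k, 'w) module \<Rightarrow> ('v \<Rightarrow> 'w) \<Rightarrow> bool"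
  where "linear_map K V W f \<longleftrightarrow>
    f \<in> carrier V \<rightarrow> carrier W \<and>
    (\<forall>x\<in>carrier V. \<forall>y\<in>carrier V. f (x \<oplus>\<^bsub>V\<^esub> y) = f x \<oplus>\<^bsub>W\<^esub> f y) \<and>
    (\<forall>r\<in>carrier K. \<forall>x\<in>carrier V. f (r \<odot>\<^bsub>V\<^esub> x) = r \<odot>\<^bsub>W\<^esub> f x)"

definition ground_space :: "('k, 'm) ring_scheme \<Rightarrow> ('k, 'k) module"
  where "ground_space K =
    \<lparr>carrier = carrier K, mult = mult K, one = one K, zero = zero K, add = add K,
     smult = mult K\<rparr>"

definition direct_sum :: "('k, 'v) module \<Rightarrow> ('k, 'w) module \<Rightarrow> ('k, 'v \<times> 'w) module"
  where "direct_sum V W =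
    \<lparr>carrier = carrier V \<times> carrier W, mult = undefined, one = undefined,
     zero = (\<zero>\<^bsub>V\<^esub>, \<zero>\<^bsub>W\<^esub>),
     add = (\<lambda>x y. (fst x \<oplus>\<^bsub>V\<^esub> fst y, snd x \<oplus>\<^bsub>W\<^esub> snd y)),
     smult = (\<lambda>r x. (r \<odot>\<^bsub>V\<^esub> fst x, r \<odot>\<^bsub>W\<^esub> snd x))\<rparr>"


section \<open>Tensor products\<close>

definition free_space :: "('k, 'm) ring_scheme \<Rightarrow> 's set \<Rightarrow> ('k, 's \<Rightarrow> 'k) module"
  where "free_space K S =
    \<lparr>carrier = {f. (\<forall>s\<in>S. f s \<in> carrier K) \<and> (\<forall>s. s \<notin> S \<longrightarrow> f s = \<zero>\<^bsub>K\<^esub>) \<and>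
                   finite {s. f s \<noteq> \<zero>\<^bsub>K\<^esub>}},
     mult = undefined, one = undefined,
     zero = (\<lambda>_. \<zero>\<^bsub>K\<^esub>),
     add = (\<lambda>f g s. f s \<oplus>\<^bsub>K\<^esub> g s),
     smult = (\<lambda>r f s. r \<otimes>\<^bsub>K\<^esub> f s)\<rparr>"

definition free_gen :: "('k, 'm) ring_scheme \<Rightarrow> 's \<Rightarrow> 's \<Rightarrow> 'k"
  where "free_gen K s = (\<lambda>t. if t = s then \<one>\<^bsub>K\<^esub> else \<zero>\<^bsub>K\<^esub>)"

definition generated_submodule ::
  "('k, 'm) ring_scheme \<Rightarrow> ('k, 'v) module \<Rightarrow> 'v set \<Rightarrow> 'v set"
  where "generated_submodule K V X = \<Inter>{H. submodule H K V \<and> X \<subseteq> H}"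

definition bilinear_relations ::
  "('k, 'm) ring_scheme \<Rightarrow> ('k, 'v) module \<Rightarrow> ('k, 'w) module \<Rightarrow> ('v \<times> 'w \<Rightarrow> 'k) set"
  where "bilinear_relations K V W =
    (let F = free_space K (carrier V \<times> carrier W); e = free_gen K in
      {e (x \<oplus>\<^bsub>V\<^esub> y, w) \<ominus>\<^bsub>F\<^esub> (e (x, w) \<oplus>\<^bsub>F\<^esub> e (y, w)) | x y w.
         x \<in> carrier V \<and> y \<in> carrier V \<and> w \<in> carrier W} \<union>
      {e (v, x \<oplus>\<^bsub>W\<^esub> y) \<ominus>\<^bsub>F\<^esub> (e (v, x) \<oplus>\<^bsub>F\<^esub> e (v, y)) | v x y.
         v \<in> carrier V \<and> x \<in> carrier W \<and> y \<in> carrier W} \<union>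
      {e (r \<odot>\<^bsub>V\<^esub> v, w) \<ominus>\<^bsub>F\<^esub> r \<odot>\<^bsub>F\<^esub> e (v, w) | r v w.
         r \<in> carrier K \<and> v \<in> carrier V \<and> w \<in> carrier W} \<union>
      {e (v, r \<odot>\<^bsub>W\<^esub> w) \<ominus>\<^bsub>F\<^esub> r \<odot>\<^bsub>F\<^esub> e (v, w) | r v w.
         r \<in> carrier K \<and> v \<in> carrier V \<and> w \<in> carrier W})"

definition tensor_kernel ::
  "('k, 'm) ring_scheme \<Rightarrow> ('k, 'v) module \<Rightarrow> ('k, 'w) module \<Rightarrow> ('v \<times> 'w \<Rightarrow> 'k) set"
  where "tensor_kernel K V W =
    generated_submodule K (free_space K (carrier V \<times> carrier W)) (bilinear_relations K V W)"

text \<open>The space \<open>V \<boxtimes>\<^bsub>K\<^esub> W\<close> is the usual quotient of the free space on pairs; its elements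
  are the cosets of \<open>tensor_kernel K V W\<close>.\<close>

definition tensor_space ::
  "('k, 'm) ring_scheme \<Rightarrow> ('k, 'v) module \<Rightarrow> ('k, 'w) module \<Rightarrow>
   ('k, ('v \<times> 'w \<Rightarrow> 'k) set) module" (infixr \<open>\<boxtimes>\<index>\<close> 75)
  where "V \<boxtimes>\<^bsub>K\<^esub> W =
    (let F = free_space K (carrier V \<times> carrier W); N = tensor_kernel K V W in
      \<lparr>carrier = a_rcosets\<^bsub>F\<^esub> N, mult = undefined, one = undefined,
       zero = N,
       add = (\<lambda>X Y. X <+>\<^bsub>F\<^esub> Y),
       smult = (\<lambda>r X. N <+>\<^bsub>F\<^esub> ((\<lambda>x. r \<odot>\<^bsub>F\<^esub> x) ` X))\<rparr>)"

definition tensor ::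
  "('k, 'm) ring_scheme \<Rightarrow> ('k, 'v) module \<Rightarrow> ('k, 'w) module \<Rightarrow> 'v \<Rightarrow> 'w \<Rightarrow> ('v \<times> 'w \<Rightarrow> 'k) set"
  where "tensor K V W v w =
    tensor_kernel K V W +>\<^bsub>free_space K (carrier V \<times> carrier W)\<^esub> free_gen K (v, w)"

text \<open>For a bilinear \<open>b\<close>, \<open>tensor_lift K V W U b\<close> is the linear map \<open>V \<boxtimes>\<^bsub>K\<^esub> W \<rightarrow> U\<close> sending
  \<open>tensor K V W v w\<close> to \<open>b v w\<close>. It is computed on a representative of the coset, the choice of
  which is immaterial when \<open>b\<close> is bilinear; below it is applied to bilinear \<open>b\<close> only.\<close>

definition tensor_lift ::
  "('k, 'm) ring_scheme \<Rightarrow> ('k, 'v) module \<Rightarrow> ('k, 'w) module \<Rightarrow> ('k, 'u) module \<Rightarrow>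
   ('v \<Rightarrow> 'w \<Rightarrow> 'u) \<Rightarrow> ('v \<times> 'w \<Rightarrow> 'k) set \<Rightarrow> 'u"
  where "tensor_lift K V W U b X =
    (let x = (SOME x. x \<in> X) in
      \<Oplus>\<^bsub>U\<^esub>p\<in>{p. x p \<noteq> \<zero>\<^bsub>K\<^esub>}. x p \<odot>\<^bsub>U\<^esub> b (fst p) (snd p))"

text \<open>\<open>tensor_map K V W V' W' f g\<close> is the map \<open>f \<otimes> g\<close> from \<open>V \<boxtimes>\<^bsub>K\<^esub> W\<close> to
  \<open>V' \<boxtimes>\<^bsub>K\<^esub> W'\<close>.\<close>

definition tensor_map ::
  "('k, 'm) ring_scheme \<Rightarrow> ('k, 'v) module \<Rightarrow> ('k, 'w) module \<Rightarrow>
   ('k, 'v1) module \<Rightarrow> ('k, 'w1) module \<Rightarrow> ('v \<Rightarrow> 'v1) \<Rightarrow> ('w \<Rightarrow> 'w1) \<Rightarrow>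
   ('v \<times> 'w \<Rightarrow> 'k) set \<Rightarrow> ('v1 \<times> 'w1 \<Rightarrow> 'k) set"
  where "tensor_map K V W V' W' f g =
    tensor_lift K V W (V' \<boxtimes>\<^bsub>K\<^esub> W') (\<lambda>v w. tensor K V' W' (f v) (g w))"

definition flip ::
  "('k, 'm) ring_scheme \<Rightarrow> ('k, 'v) module \<Rightarrow> ('k, 'w) module \<Rightarrow>
   ('v \<times> 'w \<Rightarrow> 'k) set \<Rightarrow> ('w \<times> 'v \<Rightarrow> 'k) set"
  where "flip K V W = tensor_lift K V W (W \<boxtimes>\<^bsub>K\<^esub> V) (\<lambda>v w. tensor K W V w v)"

text \<open>The canonical identifications \<open>(U \<otimes> V) \<otimes> W \<cong> U \<otimes> (V \<otimes> W)\<close>, in both directions, and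
  \<open>k \<otimes> V \<cong> V\<close>, \<open>V \<otimes> k \<cong> V\<close>, which the usual notation leaves implicit.\<close>

definition assoc_r ::
  "('k, 'm) ring_scheme \<Rightarrow> ('k, 'u) module \<Rightarrow> ('k, 'v) module \<Rightarrow> ('k, 'w) module \<Rightarrow>
   (('u \<times> 'v \<Rightarrow> 'k) set \<times> 'w \<Rightarrow> 'k) set \<Rightarrow> ('u \<times> ('v \<times> 'w \<Rightarrow> 'k) set \<Rightarrow> 'k) set"
  where "assoc_r K U V W =
    tensor_lift K (U \<boxtimes>\<^bsub>K\<^esub> V) W (U \<boxtimes>\<^bsub>K\<^esub> (V \<boxtimes>\<^bsub>K\<^esub> W))
      (\<lambda>X w. tensor_lift K U V (U \<boxtimes>\<^bsub>K\<^esub> (V \<boxtimes>\<^bsub>K\<^esub> W))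
        (\<lambda>u v. tensor K U (V \<boxtimes>\<^bsub>K\<^esub> W) u (tensor K V W v w)) X)"

definition assoc_l ::
  "('k, 'm) ring_scheme \<Rightarrow> ('k, 'u) module \<Rightarrow> ('k, 'v) module \<Rightarrow> ('k, 'w) module \<Rightarrow>
   ('u \<times> ('v \<times> 'w \<Rightarrow> 'k) set \<Rightarrow> 'k) set \<Rightarrow> (('u \<times> 'v \<Rightarrow> 'k) set \<times> 'w \<Rightarrow> 'k) set"
  where "assoc_l K U V W =
    tensor_lift K U (V \<boxtimes>\<^bsub>K\<^esub> W) ((U \<boxtimes>\<^bsub>K\<^esub> V) \<boxtimes>\<^bsub>K\<^esub> W)
      (\<lambda>u X. tensor_lift K V W ((U \<boxtimes>\<^bsub>K\<^esub> V) \<boxtimes>\<^bsub>K\<^esub> W)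
        (\<lambda>v w. tensor K (U \<boxtimes>\<^bsub>K\<^esub> V) W (tensor K U V u v) w) X)"

definition unit_l ::
  "('k, 'm) ring_scheme \<Rightarrow> ('k, 'v) module \<Rightarrow> ('k \<times> 'v \<Rightarrow> 'k) set \<Rightarrow> 'v"
  where "unit_l K V = tensor_lift K (ground_space K) V V (\<lambda>r v. r \<odot>\<^bsub>V\<^esub> v)"

definition unit_r ::
  "('k, 'm) ring_scheme \<Rightarrow> ('k, 'v) module \<Rightarrow> ('v \<times> 'k \<Rightarrow> 'k) set \<Rightarrow> 'v"
  where "unit_r K V = tensor_lift K V (ground_space K) V (\<lambda>v r. r \<odot>\<^bsub>V\<^esub> v)"


section \<open>Algebras, coalgebras and entwining structures\<close>

text \<open>The library locale \<open>algebra\<close> requires a commutative multiplication, hence this variant.\<close>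

locale assoc_algebra = K?: field K + module K A + A?: ring A
  for K (structure) and A :: "('k, 'a) module" (structure) +
  assumes smult_mult_l:
      "\<lbrakk>r \<in> carrier K; x \<in> carrier A; y \<in> carrier A\<rbrakk> \<Longrightarrow>
       (r \<odot>\<^bsub>A\<^esub> x) \<otimes>\<^bsub>A\<^esub> y = r \<odot>\<^bsub>A\<^esub> (x \<otimes>\<^bsub>A\<^esub> y)"
    and smult_mult_r:
      "\<lbrakk>r \<in> carrier K; x \<in> carrier A; y \<in> carrier A\<rbrakk> \<Longrightarrow>
       x \<otimes>\<^bsub>A\<^esub> (r \<odot>\<^bsub>A\<^esub> y) = r \<odot>\<^bsub>A\<^esub> (x \<otimes>\<^bsub>A\<^esub> y)"

definition product_map ::
  "('k, 'm) ring_scheme \<Rightarrow> ('k, 'a) module \<Rightarrow> ('a \<times> 'a \<Rightarrow> 'k) set \<Rightarrow> 'a"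
  where "product_map K A = tensor_lift K A A A (\<lambda>x y. x \<otimes>\<^bsub>A\<^esub> y)"

locale coalgebra = K?: field K + module K C
  for K (structure) and C :: "('k, 'c) module" (structure) +
  fixes \<Delta> :: "'c \<Rightarrow> ('c \<times> 'c \<Rightarrow> 'k) set" and \<epsilon> :: "'c \<Rightarrow> 'k"
  assumes coproduct_linear: "linear_map K C (C \<boxtimes>\<^bsub>K\<^esub> C) \<Delta>"
    and counit_linear: "linear_map K C (ground_space K) \<epsilon>"
    and coassociative:
      "c \<in> carrier C \<Longrightarrow>
       assoc_r K C C C (tensor_map K C C (C \<boxtimes>\<^bsub>K\<^esub> C) C \<Delta> (\<lambda>x. x) (\<Delta> c)) =
       tensor_map K C C C (C \<boxtimes>\<^bsub>K\<^esub> C) (\<lambda>x. x) \<Delta> (\<Delta> c)"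
    and counit_left:
      "c \<in> carrier C \<Longrightarrow> unit_l K C (tensor_map K C C (ground_space K) C \<epsilon> (\<lambda>x. x) (\<Delta> c)) = c"
    and counit_right:
      "c \<in> carrier C \<Longrightarrow> unit_r K C (tensor_map K C C C (ground_space K) (\<lambda>x. x) \<epsilon> (\<Delta> c)) = c"

locale entwining_structure = assoc_algebra K A + coalgebra K C \<Delta> \<epsilon>
  for K (structure) and A :: "('k, 'a) module" and C :: "('k, 'c) module"
    and \<Delta> :: "'c \<Rightarrow> ('c \<times> 'c \<Rightarrow> 'k) set" and \<epsilon> :: "'c \<Rightarrow> 'k" +
  fixes \<psi> :: "('c \<times> 'a \<Rightarrow> 'k) set \<Rightarrow> ('a \<times> 'c \<Rightarrow> 'k) set"
  assumes entwining_linear: "linear_map K (C \<boxtimes>\<^bsub>K\<^esub> A) (A \<boxtimes>\<^bsub>K\<^esub> C) \<psi>"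
    and entwining_product:
      "\<And>X. X \<in> carrier (C \<boxtimes>\<^bsub>K\<^esub> (A \<boxtimes>\<^bsub>K\<^esub> A)) \<Longrightarrow>
       \<psi> (tensor_map K C (A \<boxtimes>\<^bsub>K\<^esub> A) C A (\<lambda>x. x) (product_map K A) X) =
       (tensor_map K (A \<boxtimes>\<^bsub>K\<^esub> A) C A C (product_map K A) (\<lambda>x. x)
        \<circ> assoc_l K A A C
        \<circ> tensor_map K A (C \<boxtimes>\<^bsub>K\<^esub> A) A (A \<boxtimes>\<^bsub>K\<^esub> C) (\<lambda>x. x) \<psi>
        \<circ> assoc_r K A C A
        \<circ> tensor_map K (C \<boxtimes>\<^bsub>K\<^esub> A) A (A \<boxtimes>\<^bsub>K\<^esub> C) A \<psi> (\<lambda>x. x)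
        \<circ> assoc_l K C A A) X"
    and entwining_coproduct:
      "\<And>X. X \<in> carrier (C \<boxtimes>\<^bsub>K\<^esub> A) \<Longrightarrow>
       tensor_map K A C A (C \<boxtimes>\<^bsub>K\<^esub> C) (\<lambda>x. x) \<Delta> (\<psi> X) =
       (assoc_r K A C C
        \<circ> tensor_map K (C \<boxtimes>\<^bsub>K\<^esub> A) C (A \<boxtimes>\<^bsub>K\<^esub> C) C \<psi> (\<lambda>x. x)
        \<circ> assoc_l K C A C
        \<circ> tensor_map K C (C \<boxtimes>\<^bsub>K\<^esub> A) C (A \<boxtimes>\<^bsub>K\<^esub> C) (\<lambda>x. x) \<psi>
        \<circ> assoc_r K C C A
        \<circ> tensor_map K C A (C \<boxtimes>\<^bsub>K\<^esub> C) A \<Delta> (\<lambda>x. x)) X"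
    and entwining_unit:
      "c \<in> carrier C \<Longrightarrow> \<psi> (tensor K C A c \<one>\<^bsub>A\<^esub>) = tensor K A C \<one>\<^bsub>A\<^esub> c"
    and entwining_counit:
      "\<lbrakk>c \<in> carrier C; a \<in> carrier A\<rbrakk> \<Longrightarrow>
       unit_r K A (tensor_map K A C A (ground_space K) (\<lambda>x. x) \<epsilon> (\<psi> (tensor K C A c a))) =
       \<epsilon> c \<odot>\<^bsub>A\<^esub> a"


section \<open>Yang-Baxter and Hecke operators\<close>

text \<open>The space \<open>V \<otimes> V \<otimes> V\<close> is taken to be \<open>V \<otimes> (V \<otimes> V)\<close>.\<close>

definition op12 ::
  "('k, 'm) ring_scheme \<Rightarrow> ('k, 'v) module \<Rightarrow> (('v \<times> 'v \<Rightarrow> 'k) set \<Rightarrow> ('v \<times> 'v \<Rightarrow> 'k) set) \<Rightarrow>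
   ('v \<times> ('v \<times> 'v \<Rightarrow> 'k) set \<Rightarrow> 'k) set \<Rightarrow> ('v \<times> ('v \<times> 'v \<Rightarrow> 'k) set \<Rightarrow> 'k) set"
  where "op12 K V T =
    assoc_r K V V V \<circ> tensor_map K (V \<boxtimes>\<^bsub>K\<^esub> V) V (V \<boxtimes>\<^bsub>K\<^esub> V) V T (\<lambda>x. x) \<circ> assoc_l K V V V"

definition op23 ::
  "('k, 'm) ring_scheme \<Rightarrow> ('k, 'v) module \<Rightarrow> (('v \<times> 'v \<Rightarrow> 'k) set \<Rightarrow> ('v \<times> 'v \<Rightarrow> 'k) set) \<Rightarrow>
   ('v \<times> ('v \<times> 'v \<Rightarrow> 'k) set \<Rightarrow> 'k) set \<Rightarrow> ('v \<times> ('v \<times> 'v \<Rightarrow> 'k) set \<Rightarrow> 'k) set"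
  where "op23 K V T = tensor_map K V (V \<boxtimes>\<^bsub>K\<^esub> V) V (V \<boxtimes>\<^bsub>K\<^esub> V) (\<lambda>x. x) T"

definition yang_baxter_operator ::
  "('k, 'm) ring_scheme \<Rightarrow> ('k, 'v) module \<Rightarrow>
   (('v \<times> 'v \<Rightarrow> 'k) set \<Rightarrow> ('v \<times> 'v \<Rightarrow> 'k) set) \<Rightarrow> bool"
  where "yang_baxter_operator K V T \<longleftrightarrow>
    linear_map K (V \<boxtimes>\<^bsub>K\<^esub> V) (V \<boxtimes>\<^bsub>K\<^esub> V) T \<and>
    bij_betw T (carrier (V \<boxtimes>\<^bsub>K\<^esub> V)) (carrier (V \<boxtimes>\<^bsub>K\<^esub> V)) \<and>
    (\<forall>X\<in>carrier (V \<boxtimes>\<^bsub>K\<^esub> (V \<boxtimes>\<^bsub>K\<^esub> V)).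
      (op12 K V T \<circ> op23 K V T \<circ> op12 K V T) X = (op23 K V T \<circ> op12 K V T \<circ> op23 K V T) X)"

text \<open>In the field \<open>K\<close>, \<open>inv\<^bsub>K\<^esub> q\<close> is the multiplicative inverse of a nonzero \<open>q\<close>.\<close>

definition hecke_operator ::
  "('k, 'm) ring_scheme \<Rightarrow> ('k, 'v) module \<Rightarrow> 'k \<Rightarrow>
   (('v \<times> 'v \<Rightarrow> 'k) set \<Rightarrow> ('v \<times> 'v \<Rightarrow> 'k) set) \<Rightarrow> bool"
  where "hecke_operator K V q T \<longleftrightarrow>
    yang_baxter_operator K V T \<and>
    (\<forall>X\<in>carrier (V \<boxtimes>\<^bsub>K\<^esub> V).
      ((\<lambda>Y. T Y \<oplus>\<^bsub>V \<boxtimes>\<^bsub>K\<^esub> V\<^esub> (inv\<^bsub>K\<^esub> q) \<odot>\<^bsub>V \<boxtimes>\<^bsub>K\<^esub> V\<^esub> Y) \<circ>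
       (\<lambda>Y. T Y \<ominus>\<^bsub>V \<boxtimes>\<^bsub>K\<^esub> V\<^esub> q \<odot>\<^bsub>V \<boxtimes>\<^bsub>K\<^esub> V\<^esub> Y)) X = \<zero>\<^bsub>V \<boxtimes>\<^bsub>K\<^esub> V\<^esub>)"


section \<open>The operators built from an algebra, a coalgebra and an entwining map\<close>

definition alg_op_W ::
  "('k, 'm) ring_scheme \<Rightarrow> ('k, 'a) module \<Rightarrow> 'k \<Rightarrow> ('a \<times> 'a \<Rightarrow> 'k) set \<Rightarrow> ('a \<times> 'a \<Rightarrow> 'k) set"
  where "alg_op_W K A q = tensor_lift K A A (A \<boxtimes>\<^bsub>K\<^esub> A) (\<lambda>a b.
    (inv\<^bsub>K\<^esub> q) \<odot>\<^bsub>A \<boxtimes>\<^bsub>K\<^esub> A\<^esub> tensor K A A (b \<otimes>\<^bsub>A\<^esub> a) \<one>\<^bsub>A\<^esub>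
    \<oplus>\<^bsub>A \<boxtimes>\<^bsub>K\<^esub> A\<^esub> q \<odot>\<^bsub>A \<boxtimes>\<^bsub>K\<^esub> A\<^esub> tensor K A A \<one>\<^bsub>A\<^esub> (b \<otimes>\<^bsub>A\<^esub> a)
    \<ominus>\<^bsub>A \<boxtimes>\<^bsub>K\<^esub> A\<^esub> (inv\<^bsub>K\<^esub> q) \<odot>\<^bsub>A \<boxtimes>\<^bsub>K\<^esub> A\<^esub> tensor K A A b a)"

definition coalg_op_Z ::
  "('k, 'm) ring_scheme \<Rightarrow> ('k, 'c) module \<Rightarrow> ('c \<Rightarrow> ('c \<times> 'c \<Rightarrow> 'k) set) \<Rightarrow> ('c \<Rightarrow> 'k) \<Rightarrow> 'k \<Rightarrow>
   ('c \<times> 'c \<Rightarrow> 'k) set \<Rightarrow> ('c \<times> 'c \<Rightarrow> 'k) set"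
  where "coalg_op_Z K C \<Delta> \<epsilon> q = tensor_lift K C C (C \<boxtimes>\<^bsub>K\<^esub> C) (\<lambda>c d.
    (q \<otimes>\<^bsub>K\<^esub> \<epsilon> c) \<odot>\<^bsub>C \<boxtimes>\<^bsub>K\<^esub> C\<^esub> \<Delta> d
    \<oplus>\<^bsub>C \<boxtimes>\<^bsub>K\<^esub> C\<^esub> (inv\<^bsub>K\<^esub> q \<otimes>\<^bsub>K\<^esub> \<epsilon> d) \<odot>\<^bsub>C \<boxtimes>\<^bsub>K\<^esub> C\<^esub> \<Delta> c
    \<ominus>\<^bsub>C \<boxtimes>\<^bsub>K\<^esub> C\<^esub> (inv\<^bsub>K\<^esub> q) \<odot>\<^bsub>C \<boxtimes>\<^bsub>K\<^esub> C\<^esub> tensor K C C d c)"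

definition alg_op_R ::
  "('k, 'm) ring_scheme \<Rightarrow> ('k, 'a) module \<Rightarrow> 'k \<Rightarrow> ('a \<times> 'a \<Rightarrow> 'k) set \<Rightarrow> ('a \<times> 'a \<Rightarrow> 'k) set"
  where "alg_op_R K A q = alg_op_W K A q \<circ> flip K A A"

definition coalg_op_R' ::
  "('k, 'm) ring_scheme \<Rightarrow> ('k, 'c) module \<Rightarrow> ('c \<Rightarrow> ('c \<times> 'c \<Rightarrow> 'k) set) \<Rightarrow> ('c \<Rightarrow> 'k) \<Rightarrow> 'k \<Rightarrow>
   ('c \<times> 'c \<Rightarrow> 'k) set \<Rightarrow> ('c \<times> 'c \<Rightarrow> 'k) set"
  where "coalg_op_R' K C \<Delta> \<epsilon> q = coalg_op_Z K C \<Delta> \<epsilon> q \<circ> flip K C C"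

text \<open>The map on \<open>(A \<oplus> C) \<otimes> (A \<oplus> C)\<close> with the prescribed restrictions to the four summands
  \<open>A \<otimes> A\<close>, \<open>C \<otimes> C\<close>, \<open>A \<otimes> C\<close> and \<open>C \<otimes> A\<close>. Each line projects to a summand, applies the
  map prescribed there, and includes the result back; the inclusions and projections are the
  tensor products of those of \<open>A \<oplus> C\<close>.\<close>

definition entwined_sum ::
  "('k, 'm) ring_scheme \<Rightarrow> ('k, 'a) module \<Rightarrow> ('k, 'c) module \<Rightarrow>
   (('c \<times> 'a \<Rightarrow> 'k) set \<Rightarrow> ('a \<times> 'c \<Rightarrow> 'k) set) \<Rightarrow> 'k \<Rightarrow>
   (('a \<times> 'a \<Rightarrow> 'k) set \<Rightarrow> ('a \<times> 'a \<Rightarrow> 'k) set) \<Rightarrow>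
   (('c \<times> 'c \<Rightarrow> 'k) set \<Rightarrow> ('c \<times> 'c \<Rightarrow> 'k) set) \<Rightarrow>
   (('a \<times> 'c) \<times> ('a \<times> 'c) \<Rightarrow> 'k) set \<Rightarrow> (('a \<times> 'c) \<times> ('a \<times> 'c) \<Rightarrow> 'k) set"
  where "entwined_sum K A C \<psi> q R R' X =
    (let V = direct_sum A C; VV = V \<boxtimes>\<^bsub>K\<^esub> V;
         inA = (\<lambda>a. (a, \<zero>\<^bsub>C\<^esub>)); inC = (\<lambda>c. (\<zero>\<^bsub>A\<^esub>, c));
         \<psi>inv = inv_into (carrier (C \<boxtimes>\<^bsub>K\<^esub> A)) \<psi>;
         XAA = tensor_map K V V A A fst fst X;
         XCC = tensor_map K V V C C snd snd X;
         XAC = tensor_map K V V A C fst snd X;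
         XCA = tensor_map K V V C A snd fst X
     in tensor_map K A A V V inA inA (R XAA)
        \<oplus>\<^bsub>VV\<^esub> tensor_map K C C V V inC inC (R' XCC)
        \<oplus>\<^bsub>VV\<^esub> tensor_map K C A V V inC inA (\<psi>inv XAC)
        \<oplus>\<^bsub>VV\<^esub> (tensor_map K A C V V inA inC (\<psi> XCA)
               \<oplus>\<^bsub>VV\<^esub> (q \<ominus>\<^bsub>K\<^esub> inv\<^bsub>K\<^esub> q) \<odot>\<^bsub>VV\<^esub> tensor_map K C A V V inC inA XCA))"

end

theory Submission
  imports Defs
begin

text \<open>Write \<open>p\<close> for the inverse of \<open>q\<close>, \<open>l = q - p\<close>, \<open>V = A \<oplus> C\<close>, and \<open>T\<close> for the operator on \<open>V \<otimes> V\<close>. The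
operators on the two summands have the form \<open>P - p\<close>: on the algebra, \<open>R = P - p\<close> with
\<open>P (a \<otimes> b) = p (ab \<otimes> 1) + q (1 \<otimes> ab)\<close>, and on the coalgebra, \<open>R' = P' - p\<close> with
\<open>P' (c \<otimes> d) = q \<epsilon>(d) \<Delta>(c) + p \<epsilon>(c) \<Delta>(d)\<close>. In both cases \<open>P\<^sup>2 = (p + q) P\<close>, which gives the
quadratic relation \<open>R\<^sup>2 = 1 + l R\<close> (\<open>quadratic_relation\<close>), and the two amplifications
\<open>P12 = P \<otimes> id\<close> and \<open>P23 = id \<otimes> P\<close> to three tensor factors satisfy the Temperley-Lieb type relation
\<open>P12 P23 P12 + P23 = P23 P12 P23 + P12\<close>, which together with the quadratic relation is equivalent
to the braid equation for \<open>R\<close> (\<open>braid_relation\<close>). Stating everything in terms of \<open>P\<close> and of sums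
without minus signs reduces these computations to distributivity and reordering of sums.

The axioms of an entwining structure say exactly what is needed to move \<open>P\<close> and \<open>P'\<close> past \<open>\<psi>\<close>:
compatibility with the product and the unit gives \<open>R12 \<psi>23 \<psi>12 = \<psi>23 \<psi>12 R23\<close> on
\<open>C \<otimes> A \<otimes> A\<close> (\<open>entwining_alg_op_R\<close>), and compatibility with the coproduct and the counit gives
\<open>R'23 \<psi>12 \<psi>23 = \<psi>12 \<psi>23 R'12\<close> on \<open>C \<otimes> C \<otimes> A\<close> (\<open>entwining_coalg_op_R'\<close>). Conjugating with \<open>\<psi>\<close>
yields the analogous relations on the other mixed triple products.

The relation \<open>T\<^sup>2 = 1 + l T\<close> is checked on the four summands of \<open>V \<otimes> V\<close>; on \<open>A \<otimes> C\<close> and \<open>C \<otimes> A\<close> it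
holds because \<open>T\<close> is \<open>\<psi>\<close> inverse on the former and \<open>\<psi> + l\<close> on the latter. It gives the Hecke
relation as well as the inverse \<open>T - l\<close>. The braid equation is checked on the eight summands of
\<open>V \<otimes> V \<otimes> V\<close>: on \<open>A \<otimes> A \<otimes> A\<close> and \<open>C \<otimes> C \<otimes> C\<close> it is the braid equation of \<open>R\<close> and of \<open>R'\<close>, and on
the six mixed summands it reduces to one of the intertwining relations and, on \<open>C \<otimes> A \<otimes> A\<close> and
\<open>C \<otimes> C \<otimes> A\<close>, to the quadratic relations of \<open>R\<close> and \<open>R'\<close>.

The tensor products are concrete quotients of free spaces, so their module structure and universal
property come first; afterwards all identities of linear maps are proved on pure tensors.\<close>

section \<open>Linear maps\<close>

lemma linear_mapI:
  assumes "\<And>x. x \<in> carrier V \<Longrightarrow> f x \<in> carrier W"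
    and "\<And>x y. \<lbrakk>x \<in> carrier V; y \<in> carrier V\<rbrakk> \<Longrightarrow> f (x \<oplus>\<^bsub>V\<^esub> y) = f x \<oplus>\<^bsub>W\<^esub> f y"
    and "\<And>r x. \<lbrakk>r \<in> carrier K; x \<in> carrier V\<rbrakk> \<Longrightarrow> f (r \<odot>\<^bsub>V\<^esub> x) = r \<odot>\<^bsub>W\<^esub> f x"
  shows "linear_map K V W f"
  using assms by (auto simp: linear_map_def)

lemma linear_mapD:
  assumes "linear_map K V W f"
  shows "x \<in> carrier V \<Longrightarrow> f x \<in> carrier W"
    and "\<lbrakk>x \<in> carrier V; y \<in> carrier V\<rbrakk> \<Longrightarrow> f (x \<oplus>\<^bsub>V\<^esub> y) = f x \<oplus>\<^bsub>W\<^esub> f y"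
    and "\<lbrakk>r \<in> carrier K; x \<in> carrier V\<rbrakk> \<Longrightarrow> f (r \<odot>\<^bsub>V\<^esub> x) = r \<odot>\<^bsub>W\<^esub> f x"
  using assms by (auto simp: linear_map_def)

lemma linear_map_zero:
  assumes "module K V" "module K W" "linear_map K V W f"
  shows "f \<zero>\<^bsub>V\<^esub> = \<zero>\<^bsub>W\<^esub>"
proof -
  interpret V: module K V by fact
  interpret W: module K W by fact
  have "f (\<zero>\<^bsub>K\<^esub> \<odot>\<^bsub>V\<^esub> \<zero>\<^bsub>V\<^esub>) = \<zero>\<^bsub>K\<^esub> \<odot>\<^bsub>W\<^esub> f \<zero>\<^bsub>V\<^esub>"
    by (rule linear_mapD(3)[OF assms(3)]) auto
  then show ?thesis
    using linear_mapD(1)[OF assms(3)] by simp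
qed

lemma linear_map_minus:
  assumes "module K V" "module K W" "linear_map K V W f" "x \<in> carrier V"
  shows "f (\<ominus>\<^bsub>V\<^esub> x) = \<ominus>\<^bsub>W\<^esub> f x"
proof -
  interpret V: module K V by fact
  interpret W: module K W by fact
  have "f (\<ominus>\<^bsub>V\<^esub> x) \<oplus>\<^bsub>W\<^esub> f x = f (\<ominus>\<^bsub>V\<^esub> x \<oplus>\<^bsub>V\<^esub> x)"
    using assms(4) by (simp add: linear_mapD(2)[OF assms(3)])
  also have "\<dots> = \<zero>\<^bsub>W\<^esub>"
    using assms(4) by (simp add: V.l_neg linear_map_zero[OF assms(1-3)])
  finally show ?thesis
    using assms(4) linear_mapD(1)[OF assms(3)] by (simp add: W.minus_equality)
qed

lemma linear_map_diff:
  assumes "module K V" "module K W" "linear_map K V W f" "x \<in> carrier V" "y \<in> carrier V"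
  shows "f (x \<ominus>\<^bsub>V\<^esub> y) = f x \<ominus>\<^bsub>W\<^esub> f y"
proof -
  interpret V: module K V by fact
  show ?thesis
    using assms(4,5)
    by (simp add: a_minus_def linear_mapD(2)[OF assms(3)] linear_map_minus[OF assms(1-3)])
qed

lemma linear_map_comp:
  assumes "linear_map K U V f" "linear_map K V W g"
  shows "linear_map K U W (g \<circ> f)" "linear_map K U W (\<lambda>x. g (f x))"
  using assms by (auto simp: linear_map_def Pi_iff)

lemma linear_map_id: "linear_map K V V (\<lambda>x. x)"
  by (auto simp: linear_map_def)

lemma linear_map_add:
  assumes "module K W" "linear_map K V W f" "linear_map K V W g"
  shows "linear_map K V W (\<lambda>x. f x \<oplus>\<^bsub>W\<^esub> g x)"
proof -
  interpret W: module K W by fact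
  show ?thesis
    by (rule linear_mapI)
      (auto simp: linear_mapD[OF assms(2)] linear_mapD[OF assms(3)] W.smult_r_distr W.a_ac)
qed

lemma linear_map_smult:
  assumes "module K W" "linear_map K V W f" "r \<in> carrier K"
  shows "linear_map K V W (\<lambda>x. r \<odot>\<^bsub>W\<^esub> f x)"
proof -
  interpret W: module K W by fact
  show ?thesis
    using assms(3)
    by (intro linear_mapI)
      (auto simp: linear_mapD[OF assms(2)] W.smult_r_distr W.smult_assoc1[symmetric] W.m_comm)
qed

lemma linear_map_uminus:
  assumes "module K W" "linear_map K V W f"
  shows "linear_map K V W (\<lambda>x. \<ominus>\<^bsub>W\<^esub> f x)"
proof -
  interpret W: module K W by fact
  show ?thesis
    by (intro linear_mapI)
      (auto simp: linear_mapD[OF assms(2)] W.smult_r_minus W.minus_add)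
qed

lemma linear_map_minus_fun:
  assumes "module K W" "linear_map K V W f" "linear_map K V W g"
  shows "linear_map K V W (\<lambda>x. f x \<ominus>\<^bsub>W\<^esub> g x)"
  using linear_map_add[OF assms(1,2) linear_map_uminus[OF assms(1,3)]]
  by (simp add: a_minus_def)

lemma linear_map_inv_into:
  assumes "module K V" "linear_map K V W f" "bij_betw f (carrier V) (carrier W)"
  shows "linear_map K W V (inv_into (carrier V) f)"
proof -
  interpret V: module K V by fact
  let ?g = "inv_into (carrier V) f"
  have inj: "inj_on f (carrier V)" and img: "f ` carrier V = carrier W"
    using assms(3) by (auto simp: bij_betw_def)
  have g: "?g y \<in> carrier V" "f (?g y) = y" if "y \<in> carrier W" for y
    using that img by (auto simp: inv_into_into f_inv_into_f)
  show ?thesis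
  proof (rule linear_mapI)
    fix x y assume xy: "x \<in> carrier W" "y \<in> carrier W"
    then have "f (?g x \<oplus>\<^bsub>V\<^esub> ?g y) = x \<oplus>\<^bsub>W\<^esub> y"
      using g by (simp add: linear_mapD[OF assms(2)])
    then show "?g (x \<oplus>\<^bsub>W\<^esub> y) = ?g x \<oplus>\<^bsub>V\<^esub> ?g y"
      using xy g by (intro inv_into_f_eq[OF inj]) auto
  next
    fix r x assume rx: "r \<in> carrier K" "x \<in> carrier W"
    then have "f (r \<odot>\<^bsub>V\<^esub> ?g x) = r \<odot>\<^bsub>W\<^esub> x"
      using g by (simp add: linear_mapD[OF assms(2)])
    then show "?g (r \<odot>\<^bsub>W\<^esub> x) = r \<odot>\<^bsub>V\<^esub> ?g x"
      using rx g by (intro inv_into_f_eq[OF inj]) auto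
  qed (use g in auto)
qed

lemma ground_space_module:
  assumes "cring K"
  shows "module K (ground_space K)"
proof -
  interpret K: cring K by fact
  show ?thesis
  proof (intro moduleI abelian_groupI)
    fix x assume "x \<in> carrier (ground_space K)"
    then show "\<exists>y\<in>carrier (ground_space K). y \<oplus>\<^bsub>ground_space K\<^esub> x = \<zero>\<^bsub>ground_space K\<^esub>"
      by (intro bexI[of _ "\<ominus>\<^bsub>K\<^esub> x"]) (auto simp: ground_space_def K.l_neg)
  qed (auto simp: ground_space_def K.cring_axioms K.l_distr K.r_distr K.m_assoc K.a_ac)
qed

lemma direct_sum_module:
  assumes "module K V" "module K W"
  shows "module K (direct_sum V W)"
proof -
  interpret V: module K V by fact
  interpret W: module K W by fact
  show ?thesis
  proof (intro moduleI abelian_groupI)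
    fix x assume "x \<in> carrier (direct_sum V W)"
    then show "\<exists>y\<in>carrier (direct_sum V W). y \<oplus>\<^bsub>direct_sum V W\<^esub> x = \<zero>\<^bsub>direct_sum V W\<^esub>"
      by (intro bexI[of _ "(\<ominus>\<^bsub>V\<^esub> fst x, \<ominus>\<^bsub>W\<^esub> snd x)"])
        (auto simp: direct_sum_def V.l_neg W.l_neg)
  qed (auto simp: direct_sum_def V.cring_axioms V.a_ac W.a_ac V.smult_l_distr W.smult_l_distr
      V.smult_r_distr W.smult_r_distr V.smult_assoc1 W.smult_assoc1)
qed

lemma direct_sum_linear:
  assumes "module K V" "module K W"
  shows "linear_map K V (direct_sum V W) (\<lambda>v. (v, \<zero>\<^bsub>W\<^esub>))"
    and "linear_map K W (direct_sum V W) (\<lambda>w. (\<zero>\<^bsub>V\<^esub>, w))"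
    and "linear_map K (direct_sum V W) V fst"
    and "linear_map K (direct_sum V W) W snd"
proof -
  interpret V: module K V by fact
  interpret W: module K W by fact
  show "linear_map K V (direct_sum V W) (\<lambda>v. (v, \<zero>\<^bsub>W\<^esub>))"
    "linear_map K W (direct_sum V W) (\<lambda>w. (\<zero>\<^bsub>V\<^esub>, w))"
    "linear_map K (direct_sum V W) V fst"
    "linear_map K (direct_sum V W) W snd"
    by (auto simp: linear_map_def direct_sum_def)
qed

section \<open>Free spaces\<close>

lemma free_spaceD:
  assumes "cring K" "f \<in> carrier (free_space K S)"
  shows "f s \<in> carrier K" "s \<notin> S \<Longrightarrow> f s = \<zero>\<^bsub>K\<^esub>" "finite {s. f s \<noteq> \<zero>\<^bsub>K\<^esub>}"
proof -
  interpret K: cring K by fact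
  show "f s \<in> carrier K"
    using assms(2) by (cases "s \<in> S") (auto simp: free_space_def)
qed (use assms(2) in \<open>auto simp: free_space_def\<close>)

lemma free_spaceI:
  assumes "\<And>s. f s \<in> carrier K" "\<And>s. s \<notin> S \<Longrightarrow> f s = \<zero>\<^bsub>K\<^esub>"
    and "finite B" "{s. f s \<noteq> \<zero>\<^bsub>K\<^esub>} \<subseteq> B"
  shows "f \<in> carrier (free_space K S)"
  using assms finite_subset[OF assms(4,3)] by (simp add: free_space_def)

lemma free_space_simps:
  "\<zero>\<^bsub>free_space K S\<^esub> = (\<lambda>_. \<zero>\<^bsub>K\<^esub>)"
  "f \<oplus>\<^bsub>free_space K S\<^esub> g = (\<lambda>s. f s \<oplus>\<^bsub>K\<^esub> g s)"
  "r \<odot>\<^bsub>free_space K S\<^esub> f = (\<lambda>s. r \<otimes>\<^bsub>K\<^esub> f s)"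
  by (simp_all add: free_space_def)

lemma free_space_module:
  assumes "cring K"
  shows "module K (free_space K S)"
proof -
  interpret K: cring K by fact
  let ?F = "free_space K S"
  note c = free_spaceD(1)[OF assms] and z = free_spaceD(2)[OF assms]
    and fin = free_spaceD(3)[OF assms]
  show ?thesis
  proof (intro moduleI abelian_groupI)
    fix f g assume fg: "f \<in> carrier ?F" "g \<in> carrier ?F"
    show "f \<oplus>\<^bsub>?F\<^esub> g \<in> carrier ?F"
      by (rule free_spaceI[of _ _ _ "{s. f s \<noteq> \<zero>\<^bsub>K\<^esub>} \<union> {s. g s \<noteq> \<zero>\<^bsub>K\<^esub>}"])
        (use c[OF fg(1)] c[OF fg(2)] z[OF fg(1)] z[OF fg(2)] fin[OF fg(1)] fin[OF fg(2)] in \<open>auto simp: free_space_simps\<close>)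
  next
    fix r f assume rf: "r \<in> carrier K" "f \<in> carrier ?F"
    show "r \<odot>\<^bsub>?F\<^esub> f \<in> carrier ?F"
      by (rule free_spaceI[of _ _ _ "{s. f s \<noteq> \<zero>\<^bsub>K\<^esub>}"])
        (use rf(1) c[OF rf(2)] z[OF rf(2)] fin[OF rf(2)] in \<open>auto simp: free_space_simps\<close>)
  next
    fix f assume f: "f \<in> carrier ?F"
    have "(\<lambda>s. \<ominus>\<^bsub>K\<^esub> f s) \<in> carrier ?F"
      by (rule free_spaceI[of _ _ _ "{s. f s \<noteq> \<zero>\<^bsub>K\<^esub>}"]) (use c[OF f] z[OF f] fin[OF f] in auto)
    then show "\<exists>g\<in>carrier ?F. g \<oplus>\<^bsub>?F\<^esub> f = \<zero>\<^bsub>?F\<^esub>"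
      by (rule bexI[rotated]) (simp add: free_space_simps c[OF f] K.l_neg)
  next
    show "\<zero>\<^bsub>?F\<^esub> \<in> carrier ?F"
      by (rule free_spaceI[of _ _ _ "{}"]) (auto simp: free_space_simps)
  qed (simp_all add: free_space_simps c assms K.a_ac K.l_distr K.r_distr K.m_assoc)
qed

lemma free_gen_closed:
  assumes "cring K" "s \<in> S"
  shows "free_gen K s \<in> carrier (free_space K S)"
proof -
  interpret K: cring K by fact
  show ?thesis
    by (rule free_spaceI[of _ _ _ "{s}"]) (use assms(2) in \<open>auto simp: free_gen_def\<close>)
qed

text \<open>A property of the zero function that is preserved by adding a multiple of a generator holds on
  the whole free space, by induction on the support.\<close>

lemma free_space_induct [consumes 2, case_names zero add]:
  assumes "cring K" "f \<in> carrier (free_space K S)"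
    and zero: "P \<zero>\<^bsub>free_space K S\<^esub>"
    and add: "\<And>r s g. \<lbrakk>r \<in> carrier K; s \<in> S; g \<in> carrier (free_space K S); P g\<rbrakk> \<Longrightarrow>
      P (r \<odot>\<^bsub>free_space K S\<^esub> free_gen K s \<oplus>\<^bsub>free_space K S\<^esub> g)"
  shows "P f"
proof -
  interpret K: cring K by fact
  let ?F = "free_space K S"
  have "\<forall>f\<in>carrier ?F. {s. f s \<noteq> \<zero>\<^bsub>K\<^esub>} \<subseteq> B \<longrightarrow> P f" if "finite B" for B
    using that
  proof (induction B)
    case empty
    have "f = \<zero>\<^bsub>?F\<^esub>" if "{s. f s \<noteq> \<zero>\<^bsub>K\<^esub>} \<subseteq> {}" for f
      using that by (auto simp: free_space_simps)
    then show ?case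
      using zero by auto
  next
    case (insert t B)
    show ?case
    proof (intro ballI impI)
      fix f assume f: "f \<in> carrier ?F" "{s. f s \<noteq> \<zero>\<^bsub>K\<^esub>} \<subseteq> insert t B"
      define g where "g = f(t := \<zero>\<^bsub>K\<^esub>)"
      note fc = free_spaceD(1)[OF assms(1) f(1)] and fz = free_spaceD(2)[OF assms(1) f(1)]
      have g: "g \<in> carrier ?F"
        by (rule free_spaceI[OF _ _ free_spaceD(3)[OF assms(1) f(1)]])
          (use fc fz in \<open>auto simp: g_def\<close>)
      have "P g"
        by (rule insert.IH[rule_format, OF g]) (use f(2) in \<open>auto simp: g_def\<close>)
      show "P f"
      proof (cases "t \<in> S")
        case True
        have "f = f t \<odot>\<^bsub>?F\<^esub> free_gen K t \<oplus>\<^bsub>?F\<^esub> g"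
          using fc by (auto simp: free_space_simps free_gen_def g_def)
        then show ?thesis
          using add[OF fc True g \<open>P g\<close>] by metis
      next
        case False
        then have "f = g"
          using fz by (auto simp: g_def)
        then show ?thesis
          using \<open>P g\<close> by simp
      qed
    qed
  qed
  moreover have "finite {s. f s \<noteq> \<zero>\<^bsub>K\<^esub>}"
    by (rule free_spaceD(3)[OF assms(1,2)])
  ultimately show ?thesis
    using assms(2) by blast
qed

text \<open>The linear extension to the free space of a map \<open>b\<close> on generators, as a finite sum over the
  support. It is meaningful for arguments in the free space on a set that \<open>b\<close> maps to the carrier
  of \<open>U\<close>.\<close>

definition free_lift ::
  "('k, 'm) ring_scheme \<Rightarrow> ('k, 'u) module \<Rightarrow> ('s \<Rightarrow> 'u) \<Rightarrow> ('s \<Rightarrow> 'k) \<Rightarrow> 'u"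
  where "free_lift K U b x = (\<Oplus>\<^bsub>U\<^esub>p\<in>{p. x p \<noteq> \<zero>\<^bsub>K\<^esub>}. x p \<odot>\<^bsub>U\<^esub> b p)"

lemma free_lift_superset:
  assumes "module K U" "x \<in> carrier (free_space K S)" "b \<in> S \<rightarrow> carrier U"
    and "finite B" "{p. x p \<noteq> \<zero>\<^bsub>K\<^esub>} \<subseteq> B" "B \<subseteq> S"
  shows "free_lift K U b x = (\<Oplus>\<^bsub>U\<^esub>p\<in>B. x p \<odot>\<^bsub>U\<^esub> b p)"
proof -
  interpret U: module K U by fact
  show ?thesis
    unfolding free_lift_def
    by (rule U.add.finprod_mono_neutral_cong_left)
      (use assms(3-6) free_spaceD(1)[OF U.cring_axioms assms(2)] in
        \<open>auto simp: Pi_iff subset_iff\<close>)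
qed

lemma free_lift_linear:
  fixes K :: "('k, 'm) ring_scheme" and b :: "'s \<Rightarrow> 'u"
  assumes "module K U" "b \<in> S \<rightarrow> carrier U"
  shows "linear_map K (free_space K S) U (free_lift K U b)"
proof -
  interpret U: module K U by fact
  let ?F = "free_space K S"
  interpret F: module K ?F
    using U.cring_axioms by (rule free_space_module)
  define supp where "supp f = {s. f s \<noteq> \<zero>\<^bsub>K\<^esub>}" for f :: "'s \<Rightarrow> 'k"
  have supp: "finite (supp f)" "supp f \<subseteq> S" if "f \<in> carrier ?F" for f
    using free_spaceD(2,3)[OF U.cring_axioms that] by (auto simp: supp_def)
  note fc = free_spaceD(1)[OF U.cring_axioms]
  have lift: "free_lift K U b x = (\<Oplus>\<^bsub>U\<^esub>p\<in>B. x p \<odot>\<^bsub>U\<^esub> b p)"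
    if "x \<in> carrier ?F" "finite B" "supp x \<subseteq> B" "B \<subseteq> S" for x B
    using free_lift_superset[OF assms(1) that(1) assms(2) that(2)] that(3,4)
    by (simp add: supp_def)
  have bc: "x p \<odot>\<^bsub>U\<^esub> b p \<in> carrier U" if "x \<in> carrier ?F" "p \<in> S" for x p
    by (intro U.smult_closed fc[OF that(1)] funcset_mem[OF assms(2) that(2)])
  show ?thesis
  proof (rule linear_mapI)
    fix x assume x: "x \<in> carrier ?F"
    show "free_lift K U b x \<in> carrier U"
      unfolding lift[OF x supp(1)[OF x] order_refl supp(2)[OF x]]
      using supp(2)[OF x] bc[OF x] by (intro U.finsum_closed) auto
  next
    fix x y assume x: "x \<in> carrier ?F" and y: "y \<in> carrier ?F"
    let ?B = "supp x \<union> supp y"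
    have B: "finite ?B" "?B \<subseteq> S"
      using supp[OF x] supp[OF y] by auto
    have xy: "x \<oplus>\<^bsub>?F\<^esub> y \<in> carrier ?F"
      using x y by simp
    have "supp (x \<oplus>\<^bsub>?F\<^esub> y) \<subseteq> ?B"
      by (auto simp: supp_def free_space_simps)
    then have "free_lift K U b (x \<oplus>\<^bsub>?F\<^esub> y) = (\<Oplus>\<^bsub>U\<^esub>p\<in>?B. (x \<oplus>\<^bsub>?F\<^esub> y) p \<odot>\<^bsub>U\<^esub> b p)"
      by (intro lift xy B)
    also have "\<dots> = (\<Oplus>\<^bsub>U\<^esub>p\<in>?B. x p \<odot>\<^bsub>U\<^esub> b p \<oplus>\<^bsub>U\<^esub> y p \<odot>\<^bsub>U\<^esub> b p)"
      by (intro U.add.finprod_cong')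
        (use B(2) fc[OF x] fc[OF y] bc[OF x] bc[OF y] assms(2) in
          \<open>auto simp: free_space_simps Pi_iff subset_iff U.smult_l_distr\<close>)
    also have "\<dots> = (\<Oplus>\<^bsub>U\<^esub>p\<in>?B. x p \<odot>\<^bsub>U\<^esub> b p) \<oplus>\<^bsub>U\<^esub> (\<Oplus>\<^bsub>U\<^esub>p\<in>?B. y p \<odot>\<^bsub>U\<^esub> b p)"
      by (intro U.finsum_addf) (use B(2) bc[OF x] bc[OF y] in auto)
    finally show "free_lift K U b (x \<oplus>\<^bsub>?F\<^esub> y) = free_lift K U b x \<oplus>\<^bsub>U\<^esub> free_lift K U b y"
      using lift[OF x B(1) _ B(2)] lift[OF y B(1) _ B(2)] by simp
  next
    fix r x assume r: "r \<in> carrier K" and x: "x \<in> carrier ?F"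
    have rx: "r \<odot>\<^bsub>?F\<^esub> x \<in> carrier ?F"
      using r x by simp
    have "supp (r \<odot>\<^bsub>?F\<^esub> x) \<subseteq> supp x"
      using r by (auto simp: supp_def free_space_simps)
    then have "free_lift K U b (r \<odot>\<^bsub>?F\<^esub> x) = (\<Oplus>\<^bsub>U\<^esub>p\<in>supp x. (r \<odot>\<^bsub>?F\<^esub> x) p \<odot>\<^bsub>U\<^esub> b p)"
      by (intro lift rx supp[OF x])
    also have "\<dots> = (\<Oplus>\<^bsub>U\<^esub>p\<in>supp x. r \<odot>\<^bsub>U\<^esub> (x p \<odot>\<^bsub>U\<^esub> b p))"
      by (intro U.add.finprod_cong')
        (use supp(2)[OF x] fc[OF x] bc[OF x] assms(2) r in
          \<open>auto simp: free_space_simps Pi_iff subset_iff U.smult_assoc1\<close>)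
    also have "\<dots> = r \<odot>\<^bsub>U\<^esub> (\<Oplus>\<^bsub>U\<^esub>p\<in>supp x. x p \<odot>\<^bsub>U\<^esub> b p)"
      by (intro U.finsum_smult_ldistr[symmetric]) (use supp[OF x] bc[OF x] r in auto)
    finally show "free_lift K U b (r \<odot>\<^bsub>?F\<^esub> x) = r \<odot>\<^bsub>U\<^esub> free_lift K U b x"
      using lift[OF x supp(1)[OF x] order_refl supp(2)[OF x]] by simp
  qed
qed

lemma free_lift_gen:
  assumes "module K U" "b \<in> S \<rightarrow> carrier U" "s \<in> S"
  shows "free_lift K U b (free_gen K s) = b s"
proof -
  interpret U: module K U by fact
  have "free_lift K U b (free_gen K s) = (\<Oplus>\<^bsub>U\<^esub>p\<in>{s}. free_gen K s p \<odot>\<^bsub>U\<^esub> b p)"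
    by (rule free_lift_superset[OF assms(1) free_gen_closed[OF U.cring_axioms assms(3)] assms(2)])
      (use assms(3) in \<open>auto simp: free_gen_def\<close>)
  also have "\<dots> = b s"
    using funcset_mem[OF assms(2,3)] by (subst U.add.finprod_insert) (auto simp: free_gen_def)
  finally show ?thesis .
qed

section \<open>Tensor products\<close>

lemma generated_submodule_submodule:
  assumes "module K V" "X \<subseteq> carrier V"
  shows "submodule (generated_submodule K V X) K V"
proof -
  interpret V: module K V by fact
  note E = V.submoduleE
  show ?thesis
  proof (rule V.submoduleI)
    show "generated_submodule K V X \<subseteq> carrier V"
      using V.carrier_is_submodule assms(2) by (auto simp: generated_submodule_def)
    show "\<zero>\<^bsub>V\<^esub> \<in> generated_submodule K V X"
      by (auto simp: generated_submodule_def intro: subgroup.one_closed[OF submodule.axioms(1), simplified])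
  qed (auto simp: generated_submodule_def dest: E)
qed

lemma generated_submodule_superset: "X \<subseteq> generated_submodule K V X"
  by (auto simp: generated_submodule_def)

lemma generated_submodule_least:
  "submodule H K V \<Longrightarrow> X \<subseteq> H \<Longrightarrow> generated_submodule K V X \<subseteq> H"
  by (auto simp: generated_submodule_def)

text \<open>The space whose quotient is \<open>V \<otimes> W\<close>, and the quotient map.\<close>

abbreviation (input) pair_space ::
  "('k, 'm) ring_scheme \<Rightarrow> ('k, 'v) module \<Rightarrow> ('k, 'w) module \<Rightarrow> ('k, 'v \<times> 'w \<Rightarrow> 'k) module"
  where "pair_space K V W \<equiv> free_space K (carrier V \<times> carrier W)"

definition tensor_class ::
  "('k, 'm) ring_scheme \<Rightarrow> ('k, 'v) module \<Rightarrow> ('k, 'w) module \<Rightarrow>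
   ('v \<times> 'w \<Rightarrow> 'k) \<Rightarrow> ('v \<times> 'w \<Rightarrow> 'k) set"
  where "tensor_class K V W f = tensor_kernel K V W +>\<^bsub>pair_space K V W\<^esub> f"

lemma bilinear_relations_closed:
  assumes "module K V" "module K W"
  shows "bilinear_relations K V W \<subseteq> carrier (pair_space K V W)"
proof -
  interpret V: module K V by fact
  interpret W: module K W by fact
  interpret F: module K "pair_space K V W"
    using V.cring_axioms by (rule free_space_module)
  have e: "free_gen K (v, w) \<in> carrier (pair_space K V W)"
    if "v \<in> carrier V" "w \<in> carrier W" for v w
    using that by (intro free_gen_closed[OF V.cring_axioms] SigmaI)
  show ?thesis
    unfolding bilinear_relations_def Let_def
    by (intro Un_least subsetI; elim CollectE exE conjE; hypsubst)
      (intro F.minus_closed F.a_closed F.smult_closed V.a_closed W.a_closed V.smult_closed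
        W.smult_closed e; assumption)+
qed

lemma tensor_kernel_submodule:
  assumes "module K V" "module K W"
  shows "submodule (tensor_kernel K V W) K (pair_space K V W)"
  unfolding tensor_kernel_def
  using assms free_space_module[of K] bilinear_relations_closed[OF assms]
  by (intro generated_submodule_submodule) (auto simp: module_def)

lemma tensor_kernel_subgroup:
  assumes "module K V" "module K W"
  shows "abelian_subgroup (tensor_kernel K V W) (pair_space K V W)"
proof -
  interpret V: module K V by fact
  interpret F: module K "pair_space K V W"
    using V.cring_axioms by (rule free_space_module)
  show ?thesis
    using submodule.axioms(1)[OF tensor_kernel_submodule[OF assms]]
    by (intro abelian_subgroupI3 additive_subgroupI F.abelian_group_axioms)
qed

lemma tensor_space_carrier:
  "carrier (V \<boxtimes>\<^bsub>K\<^esub> W) = tensor_class K V W ` carrier (pair_space K V W)"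
  by (auto simp: tensor_space_def tensor_class_def Let_def A_RCOSETS_def')

lemma tensor_space_zero:
  assumes "module K V" "module K W"
  shows "\<zero>\<^bsub>V \<boxtimes>\<^bsub>K\<^esub> W\<^esub> = tensor_class K V W \<zero>\<^bsub>pair_space K V W\<^esub>"
proof -
  interpret N: abelian_subgroup "tensor_kernel K V W" "pair_space K V W"
    using assms by (rule tensor_kernel_subgroup)
  show ?thesis
    using N.a_subset by (simp add: tensor_space_def Let_def tensor_class_def)
qed

lemma tensor_space_add:
  assumes "module K V" "module K W"
    and "f \<in> carrier (pair_space K V W)" "g \<in> carrier (pair_space K V W)"
  shows "tensor_class K V W f \<oplus>\<^bsub>V \<boxtimes>\<^bsub>K\<^esub> W\<^esub> tensor_class K V W g =
    tensor_class K V W (f \<oplus>\<^bsub>pair_space K V W\<^esub> g)"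
proof -
  interpret N: abelian_subgroup "tensor_kernel K V W" "pair_space K V W"
    using assms(1,2) by (rule tensor_kernel_subgroup)
  show ?thesis
    using assms(3,4) by (simp add: tensor_space_def Let_def tensor_class_def N.a_rcos_sum)
qed

lemma tensor_class_eqI:
  assumes "module K V" "module K W"
    and "f \<in> carrier (pair_space K V W)" "g \<in> carrier (pair_space K V W)"
    and "f \<ominus>\<^bsub>pair_space K V W\<^esub> g \<in> tensor_kernel K V W"
  shows "tensor_class K V W f = tensor_class K V W g"
proof -
  interpret N: abelian_subgroup "tensor_kernel K V W" "pair_space K V W"
    using assms(1,2) by (rule tensor_kernel_subgroup)
  have "f \<in> tensor_class K V W g"
    using assms(3-5) by (simp add: tensor_class_def N.a_rcos_module a_minus_def)
  then show ?thesis
    using assms(4) N.a_repr_independence' by (simp add: tensor_class_def)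
qed

lemma tensor_space_smult:
  assumes "module K V" "module K W"
    and "r \<in> carrier K" "f \<in> carrier (pair_space K V W)"
  shows "r \<odot>\<^bsub>V \<boxtimes>\<^bsub>K\<^esub> W\<^esub> tensor_class K V W f =
    tensor_class K V W (r \<odot>\<^bsub>pair_space K V W\<^esub> f)"
proof -
  let ?F = "pair_space K V W" and ?N = "tensor_kernel K V W"
  interpret V: module K V by fact
  interpret F: module K ?F
    using V.cring_axioms by (rule free_space_module)
  interpret N: abelian_subgroup ?N ?F
    using assms(1,2) by (rule tensor_kernel_subgroup)
  interpret S: submodule ?N K ?F
    using assms(1,2) by (rule tensor_kernel_submodule)
  have 1: "x \<in> ?N +>\<^bsub>?F\<^esub> (r \<odot>\<^bsub>?F\<^esub> f)"
    if "n \<in> ?N" "m \<in> ?N" "x = n \<oplus>\<^bsub>?F\<^esub> r \<odot>\<^bsub>?F\<^esub> (m \<oplus>\<^bsub>?F\<^esub> f)" for x n m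
  proof -
    have "x = (n \<oplus>\<^bsub>?F\<^esub> r \<odot>\<^bsub>?F\<^esub> m) \<oplus>\<^bsub>?F\<^esub> r \<odot>\<^bsub>?F\<^esub> f"
      using that assms(3,4) by (simp add: F.smult_r_distr F.a_assoc)
    moreover have "n \<oplus>\<^bsub>?F\<^esub> r \<odot>\<^bsub>?F\<^esub> m \<in> ?N"
      using that assms(3) by auto
    ultimately show ?thesis
      by (auto simp: a_r_coset_def')
  qed
  have 2: "x \<in> ?N <+>\<^bsub>?F\<^esub> ((\<lambda>x. r \<odot>\<^bsub>?F\<^esub> x) ` (?N +>\<^bsub>?F\<^esub> f))"
    if x: "x \<in> ?N +>\<^bsub>?F\<^esub> (r \<odot>\<^bsub>?F\<^esub> f)" for x
  proof -
    obtain n where n: "n \<in> ?N" "x = n \<oplus>\<^bsub>?F\<^esub> r \<odot>\<^bsub>?F\<^esub> f"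
      using x by (auto simp: a_r_coset_def')
    moreover have "f \<in> ?N +>\<^bsub>?F\<^esub> f"
      using assms(4) by (rule N.a_rcos_self)
    ultimately show ?thesis
      by (auto simp: set_add_def')
  qed
  have "?N <+>\<^bsub>?F\<^esub> ((\<lambda>x. r \<odot>\<^bsub>?F\<^esub> x) ` (?N +>\<^bsub>?F\<^esub> f)) = ?N +>\<^bsub>?F\<^esub> (r \<odot>\<^bsub>?F\<^esub> f)"
  proof (intro equalityI subsetI)
    fix x assume "x \<in> ?N <+>\<^bsub>?F\<^esub> ((\<lambda>x. r \<odot>\<^bsub>?F\<^esub> x) ` (?N +>\<^bsub>?F\<^esub> f))"
    then obtain n m where "n \<in> ?N" "m \<in> ?N" "x = n \<oplus>\<^bsub>?F\<^esub> r \<odot>\<^bsub>?F\<^esub> (m \<oplus>\<^bsub>?F\<^esub> f)"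
      by (auto simp: set_add_def' a_r_coset_def')
    then show "x \<in> ?N +>\<^bsub>?F\<^esub> (r \<odot>\<^bsub>?F\<^esub> f)"
      by (rule 1)
  qed (rule 2)
  then show ?thesis
    by (simp add: tensor_space_def Let_def tensor_class_def)
qed

lemma tensor_space_module:
  assumes "module K V" "module K W"
  shows "module K (V \<boxtimes>\<^bsub>K\<^esub> W)"
proof -
  let ?F = "pair_space K V W"
  interpret V: module K V by fact
  interpret F: module K ?F
    using V.cring_axioms by (rule free_space_module)
  note simps = tensor_space_zero[OF assms] tensor_space_add[OF assms] tensor_space_smult[OF assms]
  show ?thesis
  proof (intro moduleI abelian_groupI V.cring_axioms)
    fix X assume "X \<in> carrier (V \<boxtimes>\<^bsub>K\<^esub> W)"
    then obtain f where f: "f \<in> carrier ?F" "X = tensor_class K V W f"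
      by (auto simp: tensor_space_carrier)
    then have "tensor_class K V W (\<ominus>\<^bsub>?F\<^esub> f) \<oplus>\<^bsub>V \<boxtimes>\<^bsub>K\<^esub> W\<^esub> X = \<zero>\<^bsub>V \<boxtimes>\<^bsub>K\<^esub> W\<^esub>"
      by (simp add: simps F.l_neg)
    then show "\<exists>Y\<in>carrier (V \<boxtimes>\<^bsub>K\<^esub> W). Y \<oplus>\<^bsub>V \<boxtimes>\<^bsub>K\<^esub> W\<^esub> X = \<zero>\<^bsub>V \<boxtimes>\<^bsub>K\<^esub> W\<^esub>"
      using f(1) by (auto simp: tensor_space_carrier)
  qed (auto simp: tensor_space_carrier simps F.a_ac F.smult_l_distr F.smult_r_distr F.smult_assoc1)
qed

lemma tensor_class_linear:
  assumes "module K V" "module K W"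
  shows "linear_map K (pair_space K V W) (V \<boxtimes>\<^bsub>K\<^esub> W) (tensor_class K V W)"
  by (rule linear_mapI)
    (auto simp: tensor_space_carrier tensor_space_add[OF assms] tensor_space_smult[OF assms])

text \<open>Linearity in each argument, when the other argument lies in the carrier.\<close>

definition bilinear_map ::
  "('k, 'm) ring_scheme \<Rightarrow> ('k, 'v) module \<Rightarrow> ('k, 'w) module \<Rightarrow> ('k, 'u) module \<Rightarrow>
   ('v \<Rightarrow> 'w \<Rightarrow> 'u) \<Rightarrow> bool"
  where "bilinear_map K V W U b \<longleftrightarrow>
    (\<forall>v\<in>carrier V. linear_map K W U (b v)) \<and>
    (\<forall>w\<in>carrier W. linear_map K V U (\<lambda>v. b v w))"

lemma bilinear_mapI:
  assumes "\<And>v. v \<in> carrier V \<Longrightarrow> linear_map K W U (b v)"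
    and "\<And>w. w \<in> carrier W \<Longrightarrow> linear_map K V U (\<lambda>v. b v w)"
  shows "bilinear_map K V W U b"
  using assms by (simp add: bilinear_map_def)

lemma bilinear_mapD:
  assumes "bilinear_map K V W U b"
  shows "v \<in> carrier V \<Longrightarrow> linear_map K W U (b v)"
    and "w \<in> carrier W \<Longrightarrow> linear_map K V U (\<lambda>v. b v w)"
  using assms by (simp_all add: bilinear_map_def)

lemma tensor_eq_class: "tensor K V W v w = tensor_class K V W (free_gen K (v, w))"
  by (simp add: tensor_def tensor_class_def)

lemma tensor_bilinear:
  assumes "module K V" "module K W"
  shows "bilinear_map K V W (V \<boxtimes>\<^bsub>K\<^esub> W) (tensor K V W)"
proof -
  let ?F = "pair_space K V W"
  interpret V: module K V by fact
  interpret W: module K W by fact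
  interpret F: module K ?F
    using V.cring_axioms by (rule free_space_module)
  have e: "free_gen K (v, w) \<in> carrier ?F" if "v \<in> carrier V" "w \<in> carrier W" for v w
    using that by (intro free_gen_closed[OF V.cring_axioms] SigmaI)
  have sub: "x \<in> tensor_kernel K V W" if "x \<in> bilinear_relations K V W" for x
    using that generated_submodule_superset[of "bilinear_relations K V W"] by (auto simp: tensor_kernel_def)
  note eqI = tensor_class_eqI[OF assms _ _ sub]
    and simps = tensor_eq_class tensor_space_add[OF assms] tensor_space_smult[OF assms] e
  show ?thesis
  proof (intro bilinear_mapI linear_mapI)
    fix v x y assume c: "v \<in> carrier V" "x \<in> carrier W" "y \<in> carrier W"
    have "free_gen K (v, x \<oplus>\<^bsub>W\<^esub> y) \<ominus>\<^bsub>?F\<^esub> (free_gen K (v, x) \<oplus>\<^bsub>?F\<^esub> free_gen K (v, y))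
        \<in> bilinear_relations K V W"
      unfolding bilinear_relations_def Let_def
      by (rule UnI1, rule UnI1, rule UnI2, intro CollectI exI conjI, rule refl) (use c in simp_all)
    then show "tensor K V W v (x \<oplus>\<^bsub>W\<^esub> y) =
        tensor K V W v x \<oplus>\<^bsub>V \<boxtimes>\<^bsub>K\<^esub> W\<^esub> tensor K V W v y"
      using c by (simp add: simps eqI)
  next
    fix w x y assume c: "w \<in> carrier W" "x \<in> carrier V" "y \<in> carrier V"
    have "free_gen K (x \<oplus>\<^bsub>V\<^esub> y, w) \<ominus>\<^bsub>?F\<^esub> (free_gen K (x, w) \<oplus>\<^bsub>?F\<^esub> free_gen K (y, w))
        \<in> bilinear_relations K V W"
      unfolding bilinear_relations_def Let_def
      by (rule UnI1, rule UnI1, rule UnI1, intro CollectI exI conjI, rule refl) (use c in simp_all)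
    then show "tensor K V W (x \<oplus>\<^bsub>V\<^esub> y) w =
        tensor K V W x w \<oplus>\<^bsub>V \<boxtimes>\<^bsub>K\<^esub> W\<^esub> tensor K V W y w"
      using c by (simp add: simps eqI)
  next
    fix v r x assume c: "v \<in> carrier V" "r \<in> carrier K" "x \<in> carrier W"
    have "free_gen K (v, r \<odot>\<^bsub>W\<^esub> x) \<ominus>\<^bsub>?F\<^esub> r \<odot>\<^bsub>?F\<^esub> free_gen K (v, x) \<in> bilinear_relations K V W"
      unfolding bilinear_relations_def Let_def
      by (rule UnI2, intro CollectI exI conjI, rule refl) (use c in simp_all)
    then show "tensor K V W v (r \<odot>\<^bsub>W\<^esub> x) = r \<odot>\<^bsub>V \<boxtimes>\<^bsub>K\<^esub> W\<^esub> tensor K V W v x"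
      using c by (simp add: simps eqI)
  next
    fix w r x assume c: "w \<in> carrier W" "r \<in> carrier K" "x \<in> carrier V"
    have "free_gen K (r \<odot>\<^bsub>V\<^esub> x, w) \<ominus>\<^bsub>?F\<^esub> r \<odot>\<^bsub>?F\<^esub> free_gen K (x, w) \<in> bilinear_relations K V W"
      unfolding bilinear_relations_def Let_def
      by (rule UnI1, rule UnI2, intro CollectI exI conjI, rule refl) (use c in simp_all)
    then show "tensor K V W (r \<odot>\<^bsub>V\<^esub> x) w = r \<odot>\<^bsub>V \<boxtimes>\<^bsub>K\<^esub> W\<^esub> tensor K V W x w"
      using c by (simp add: simps eqI)
  qed (auto simp: tensor_eq_class tensor_space_carrier e)
qed

lemma tensor_closed:
  "\<lbrakk>module K V; module K W; v \<in> carrier V; w \<in> carrier W\<rbrakk> \<Longrightarrow>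
   tensor K V W v w \<in> carrier (V \<boxtimes>\<^bsub>K\<^esub> W)"
  using tensor_bilinear[of K V W] by (auto simp: bilinear_map_def linear_map_def)

lemma tensor_simps:
  assumes "module K V" "module K W"
  shows "\<lbrakk>v \<in> carrier V; v' \<in> carrier V; w \<in> carrier W\<rbrakk> \<Longrightarrow>
      tensor K V W (v \<oplus>\<^bsub>V\<^esub> v') w =
      tensor K V W v w \<oplus>\<^bsub>V \<boxtimes>\<^bsub>K\<^esub> W\<^esub> tensor K V W v' w"
    and "\<lbrakk>v \<in> carrier V; w \<in> carrier W; w' \<in> carrier W\<rbrakk> \<Longrightarrow>
      tensor K V W v (w \<oplus>\<^bsub>W\<^esub> w') =
      tensor K V W v w \<oplus>\<^bsub>V \<boxtimes>\<^bsub>K\<^esub> W\<^esub> tensor K V W v w'"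
    and "\<lbrakk>r \<in> carrier K; v \<in> carrier V; w \<in> carrier W\<rbrakk> \<Longrightarrow>
      tensor K V W (r \<odot>\<^bsub>V\<^esub> v) w = r \<odot>\<^bsub>V \<boxtimes>\<^bsub>K\<^esub> W\<^esub> tensor K V W v w"
    and "\<lbrakk>r \<in> carrier K; v \<in> carrier V; w \<in> carrier W\<rbrakk> \<Longrightarrow>
      tensor K V W v (r \<odot>\<^bsub>W\<^esub> w) = r \<odot>\<^bsub>V \<boxtimes>\<^bsub>K\<^esub> W\<^esub> tensor K V W v w"
  using tensor_bilinear[OF assms] by (auto simp: bilinear_map_def linear_map_def)

lemma tensor_linear:
  assumes "module K V" "module K W"
  shows "v \<in> carrier V \<Longrightarrow> linear_map K W (V \<boxtimes>\<^bsub>K\<^esub> W) (tensor K V W v)"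
    and "w \<in> carrier W \<Longrightarrow> linear_map K V (V \<boxtimes>\<^bsub>K\<^esub> W) (\<lambda>v. tensor K V W v w)"
  by (rule bilinear_mapD[OF tensor_bilinear[OF assms]], assumption)+

text \<open>Multiples of a pure tensor are pure tensors, so every element is a finite sum of pure tensors.\<close>

lemma tensor_space_induct [consumes 3, case_names tensor add]:
  assumes "module K V" "module K W" "X \<in> carrier (V \<boxtimes>\<^bsub>K\<^esub> W)"
    and tensor: "\<And>v w. \<lbrakk>v \<in> carrier V; w \<in> carrier W\<rbrakk> \<Longrightarrow> P (tensor K V W v w)"
    and add: "\<And>X Y. \<lbrakk>X \<in> carrier (V \<boxtimes>\<^bsub>K\<^esub> W); Y \<in> carrier (V \<boxtimes>\<^bsub>K\<^esub> W); P X; P Y\<rbrakk> \<Longrightarrow>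
      P (X \<oplus>\<^bsub>V \<boxtimes>\<^bsub>K\<^esub> W\<^esub> Y)"
  shows "P X"
proof -
  let ?F = "pair_space K V W" and ?c = "tensor_class K V W"
  interpret V: module K V by fact
  interpret W: module K W by fact
  interpret VW: module K "V \<boxtimes>\<^bsub>K\<^esub> W"
    using assms(1,2) by (rule tensor_space_module)
  interpret F: module K ?F
    using V.cring_axioms by (rule free_space_module)
  note c = linear_mapD[OF tensor_class_linear[OF assms(1,2)]]
  obtain f where f: "f \<in> carrier ?F" "X = ?c f"
    using assms(3) by (auto simp: tensor_space_carrier)
  have "P (?c f)"
    using V.cring_axioms f(1)
  proof (induction rule: free_space_induct)
    case zero
    have "tensor K V W (\<zero>\<^bsub>K\<^esub> \<odot>\<^bsub>V\<^esub> \<zero>\<^bsub>V\<^esub>) \<zero>\<^bsub>W\<^esub> = \<zero>\<^bsub>V \<boxtimes>\<^bsub>K\<^esub> W\<^esub>"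
      by (subst tensor_simps[OF assms(1,2)]) (auto simp: tensor_closed assms(1,2))
    then show ?case
      using tensor[OF V.zero_closed W.zero_closed] by (simp add: tensor_space_zero[OF assms(1,2)])
  next
    case (add r s g)
    obtain v w where s: "s = (v, w)" "v \<in> carrier V" "w \<in> carrier W"
      using add(2) by auto
    have e: "free_gen K s \<in> carrier ?F"
      by (rule free_gen_closed[OF V.cring_axioms add(2)])
    have "?c (r \<odot>\<^bsub>?F\<^esub> free_gen K s) = tensor K V W (r \<odot>\<^bsub>V\<^esub> v) w"
      using add(1) s e by (simp add: c tensor_simps[OF assms(1,2)] tensor_eq_class[symmetric])
    then have "P (?c (r \<odot>\<^bsub>?F\<^esub> free_gen K s))"
      using tensor add(1) s by simp
    then show ?case
      using assms(5)[of "?c (r \<odot>\<^bsub>?F\<^esub> free_gen K s)" "?c g"] add e by (simp add: c)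
  qed
  then show ?thesis
    using f(2) by simp
qed

lemma linear_map_eqI:
  assumes "module K V" "module K W"
    and "linear_map K (V \<boxtimes>\<^bsub>K\<^esub> W) U f" "linear_map K (V \<boxtimes>\<^bsub>K\<^esub> W) U g"
    and "\<And>v w. \<lbrakk>v \<in> carrier V; w \<in> carrier W\<rbrakk> \<Longrightarrow> f (tensor K V W v w) = g (tensor K V W v w)"
    and "X \<in> carrier (V \<boxtimes>\<^bsub>K\<^esub> W)"
  shows "f X = g X"
  using assms(1,2,6)
  by (induction rule: tensor_space_induct)
    (simp_all add: assms(5) linear_mapD(2)[OF assms(3)] linear_mapD(2)[OF assms(4)])

text \<open>The linear extension of a bilinear map vanishes on the relations, hence on the submodule that they
  generate; this makes \<open>tensor_lift\<close> independent of the chosen representative.\<close>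

lemma free_lift_kernel:
  assumes "module K V" "module K W" "module K U" "bilinear_map K V W U b"
    and "n \<in> tensor_kernel K V W"
  shows "free_lift K U (\<lambda>p. b (fst p) (snd p)) n = \<zero>\<^bsub>U\<^esub>"
proof -
  let ?F = "pair_space K V W" and ?l = "free_lift K U (\<lambda>p. b (fst p) (snd p))"
  interpret V: module K V by fact
  interpret W: module K W by fact
  interpret U: module K U by fact
  interpret F: module K ?F
    using V.cring_axioms by (rule free_space_module)
  have b: "b v w \<in> carrier U" if "v \<in> carrier V" "w \<in> carrier W" for v w
    using linear_mapD(1)[OF bilinear_mapD(1)[OF assms(4)]] that by blast
  have bl: "(\<lambda>p. b (fst p) (snd p)) \<in> carrier V \<times> carrier W \<rightarrow> carrier U"
    using b by auto
  have lin: "linear_map K ?F U ?l"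
    using assms(3) bl by (rule free_lift_linear)
  note l = linear_mapD[OF lin] linear_map_diff[OF F.module_axioms assms(3) lin]
  have gen: "?l (free_gen K (v, w)) = b v w" if "v \<in> carrier V" "w \<in> carrier W" for v w
    using free_lift_gen[OF assms(3) bl, of "(v, w)"] that by simp
  have e: "free_gen K (v, w) \<in> carrier ?F" if "v \<in> carrier V" "w \<in> carrier W" for v w
    using that by (intro free_gen_closed[OF V.cring_axioms] SigmaI)
  note bs = linear_mapD(2,3)[OF bilinear_mapD(1)[OF assms(4)]]
    linear_mapD(2,3)[OF bilinear_mapD(2)[OF assms(4)]]
  let ?H = "{x \<in> carrier ?F. ?l x = \<zero>\<^bsub>U\<^esub>}"
  have "submodule ?H K ?F"
    by (rule F.submoduleI)
      (auto simp: l linear_map_zero[OF F.module_axioms assms(3) lin]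
        linear_map_minus[OF F.module_axioms assms(3) lin])
  moreover have "bilinear_relations K V W \<subseteq> ?H"
    by (auto simp: bilinear_relations_def Let_def e l gen bs b U.r_neg a_minus_def
        linear_map_minus[OF F.module_axioms assms(3) lin])
  ultimately have "tensor_kernel K V W \<subseteq> ?H"
    unfolding tensor_kernel_def by (rule generated_submodule_least)
  then show ?thesis
    using assms(5) by auto
qed

lemma tensor_lift_class:
  assumes "module K V" "module K W" "module K U" "bilinear_map K V W U b"
    and "f \<in> carrier (pair_space K V W)"
  shows "tensor_lift K V W U b (tensor_class K V W f) = free_lift K U (\<lambda>p. b (fst p) (snd p)) f"
proof -
  let ?F = "pair_space K V W" and ?l = "free_lift K U (\<lambda>p. b (fst p) (snd p))"
    and ?X = "tensor_class K V W f"
  interpret V: module K V by fact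
  interpret U: module K U by fact
  interpret F: module K ?F
    using V.cring_axioms by (rule free_space_module)
  interpret N: abelian_subgroup "tensor_kernel K V W" ?F
    using assms(1,2) by (rule tensor_kernel_subgroup)
  have "(\<lambda>p. b (fst p) (snd p)) \<in> carrier V \<times> carrier W \<rightarrow> carrier U"
    using linear_mapD(1)[OF bilinear_mapD(1)[OF assms(4)]] by auto
  then have l: "linear_map K ?F U ?l"
    using assms(3) by (intro free_lift_linear)
  have "f \<in> ?X"
    using assms(5) N.a_rcos_self by (simp add: tensor_class_def)
  then have "(SOME x. x \<in> ?X) \<in> ?X"
    by (rule someI[where P = "\<lambda>x. x \<in> ?X"])
  then obtain n where n: "n \<in> tensor_kernel K V W" "(SOME x. x \<in> ?X) = n \<oplus>\<^bsub>?F\<^esub> f"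
    by (auto simp: tensor_class_def a_r_coset_def')
  have "?l (n \<oplus>\<^bsub>?F\<^esub> f) = ?l f"
    using n(1) assms(5) free_lift_kernel[OF assms(1-4) n(1)]
    by (simp add: linear_mapD[OF l])
  then show ?thesis
    by (simp add: tensor_lift_def Let_def n(2) free_lift_def)
qed

lemma tensor_lift_linear:
  assumes "module K V" "module K W" "module K U" "bilinear_map K V W U b"
  shows "linear_map K (V \<boxtimes>\<^bsub>K\<^esub> W) U (tensor_lift K V W U b)"
proof -
  let ?F = "pair_space K V W" and ?l = "free_lift K U (\<lambda>p. b (fst p) (snd p))"
  interpret V: module K V by fact
  interpret F: module K ?F
    using V.cring_axioms by (rule free_space_module)
  have "(\<lambda>p. b (fst p) (snd p)) \<in> carrier V \<times> carrier W \<rightarrow> carrier U"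
    using linear_mapD(1)[OF bilinear_mapD(1)[OF assms(4)]] by auto
  then have l: "linear_map K ?F U ?l"
    using assms(3) by (intro free_lift_linear)
  show ?thesis
    by (rule linear_mapI)
      (auto simp: tensor_space_carrier tensor_lift_class[OF assms] linear_mapD[OF l]
        tensor_space_add[OF assms(1,2)] tensor_space_smult[OF assms(1,2)])
qed

lemma tensor_lift_tensor:
  assumes "module K V" "module K W" "module K U" "bilinear_map K V W U b"
    and "v \<in> carrier V" "w \<in> carrier W"
  shows "tensor_lift K V W U b (tensor K V W v w) = b v w"
proof -
  interpret V: module K V by fact
  have "(\<lambda>p. b (fst p) (snd p)) \<in> carrier V \<times> carrier W \<rightarrow> carrier U"
    using linear_mapD(1)[OF bilinear_mapD(1)[OF assms(4)]] by auto
  moreover have "free_gen K (v, w) \<in> carrier (pair_space K V W)"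
    using assms(5,6) by (intro free_gen_closed[OF V.cring_axioms] SigmaI)
  ultimately show ?thesis
    using assms(5,6) free_lift_gen[OF assms(3), of "\<lambda>p. b (fst p) (snd p)" "carrier V \<times> carrier W" "(v, w)"]
    by (simp add: tensor_eq_class tensor_lift_class[OF assms(1-4)])
qed

section \<open>Maps between tensor products\<close>

lemma linear_map_eqI_right:
  assumes "module K U" "module K V" "module K W"
    and "linear_map K (U \<boxtimes>\<^bsub>K\<^esub> V \<boxtimes>\<^bsub>K\<^esub> W) Y f" "linear_map K (U \<boxtimes>\<^bsub>K\<^esub> V \<boxtimes>\<^bsub>K\<^esub> W) Y g"
    and "\<And>u v w. \<lbrakk>u \<in> carrier U; v \<in> carrier V; w \<in> carrier W\<rbrakk> \<Longrightarrow>
      f (tensor K U (V \<boxtimes>\<^bsub>K\<^esub> W) u (tensor K V W v w)) =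
      g (tensor K U (V \<boxtimes>\<^bsub>K\<^esub> W) u (tensor K V W v w))"
    and "X \<in> carrier (U \<boxtimes>\<^bsub>K\<^esub> V \<boxtimes>\<^bsub>K\<^esub> W)"
  shows "f X = g X"
proof (rule linear_map_eqI[OF assms(1) tensor_space_module[OF assms(2,3)] assms(4,5) _ assms(7)])
  fix u S assume u: "u \<in> carrier U" and S: "S \<in> carrier (V \<boxtimes>\<^bsub>K\<^esub> W)"
  let ?t = "tensor K U (V \<boxtimes>\<^bsub>K\<^esub> W) u"
  have t: "linear_map K (V \<boxtimes>\<^bsub>K\<^esub> W) (U \<boxtimes>\<^bsub>K\<^esub> V \<boxtimes>\<^bsub>K\<^esub> W) ?t"
    by (rule tensor_linear(1)[OF assms(1) tensor_space_module[OF assms(2,3)] u])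
  show "f (?t S) = g (?t S)"
    by (rule linear_map_eqI[OF assms(2,3) linear_map_comp(2)[OF t assms(4)]
          linear_map_comp(2)[OF t assms(5)] assms(6)[OF u] S])
qed

lemma linear_map_eqI_left:
  assumes "module K U" "module K V" "module K W"
    and "linear_map K ((U \<boxtimes>\<^bsub>K\<^esub> V) \<boxtimes>\<^bsub>K\<^esub> W) Y f" "linear_map K ((U \<boxtimes>\<^bsub>K\<^esub> V) \<boxtimes>\<^bsub>K\<^esub> W) Y g"
    and "\<And>u v w. \<lbrakk>u \<in> carrier U; v \<in> carrier V; w \<in> carrier W\<rbrakk> \<Longrightarrow>
      f (tensor K (U \<boxtimes>\<^bsub>K\<^esub> V) W (tensor K U V u v) w) =
      g (tensor K (U \<boxtimes>\<^bsub>K\<^esub> V) W (tensor K U V u v) w)"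
    and "X \<in> carrier ((U \<boxtimes>\<^bsub>K\<^esub> V) \<boxtimes>\<^bsub>K\<^esub> W)"
  shows "f X = g X"
proof (rule linear_map_eqI[OF tensor_space_module[OF assms(1,2)] assms(3,4,5) _ assms(7)])
  fix S w assume S: "S \<in> carrier (U \<boxtimes>\<^bsub>K\<^esub> V)" and w: "w \<in> carrier W"
  let ?t = "\<lambda>S. tensor K (U \<boxtimes>\<^bsub>K\<^esub> V) W S w"
  have t: "linear_map K (U \<boxtimes>\<^bsub>K\<^esub> V) ((U \<boxtimes>\<^bsub>K\<^esub> V) \<boxtimes>\<^bsub>K\<^esub> W) ?t"
    by (rule tensor_linear(2)[OF tensor_space_module[OF assms(1,2)] assms(3) w])
  show "f (?t S) = g (?t S)"
    by (rule linear_map_eqI[OF assms(1,2) linear_map_comp(2)[OF t assms(4)]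
          linear_map_comp(2)[OF t assms(5)] assms(6)[OF _ _ w] S])
qed

lemma tensor_map_bilinear:
  assumes "module K V'" "module K W'" "linear_map K V V' f" "linear_map K W W' g"
  shows "bilinear_map K V W (V' \<boxtimes>\<^bsub>K\<^esub> W') (\<lambda>v w. tensor K V' W' (f v) (g w))"
  by (intro bilinear_mapI linear_map_comp(2)[OF assms(4)] linear_map_comp(2)[OF assms(3)]
      tensor_linear linear_mapD(1)[OF assms(3)] linear_mapD(1)[OF assms(4)] assms)

lemma tensor_map_linear:
  assumes "module K V" "module K W" "module K V'" "module K W'"
    and "linear_map K V V' f" "linear_map K W W' g"
  shows "linear_map K (V \<boxtimes>\<^bsub>K\<^esub> W) (V' \<boxtimes>\<^bsub>K\<^esub> W') (tensor_map K V W V' W' f g)"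
  unfolding tensor_map_def
  by (intro tensor_lift_linear tensor_map_bilinear tensor_space_module assms)

lemma tensor_map_tensor:
  assumes "module K V" "module K W" "module K V'" "module K W'"
    and "linear_map K V V' f" "linear_map K W W' g" "v \<in> carrier V" "w \<in> carrier W"
  shows "tensor_map K V W V' W' f g (tensor K V W v w) = tensor K V' W' (f v) (g w)"
  unfolding tensor_map_def
  by (intro tensor_lift_tensor tensor_map_bilinear tensor_space_module assms)

lemma flip_bilinear:
  assumes "module K V" "module K W"
  shows "bilinear_map K V W (W \<boxtimes>\<^bsub>K\<^esub> V) (\<lambda>v w. tensor K W V w v)"
  by (intro bilinear_mapI tensor_linear assms)

lemma flip_linear:
  assumes "module K V" "module K W"
  shows "linear_map K (V \<boxtimes>\<^bsub>K\<^esub> W) (W \<boxtimes>\<^bsub>K\<^esub> V) (flip K V W)"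
  unfolding flip_def by (intro tensor_lift_linear flip_bilinear tensor_space_module assms)

lemma flip_tensor:
  assumes "module K V" "module K W" "v \<in> carrier V" "w \<in> carrier W"
  shows "flip K V W (tensor K V W v w) = tensor K W V w v"
  unfolding flip_def by (intro tensor_lift_tensor flip_bilinear tensor_space_module assms)

text \<open>The lift of a bilinear map that depends linearly on a parameter depends linearly on it. With
  the remaining tensor factor as parameter this shows that the maps defining the reassociations are
  bilinear.\<close>

lemma tensor_lift_family:
  assumes "module K U" "module K V" "module K Z" "module K Y"
    and "\<And>z. z \<in> carrier Z \<Longrightarrow> bilinear_map K U V Y (b z)"
    and "\<And>u v. \<lbrakk>u \<in> carrier U; v \<in> carrier V\<rbrakk> \<Longrightarrow> linear_map K Z Y (\<lambda>z. b z u v)"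
    and "X \<in> carrier (U \<boxtimes>\<^bsub>K\<^esub> V)"
  shows "linear_map K Z Y (\<lambda>z. tensor_lift K U V Y (b z) X)"
proof -
  interpret Z: module K Z by fact
  interpret Y: module K Y by fact
  note l = tensor_lift_linear[OF assms(1,2,4) assms(5)]
    and t = tensor_lift_tensor[OF assms(1,2,4) assms(5)]
  show ?thesis
  proof (rule linear_mapI)
    fix z assume "z \<in> carrier Z"
    then show "tensor_lift K U V Y (b z) X \<in> carrier Y"
      by (intro linear_mapD(1)[OF l] assms(7))
  next
    fix z z' assume z: "z \<in> carrier Z" "z' \<in> carrier Z"
    show "tensor_lift K U V Y (b (z \<oplus>\<^bsub>Z\<^esub> z')) X =
        tensor_lift K U V Y (b z) X \<oplus>\<^bsub>Y\<^esub> tensor_lift K U V Y (b z') X"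
      by (rule linear_map_eqI[OF assms(1,2) l linear_map_add[OF assms(4) l l] _ assms(7)])
        (simp_all add: z t linear_mapD[OF assms(6)])
  next
    fix r z assume z: "r \<in> carrier K" "z \<in> carrier Z"
    show "tensor_lift K U V Y (b (r \<odot>\<^bsub>Z\<^esub> z)) X = r \<odot>\<^bsub>Y\<^esub> tensor_lift K U V Y (b z) X"
      by (rule linear_map_eqI[OF assms(1,2) l linear_map_smult[OF assms(4) l] _ assms(7)])
        (simp_all add: z t linear_mapD[OF assms(6)])
  qed
qed

lemma assoc_r_inner_bilinear:
  assumes "module K U" "module K V" "module K W" "w \<in> carrier W"
  shows "bilinear_map K U V (U \<boxtimes>\<^bsub>K\<^esub> V \<boxtimes>\<^bsub>K\<^esub> W)
    (\<lambda>u v. tensor K U (V \<boxtimes>\<^bsub>K\<^esub> W) u (tensor K V W v w))"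
  by (intro bilinear_mapI linear_map_comp(2)[OF tensor_linear(2)] tensor_linear tensor_closed
      tensor_space_module assms)

lemma assoc_r_bilinear:
  assumes "module K U" "module K V" "module K W"
  shows "bilinear_map K (U \<boxtimes>\<^bsub>K\<^esub> V) W (U \<boxtimes>\<^bsub>K\<^esub> V \<boxtimes>\<^bsub>K\<^esub> W)
    (\<lambda>X w. tensor_lift K U V (U \<boxtimes>\<^bsub>K\<^esub> V \<boxtimes>\<^bsub>K\<^esub> W)
        (\<lambda>u v. tensor K U (V \<boxtimes>\<^bsub>K\<^esub> W) u (tensor K V W v w)) X)"
  by (intro bilinear_mapI tensor_lift_family tensor_lift_linear assoc_r_inner_bilinear
      linear_map_comp(2)[OF tensor_linear(1)] tensor_linear tensor_space_module assms)

lemma assoc_r_linear: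
  assumes "module K U" "module K V" "module K W"
  shows "linear_map K ((U \<boxtimes>\<^bsub>K\<^esub> V) \<boxtimes>\<^bsub>K\<^esub> W) (U \<boxtimes>\<^bsub>K\<^esub> V \<boxtimes>\<^bsub>K\<^esub> W) (assoc_r K U V W)"
  unfolding assoc_r_def by (intro tensor_lift_linear assoc_r_bilinear tensor_space_module assms)

lemma assoc_r_tensor:
  assumes "module K U" "module K V" "module K W"
    and "u \<in> carrier U" "v \<in> carrier V" "w \<in> carrier W"
  shows "assoc_r K U V W (tensor K (U \<boxtimes>\<^bsub>K\<^esub> V) W (tensor K U V u v) w) =
    tensor K U (V \<boxtimes>\<^bsub>K\<^esub> W) u (tensor K V W v w)"
  unfolding assoc_r_def
  by (subst tensor_lift_tensor, (intro assoc_r_bilinear tensor_space_module tensor_closed assms)+,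
      subst tensor_lift_tensor,
      (intro assoc_r_inner_bilinear tensor_space_module tensor_closed assms refl)+)

lemma assoc_l_inner_bilinear:
  assumes "module K U" "module K V" "module K W" "u \<in> carrier U"
  shows "bilinear_map K V W ((U \<boxtimes>\<^bsub>K\<^esub> V) \<boxtimes>\<^bsub>K\<^esub> W)
    (\<lambda>v w. tensor K (U \<boxtimes>\<^bsub>K\<^esub> V) W (tensor K U V u v) w)"
  by (intro bilinear_mapI linear_map_comp(2)[OF tensor_linear(1)] tensor_linear tensor_closed
      tensor_space_module assms)

lemma assoc_l_bilinear:
  assumes "module K U" "module K V" "module K W"
  shows "bilinear_map K U (V \<boxtimes>\<^bsub>K\<^esub> W) ((U \<boxtimes>\<^bsub>K\<^esub> V) \<boxtimes>\<^bsub>K\<^esub> W)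
    (\<lambda>u X. tensor_lift K V W ((U \<boxtimes>\<^bsub>K\<^esub> V) \<boxtimes>\<^bsub>K\<^esub> W)
        (\<lambda>v w. tensor K (U \<boxtimes>\<^bsub>K\<^esub> V) W (tensor K U V u v) w) X)"
  by (intro bilinear_mapI tensor_lift_family tensor_lift_linear assoc_l_inner_bilinear
      linear_map_comp(2)[OF tensor_linear(2)] tensor_linear tensor_space_module assms)

lemma assoc_l_linear:
  assumes "module K U" "module K V" "module K W"
  shows "linear_map K (U \<boxtimes>\<^bsub>K\<^esub> V \<boxtimes>\<^bsub>K\<^esub> W) ((U \<boxtimes>\<^bsub>K\<^esub> V) \<boxtimes>\<^bsub>K\<^esub> W) (assoc_l K U V W)"
  unfolding assoc_l_def by (intro tensor_lift_linear assoc_l_bilinear tensor_space_module assms)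

lemma assoc_l_tensor:
  assumes "module K U" "module K V" "module K W"
    and "u \<in> carrier U" "v \<in> carrier V" "w \<in> carrier W"
  shows "assoc_l K U V W (tensor K U (V \<boxtimes>\<^bsub>K\<^esub> W) u (tensor K V W v w)) =
    tensor K (U \<boxtimes>\<^bsub>K\<^esub> V) W (tensor K U V u v) w"
  unfolding assoc_l_def
  by (subst tensor_lift_tensor, (intro assoc_l_bilinear tensor_space_module tensor_closed assms)+,
      subst tensor_lift_tensor,
      (intro assoc_l_inner_bilinear tensor_space_module tensor_closed assms refl)+)

lemma assoc_l_assoc_r:
  assumes "module K U" "module K V" "module K W" "X \<in> carrier ((U \<boxtimes>\<^bsub>K\<^esub> V) \<boxtimes>\<^bsub>K\<^esub> W)"
  shows "assoc_l K U V W (assoc_r K U V W X) = X"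
  by (rule linear_map_eqI_left[OF assms(1-3) linear_map_comp(2)[OF assoc_r_linear assoc_l_linear]
        linear_map_id _ assms(4)])
    (simp_all add: assms assoc_r_tensor assoc_l_tensor)

lemma ground_space_simps:
  "carrier (ground_space K) = carrier K" "\<one>\<^bsub>ground_space K\<^esub> = \<one>\<^bsub>K\<^esub>"
  "x \<oplus>\<^bsub>ground_space K\<^esub> y = x \<oplus>\<^bsub>K\<^esub> y" "r \<odot>\<^bsub>ground_space K\<^esub> x = r \<otimes>\<^bsub>K\<^esub> x"
  by (simp_all add: ground_space_def)

lemma module_imp_cring: "module K V \<Longrightarrow> cring K"
  by (simp add: module_def)

lemma scalar_bilinear:
  assumes "module K V"
  shows "bilinear_map K (ground_space K) V V (\<lambda>r v. r \<odot>\<^bsub>V\<^esub> v)"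
    "bilinear_map K V (ground_space K) V (\<lambda>v r. r \<odot>\<^bsub>V\<^esub> v)"
proof -
  interpret V: module K V by fact
  have 1: "linear_map K V V (\<lambda>v. r \<odot>\<^bsub>V\<^esub> v)" if "r \<in> carrier K" for r
    by (rule linear_map_smult[OF assms linear_map_id that])
  have 2: "linear_map K (ground_space K) V (\<lambda>r. r \<odot>\<^bsub>V\<^esub> v)" if "v \<in> carrier V" for v
    using that by (intro linear_mapI)
      (simp_all add: ground_space_simps V.smult_l_distr V.smult_assoc1)
  show "bilinear_map K (ground_space K) V V (\<lambda>r v. r \<odot>\<^bsub>V\<^esub> v)"
    "bilinear_map K V (ground_space K) V (\<lambda>v r. r \<odot>\<^bsub>V\<^esub> v)"
    by (intro bilinear_mapI 1 2; simp add: ground_space_simps)+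
qed

lemma unit_l_linear: "module K V \<Longrightarrow> linear_map K (ground_space K \<boxtimes>\<^bsub>K\<^esub> V) V (unit_l K V)"
  unfolding unit_l_def
  by (intro tensor_lift_linear scalar_bilinear ground_space_module module_imp_cring)

lemma unit_r_linear: "module K V \<Longrightarrow> linear_map K (V \<boxtimes>\<^bsub>K\<^esub> ground_space K) V (unit_r K V)"
  unfolding unit_r_def
  by (intro tensor_lift_linear scalar_bilinear ground_space_module module_imp_cring)

lemma unit_l_tensor:
  "\<lbrakk>module K V; r \<in> carrier K; v \<in> carrier V\<rbrakk> \<Longrightarrow>
   unit_l K V (tensor K (ground_space K) V r v) = r \<odot>\<^bsub>V\<^esub> v"
  unfolding unit_l_def
  by (subst tensor_lift_tensor)
    (auto simp: ground_space_simps intro: scalar_bilinear ground_space_module module_imp_cring)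

lemma unit_r_tensor:
  "\<lbrakk>module K V; r \<in> carrier K; v \<in> carrier V\<rbrakk> \<Longrightarrow>
   unit_r K V (tensor K V (ground_space K) v r) = r \<odot>\<^bsub>V\<^esub> v"
  unfolding unit_r_def
  by (subst tensor_lift_tensor)
    (auto simp: ground_space_simps intro: scalar_bilinear ground_space_module module_imp_cring)

text \<open>The amplification of a map \<open>f\<close> from \<open>X \<otimes> Y\<close> to \<open>X' \<otimes> Y'\<close> by the identity of a third factor
  \<open>Z\<close> on the right. Triple products are bracketed to the right, which makes the reassociations
  necessary.\<close>

definition map12 ::
  "('k, 'm) ring_scheme \<Rightarrow> ('k, 'x) module \<Rightarrow> ('k, 'y) module \<Rightarrow> ('k, 'z) module \<Rightarrow>
   ('k, 'x1) module \<Rightarrow> ('k, 'y1) module \<Rightarrow>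
   (('x \<times> 'y \<Rightarrow> 'k) set \<Rightarrow> ('x1 \<times> 'y1 \<Rightarrow> 'k) set) \<Rightarrow>
   ('x \<times> ('y \<times> 'z \<Rightarrow> 'k) set \<Rightarrow> 'k) set \<Rightarrow> ('x1 \<times> ('y1 \<times> 'z \<Rightarrow> 'k) set \<Rightarrow> 'k) set"
  where "map12 K X Y Z X' Y' f = assoc_r K X' Y' Z
    \<circ> tensor_map K (X \<boxtimes>\<^bsub>K\<^esub> Y) Z (X' \<boxtimes>\<^bsub>K\<^esub> Y') Z f (\<lambda>x. x) \<circ> assoc_l K X Y Z"

lemma map12_linear:
  assumes "module K X" "module K Y" "module K Z" "module K X'" "module K Y'"
    and "linear_map K (X \<boxtimes>\<^bsub>K\<^esub> Y) (X' \<boxtimes>\<^bsub>K\<^esub> Y') f"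
  shows "linear_map K (X \<boxtimes>\<^bsub>K\<^esub> Y \<boxtimes>\<^bsub>K\<^esub> Z) (X' \<boxtimes>\<^bsub>K\<^esub> Y' \<boxtimes>\<^bsub>K\<^esub> Z) (map12 K X Y Z X' Y' f)"
  unfolding map12_def
  by (intro linear_map_comp(1)[OF assoc_l_linear] linear_map_comp(1)[OF tensor_map_linear]
      assoc_r_linear tensor_space_module linear_map_id assms)

text \<open>The value on elements \<open>u \<otimes> z\<close> where \<open>u\<close> need not be a pure tensor. This is what is needed after a
  first map has already been applied to the first two factors.\<close>

lemma map12_assoc_r:
  assumes "module K X" "module K Y" "module K Z" "module K X'" "module K Y'"
    and "linear_map K (X \<boxtimes>\<^bsub>K\<^esub> Y) (X' \<boxtimes>\<^bsub>K\<^esub> Y') f" "u \<in> carrier (X \<boxtimes>\<^bsub>K\<^esub> Y)" "z \<in> carrier Z"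
  shows "map12 K X Y Z X' Y' f (assoc_r K X Y Z (tensor K (X \<boxtimes>\<^bsub>K\<^esub> Y) Z u z)) =
    assoc_r K X' Y' Z (tensor K (X' \<boxtimes>\<^bsub>K\<^esub> Y') Z (f u) z)"
  by (simp add: map12_def assoc_l_assoc_r tensor_space_module tensor_map_tensor tensor_closed
      linear_map_id assms)

lemma map12_tensor:
  assumes "module K X" "module K Y" "module K Z" "module K X'" "module K Y'"
    and "linear_map K (X \<boxtimes>\<^bsub>K\<^esub> Y) (X' \<boxtimes>\<^bsub>K\<^esub> Y') f"
    and "x \<in> carrier X" "y \<in> carrier Y" "z \<in> carrier Z"
  shows "map12 K X Y Z X' Y' f (tensor K X (Y \<boxtimes>\<^bsub>K\<^esub> Z) x (tensor K Y Z y z)) =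
    assoc_r K X' Y' Z (tensor K (X' \<boxtimes>\<^bsub>K\<^esub> Y') Z (f (tensor K X Y x y)) z)"
  using map12_assoc_r[OF assms(1-6) tensor_closed[OF assms(1,2,7,8)] assms(9)]
  by (simp add: assoc_r_tensor assms)

lemma assoc_r_tensor_linear:
  assumes "module K U" "module K V" "module K W" "w \<in> carrier W"
  shows "linear_map K (U \<boxtimes>\<^bsub>K\<^esub> V) (U \<boxtimes>\<^bsub>K\<^esub> V \<boxtimes>\<^bsub>K\<^esub> W)
    (\<lambda>X. assoc_r K U V W (tensor K (U \<boxtimes>\<^bsub>K\<^esub> V) W X w))"
  by (intro linear_map_comp(2)[OF tensor_linear(2) assoc_r_linear] tensor_space_module assms)

text \<open>Naturality of the reassociation.\<close>

lemma tensor_map_assoc_r: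
  assumes "module K X" "module K Y" "module K Z" "module K X'" "module K Y'" "module K Z'"
    and "linear_map K X X' f" "linear_map K Y Y' g" "linear_map K Z Z' h"
    and "u \<in> carrier (X \<boxtimes>\<^bsub>K\<^esub> Y)" "z \<in> carrier Z"
  shows "tensor_map K X (Y \<boxtimes>\<^bsub>K\<^esub> Z) X' (Y' \<boxtimes>\<^bsub>K\<^esub> Z') f (tensor_map K Y Z Y' Z' g h)
      (assoc_r K X Y Z (tensor K (X \<boxtimes>\<^bsub>K\<^esub> Y) Z u z)) =
    assoc_r K X' Y' Z' (tensor K (X' \<boxtimes>\<^bsub>K\<^esub> Y') Z' (tensor_map K X Y X' Y' f g u) (h z))"
proof (rule linear_map_eqI[OF assms(1,2) _ _ _ assms(10)])
  show "linear_map K (X \<boxtimes>\<^bsub>K\<^esub> Y) (X' \<boxtimes>\<^bsub>K\<^esub> Y' \<boxtimes>\<^bsub>K\<^esub> Z')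
      (\<lambda>u. tensor_map K X (Y \<boxtimes>\<^bsub>K\<^esub> Z) X' (Y' \<boxtimes>\<^bsub>K\<^esub> Z') f (tensor_map K Y Z Y' Z' g h)
        (assoc_r K X Y Z (tensor K (X \<boxtimes>\<^bsub>K\<^esub> Y) Z u z)))"
    by (rule linear_map_comp(2)[OF assoc_r_tensor_linear tensor_map_linear])
      (simp_all add: assms tensor_space_module tensor_map_linear)
  show "linear_map K (X \<boxtimes>\<^bsub>K\<^esub> Y) (X' \<boxtimes>\<^bsub>K\<^esub> Y' \<boxtimes>\<^bsub>K\<^esub> Z')
      (\<lambda>u. assoc_r K X' Y' Z' (tensor K (X' \<boxtimes>\<^bsub>K\<^esub> Y') Z' (tensor_map K X Y X' Y' f g u) (h z)))"
    by (rule linear_map_comp(2)[OF tensor_map_linear assoc_r_tensor_linear])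
      (simp_all add: assms linear_mapD(1)[OF assms(9)])
qed (simp add: assoc_r_tensor tensor_map_tensor tensor_map_linear tensor_space_module tensor_closed
      linear_mapD(1)[OF assms(7)] linear_mapD(1)[OF assms(8)] linear_mapD(1)[OF assms(9)] assms)

text \<open>The amplification of a map \<open>f\<close> from \<open>Y \<otimes> Z\<close> to \<open>Y' \<otimes> Z'\<close> by the identity of a third factor \<open>X\<close> on
  the left.\<close>

definition map23 ::
  "('k, 'm) ring_scheme \<Rightarrow> ('k, 'x) module \<Rightarrow> ('k, 'y) module \<Rightarrow> ('k, 'z) module \<Rightarrow>
   ('k, 'y1) module \<Rightarrow> ('k, 'z1) module \<Rightarrow>
   (('y \<times> 'z \<Rightarrow> 'k) set \<Rightarrow> ('y1 \<times> 'z1 \<Rightarrow> 'k) set) \<Rightarrow>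
   ('x \<times> ('y \<times> 'z \<Rightarrow> 'k) set \<Rightarrow> 'k) set \<Rightarrow> ('x \<times> ('y1 \<times> 'z1 \<Rightarrow> 'k) set \<Rightarrow> 'k) set"
  where "map23 K X Y Z Y' Z' f =
    tensor_map K X (Y \<boxtimes>\<^bsub>K\<^esub> Z) X (Y' \<boxtimes>\<^bsub>K\<^esub> Z') (\<lambda>x. x) f"

lemma map23_linear:
  assumes "module K X" "module K Y" "module K Z" "module K Y'" "module K Z'"
    and "linear_map K (Y \<boxtimes>\<^bsub>K\<^esub> Z) (Y' \<boxtimes>\<^bsub>K\<^esub> Z') f"
  shows "linear_map K (X \<boxtimes>\<^bsub>K\<^esub> Y \<boxtimes>\<^bsub>K\<^esub> Z) (X \<boxtimes>\<^bsub>K\<^esub> Y' \<boxtimes>\<^bsub>K\<^esub> Z') (map23 K X Y Z Y' Z' f)"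
  unfolding map23_def by (intro tensor_map_linear tensor_space_module linear_map_id assms)

lemma map23_tensor:
  assumes "module K X" "module K Y" "module K Z" "module K Y'" "module K Z'"
    and "linear_map K (Y \<boxtimes>\<^bsub>K\<^esub> Z) (Y' \<boxtimes>\<^bsub>K\<^esub> Z') f" "x \<in> carrier X" "u \<in> carrier (Y \<boxtimes>\<^bsub>K\<^esub> Z)"
  shows "map23 K X Y Z Y' Z' f (tensor K X (Y \<boxtimes>\<^bsub>K\<^esub> Z) x u) =
    tensor K X (Y' \<boxtimes>\<^bsub>K\<^esub> Z') x (f u)"
  unfolding map23_def by (intro tensor_map_tensor tensor_space_module linear_map_id assms)

text \<open>Relations between maps on two tensor factors are inherited by the amplifications to three
  factors. The shift lemmas treat a relation \<open>g = f + r\<close> with a scalar \<open>r\<close>.\<close>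

lemma map12_inverse:
  assumes "module K X" "module K Y" "module K Z" "module K X'" "module K Y'"
    and "linear_map K (X \<boxtimes>\<^bsub>K\<^esub> Y) (X' \<boxtimes>\<^bsub>K\<^esub> Y') f" "linear_map K (X' \<boxtimes>\<^bsub>K\<^esub> Y') (X \<boxtimes>\<^bsub>K\<^esub> Y) g"
    and "\<And>u. u \<in> carrier (X \<boxtimes>\<^bsub>K\<^esub> Y) \<Longrightarrow> g (f u) = u"
    and "t \<in> carrier (X \<boxtimes>\<^bsub>K\<^esub> Y \<boxtimes>\<^bsub>K\<^esub> Z)"
  shows "map12 K X' Y' Z X Y g (map12 K X Y Z X' Y' f t) = t"
  by (rule linear_map_eqI_right[OF assms(1-3) linear_map_comp(2)[OF map12_linear map12_linear]
        linear_map_id _ assms(9)])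
    (simp_all add: assms map12_tensor map12_assoc_r tensor_closed linear_mapD(1)[OF assms(6)]
      assoc_r_tensor)

lemma map23_inverse:
  assumes "module K X" "module K Y" "module K Z" "module K Y'" "module K Z'"
    and "linear_map K (Y \<boxtimes>\<^bsub>K\<^esub> Z) (Y' \<boxtimes>\<^bsub>K\<^esub> Z') f" "linear_map K (Y' \<boxtimes>\<^bsub>K\<^esub> Z') (Y \<boxtimes>\<^bsub>K\<^esub> Z) g"
    and "\<And>u. u \<in> carrier (Y \<boxtimes>\<^bsub>K\<^esub> Z) \<Longrightarrow> g (f u) = u"
    and "t \<in> carrier (X \<boxtimes>\<^bsub>K\<^esub> Y \<boxtimes>\<^bsub>K\<^esub> Z)"
  shows "map23 K X Y' Z' Y Z g (map23 K X Y Z Y' Z' f t) = t"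
  by (rule linear_map_eqI_right[OF assms(1-3) linear_map_comp(2)[OF map23_linear map23_linear]
        linear_map_id _ assms(9)])
    (simp_all add: assms map23_tensor tensor_closed linear_mapD(1)[OF assms(6)])

lemma map12_quadratic:
  assumes "module K X" "module K Y" "module K Z"
    and "linear_map K (X \<boxtimes>\<^bsub>K\<^esub> Y) (X \<boxtimes>\<^bsub>K\<^esub> Y) f" "r \<in> carrier K"
    and "\<And>u. u \<in> carrier (X \<boxtimes>\<^bsub>K\<^esub> Y) \<Longrightarrow> f (f u) = u \<oplus>\<^bsub>X \<boxtimes>\<^bsub>K\<^esub> Y\<^esub> r \<odot>\<^bsub>X \<boxtimes>\<^bsub>K\<^esub> Y\<^esub> f u"
    and "t \<in> carrier (X \<boxtimes>\<^bsub>K\<^esub> Y \<boxtimes>\<^bsub>K\<^esub> Z)"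
  shows "map12 K X Y Z X Y f (map12 K X Y Z X Y f t) =
    t \<oplus>\<^bsub>X \<boxtimes>\<^bsub>K\<^esub> Y \<boxtimes>\<^bsub>K\<^esub> Z\<^esub> r \<odot>\<^bsub>X \<boxtimes>\<^bsub>K\<^esub> Y \<boxtimes>\<^bsub>K\<^esub> Z\<^esub> map12 K X Y Z X Y f t"
proof -
  interpret XY: module K "X \<boxtimes>\<^bsub>K\<^esub> Y" by (intro tensor_space_module assms)
  note m = assms(1-3) tensor_space_module
  note lin = map12_linear[OF m(1-3,1,2) assms(4)]
  note g = linear_mapD[OF assoc_r_tensor_linear[OF m(1-3)]]
  show ?thesis
    by (rule linear_map_eqI_right[OF m(1-3) linear_map_comp(2)[OF lin lin]
          linear_map_add[OF _ linear_map_id linear_map_smult[OF _ lin assms(5)]] _ assms(7)])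
      (simp_all add: m map12_tensor map12_assoc_r tensor_closed linear_mapD(1)[OF assms(4)]
        assms(4-6) g assoc_r_tensor)
qed

lemma map23_quadratic:
  assumes "module K X" "module K Y" "module K Z"
    and "linear_map K (Y \<boxtimes>\<^bsub>K\<^esub> Z) (Y \<boxtimes>\<^bsub>K\<^esub> Z) f" "r \<in> carrier K"
    and "\<And>u. u \<in> carrier (Y \<boxtimes>\<^bsub>K\<^esub> Z) \<Longrightarrow> f (f u) = u \<oplus>\<^bsub>Y \<boxtimes>\<^bsub>K\<^esub> Z\<^esub> r \<odot>\<^bsub>Y \<boxtimes>\<^bsub>K\<^esub> Z\<^esub> f u"
    and "t \<in> carrier (X \<boxtimes>\<^bsub>K\<^esub> Y \<boxtimes>\<^bsub>K\<^esub> Z)"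
  shows "map23 K X Y Z Y Z f (map23 K X Y Z Y Z f t) =
    t \<oplus>\<^bsub>X \<boxtimes>\<^bsub>K\<^esub> Y \<boxtimes>\<^bsub>K\<^esub> Z\<^esub> r \<odot>\<^bsub>X \<boxtimes>\<^bsub>K\<^esub> Y \<boxtimes>\<^bsub>K\<^esub> Z\<^esub> map23 K X Y Z Y Z f t"
proof -
  interpret YZ: module K "Y \<boxtimes>\<^bsub>K\<^esub> Z" by (intro tensor_space_module assms)
  note m = assms(1-3) tensor_space_module
  note lin = map23_linear[OF m(1-3,2,3) assms(4)]
  show ?thesis
    by (rule linear_map_eqI_right[OF m(1-3) linear_map_comp(2)[OF lin lin]
          linear_map_add[OF _ linear_map_id linear_map_smult[OF _ lin assms(5)]] _ assms(7)])
      (simp_all add: m map23_tensor tensor_closed linear_mapD(1)[OF assms(4)]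
        assms(4-6) tensor_simps)
qed

lemma map12_shift:
  assumes "module K X" "module K Y" "module K Z"
    and "linear_map K (X \<boxtimes>\<^bsub>K\<^esub> Y) (X \<boxtimes>\<^bsub>K\<^esub> Y) f" "linear_map K (X \<boxtimes>\<^bsub>K\<^esub> Y) (X \<boxtimes>\<^bsub>K\<^esub> Y) g"
    and "r \<in> carrier K"
    and "\<And>u. u \<in> carrier (X \<boxtimes>\<^bsub>K\<^esub> Y) \<Longrightarrow> g u = f u \<oplus>\<^bsub>X \<boxtimes>\<^bsub>K\<^esub> Y\<^esub> r \<odot>\<^bsub>X \<boxtimes>\<^bsub>K\<^esub> Y\<^esub> u"
    and "t \<in> carrier (X \<boxtimes>\<^bsub>K\<^esub> Y \<boxtimes>\<^bsub>K\<^esub> Z)"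
  shows "map12 K X Y Z X Y g t =
    map12 K X Y Z X Y f t \<oplus>\<^bsub>X \<boxtimes>\<^bsub>K\<^esub> Y \<boxtimes>\<^bsub>K\<^esub> Z\<^esub> r \<odot>\<^bsub>X \<boxtimes>\<^bsub>K\<^esub> Y \<boxtimes>\<^bsub>K\<^esub> Z\<^esub> t"
proof -
  interpret XY: module K "X \<boxtimes>\<^bsub>K\<^esub> Y" by (intro tensor_space_module assms)
  note m = assms(1-3) tensor_space_module
  note lin = map12_linear[OF m(1-3,1,2) assms(4)] and lin' = map12_linear[OF m(1-3,1,2) assms(5)]
  note g = linear_mapD[OF assoc_r_tensor_linear[OF m(1-3)]]
  show ?thesis
    by (rule linear_map_eqI_right[OF m(1-3) lin'
          linear_map_add[OF _ lin linear_map_smult[OF _ linear_map_id assms(6)]] _ assms(8)])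
      (simp_all add: m map12_tensor tensor_closed linear_mapD(1)[OF assms(4)]
        assms(4-7) g assoc_r_tensor)
qed

lemma map23_shift:
  assumes "module K X" "module K Y" "module K Z"
    and "linear_map K (Y \<boxtimes>\<^bsub>K\<^esub> Z) (Y \<boxtimes>\<^bsub>K\<^esub> Z) f" "linear_map K (Y \<boxtimes>\<^bsub>K\<^esub> Z) (Y \<boxtimes>\<^bsub>K\<^esub> Z) g"
    and "r \<in> carrier K"
    and "\<And>u. u \<in> carrier (Y \<boxtimes>\<^bsub>K\<^esub> Z) \<Longrightarrow> g u = f u \<oplus>\<^bsub>Y \<boxtimes>\<^bsub>K\<^esub> Z\<^esub> r \<odot>\<^bsub>Y \<boxtimes>\<^bsub>K\<^esub> Z\<^esub> u"
    and "t \<in> carrier (X \<boxtimes>\<^bsub>K\<^esub> Y \<boxtimes>\<^bsub>K\<^esub> Z)"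
  shows "map23 K X Y Z Y Z g t =
    map23 K X Y Z Y Z f t \<oplus>\<^bsub>X \<boxtimes>\<^bsub>K\<^esub> Y \<boxtimes>\<^bsub>K\<^esub> Z\<^esub> r \<odot>\<^bsub>X \<boxtimes>\<^bsub>K\<^esub> Y \<boxtimes>\<^bsub>K\<^esub> Z\<^esub> t"
proof -
  interpret YZ: module K "Y \<boxtimes>\<^bsub>K\<^esub> Z" by (intro tensor_space_module assms)
  note m = assms(1-3) tensor_space_module
  note lin = map23_linear[OF m(1-3,2,3) assms(4)] and lin' = map23_linear[OF m(1-3,2,3) assms(5)]
  show ?thesis
    by (rule linear_map_eqI_right[OF m(1-3) lin'
          linear_map_add[OF _ lin linear_map_smult[OF _ linear_map_id assms(6)]] _ assms(8)])
      (simp_all add: m map23_tensor tensor_closed linear_mapD(1)[OF assms(4)]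
        assms(4-7) tensor_simps)
qed

section \<open>Hecke relations from Temperley-Lieb relations\<close>

text \<open>If \<open>P = R + p\<close> satisfies \<open>P\<^sup>2 = (p + q) P\<close> and \<open>p q = 1\<close>, then \<open>(R + p) (R - q) = 0\<close>, in the form
  \<open>R\<^sup>2 = 1 + (q - p) R\<close>.\<close>

lemma quadratic_relation:
  assumes "module K V" "linear_map K V V R"
    and "p \<in> carrier K" "q \<in> carrier K" "p \<otimes>\<^bsub>K\<^esub> q = \<one>\<^bsub>K\<^esub>"
    and P: "\<And>x. x \<in> carrier V \<Longrightarrow> P x = R x \<oplus>\<^bsub>V\<^esub> p \<odot>\<^bsub>V\<^esub> x"
    and PP: "\<And>x. x \<in> carrier V \<Longrightarrow> P (P x) = p \<odot>\<^bsub>V\<^esub> P x \<oplus>\<^bsub>V\<^esub> q \<odot>\<^bsub>V\<^esub> P x"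
    and x: "x \<in> carrier V"
  shows "R (R x) = x \<oplus>\<^bsub>V\<^esub> (q \<ominus>\<^bsub>K\<^esub> p) \<odot>\<^bsub>V\<^esub> R x"
proof -
  interpret V: module K V by fact
  note R = linear_mapD[OF assms(2)]
  have Rx: "R x \<in> carrier V" "R (R x) \<in> carrier V"
    using R x by auto
  have qp: "q \<odot>\<^bsub>V\<^esub> (p \<odot>\<^bsub>V\<^esub> x) = x"
    using assms(3-5) x by (simp add: V.smult_assoc1[symmetric] V.m_comm)
  have "(R (R x) \<oplus>\<^bsub>V\<^esub> p \<odot>\<^bsub>V\<^esub> R x) \<oplus>\<^bsub>V\<^esub> (p \<odot>\<^bsub>V\<^esub> R x \<oplus>\<^bsub>V\<^esub> p \<odot>\<^bsub>V\<^esub> (p \<odot>\<^bsub>V\<^esub> x)) = P (P x)"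
    using assms(3) x Rx by (simp add: P R V.smult_r_distr V.a_ac)
  also have "\<dots> = (x \<oplus>\<^bsub>V\<^esub> q \<odot>\<^bsub>V\<^esub> R x) \<oplus>\<^bsub>V\<^esub> (p \<odot>\<^bsub>V\<^esub> R x \<oplus>\<^bsub>V\<^esub> p \<odot>\<^bsub>V\<^esub> (p \<odot>\<^bsub>V\<^esub> x))"
    unfolding PP[OF x] using assms(3,4) x Rx by (simp add: P V.smult_r_distr V.a_ac qp)
  finally have "R (R x) \<oplus>\<^bsub>V\<^esub> p \<odot>\<^bsub>V\<^esub> R x = x \<oplus>\<^bsub>V\<^esub> q \<odot>\<^bsub>V\<^esub> R x"
    using assms(3,4) x Rx by simp
  also have "q \<odot>\<^bsub>V\<^esub> R x = (q \<ominus>\<^bsub>K\<^esub> p) \<odot>\<^bsub>V\<^esub> R x \<oplus>\<^bsub>V\<^esub> p \<odot>\<^bsub>V\<^esub> R x"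
    using assms(3,4) Rx
    by (simp add: V.smult_l_distr[symmetric] a_minus_def V.R.add.m_assoc V.R.l_neg)
  finally show ?thesis
    using assms(3,4) x Rx by (simp add: V.a_assoc[symmetric])
qed

text \<open>Expanding \<open>P Q P + Q\<close> with \<open>P = R + p\<close> and \<open>Q = S + p\<close>, and using the quadratic relation of \<open>R\<close>,
  gives \<open>R S R + B\<close> with \<open>B\<close> symmetric in \<open>R\<close> and \<open>S\<close>. The other side of the Temperley-Lieb type
  relation is therefore \<open>S R S + B\<close>.\<close>

lemma braid_relation:
  assumes "module K V" "linear_map K V V R" "linear_map K V V S"
    and "p \<in> carrier K" "q \<in> carrier K" "p \<otimes>\<^bsub>K\<^esub> q = \<one>\<^bsub>K\<^esub>"
    and P: "\<And>x. x \<in> carrier V \<Longrightarrow> P x = R x \<oplus>\<^bsub>V\<^esub> p \<odot>\<^bsub>V\<^esub> x"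
    and Q: "\<And>x. x \<in> carrier V \<Longrightarrow> Q x = S x \<oplus>\<^bsub>V\<^esub> p \<odot>\<^bsub>V\<^esub> x"
    and RR: "\<And>x. x \<in> carrier V \<Longrightarrow> R (R x) = x \<oplus>\<^bsub>V\<^esub> (q \<ominus>\<^bsub>K\<^esub> p) \<odot>\<^bsub>V\<^esub> R x"
    and SS: "\<And>x. x \<in> carrier V \<Longrightarrow> S (S x) = x \<oplus>\<^bsub>V\<^esub> (q \<ominus>\<^bsub>K\<^esub> p) \<odot>\<^bsub>V\<^esub> S x"
    and x: "x \<in> carrier V"
    and TL: "P (Q (P x)) \<oplus>\<^bsub>V\<^esub> Q x = Q (P (Q x)) \<oplus>\<^bsub>V\<^esub> P x"
  shows "R (S (R x)) = S (R (S x))"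
proof -
  interpret V: module K V by fact
  note R = linear_mapD[OF assms(2)] and S = linear_mapD[OF assms(3)]
  have c: "R y \<in> carrier V" "S y \<in> carrier V" if "y \<in> carrier V" for y
    using R S that by auto
  define l where "l = q \<ominus>\<^bsub>K\<^esub> p"
  have l: "l \<in> carrier K"
    using assms(4,5) by (simp add: l_def)
  have unit: "p \<odot>\<^bsub>V\<^esub> (l \<odot>\<^bsub>V\<^esub> y) \<oplus>\<^bsub>V\<^esub> p \<odot>\<^bsub>V\<^esub> (p \<odot>\<^bsub>V\<^esub> y) = y" if "y \<in> carrier V" for y
  proof -
    have "p \<odot>\<^bsub>V\<^esub> (l \<odot>\<^bsub>V\<^esub> y) \<oplus>\<^bsub>V\<^esub> p \<odot>\<^bsub>V\<^esub> (p \<odot>\<^bsub>V\<^esub> y) = (p \<otimes>\<^bsub>K\<^esub> (l \<oplus>\<^bsub>K\<^esub> p)) \<odot>\<^bsub>V\<^esub> y"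
      using assms(4) l that by (simp add: V.smult_assoc1 V.smult_l_distr V.smult_r_distr)
    also have "l \<oplus>\<^bsub>K\<^esub> p = q"
      using assms(4,5) by (simp add: l_def a_minus_def V.R.add.m_assoc V.R.l_neg)
    finally show ?thesis
      using assms(6) that by simp
  qed
  define B where "B = p \<odot>\<^bsub>V\<^esub> R (S x) \<oplus>\<^bsub>V\<^esub> p \<odot>\<^bsub>V\<^esub> S (R x) \<oplus>\<^bsub>V\<^esub> p \<odot>\<^bsub>V\<^esub> x \<oplus>\<^bsub>V\<^esub> p \<odot>\<^bsub>V\<^esub> x
    \<oplus>\<^bsub>V\<^esub> p \<odot>\<^bsub>V\<^esub> (p \<odot>\<^bsub>V\<^esub> (p \<odot>\<^bsub>V\<^esub> x)) \<oplus>\<^bsub>V\<^esub> p \<odot>\<^bsub>V\<^esub> (p \<odot>\<^bsub>V\<^esub> R x) \<oplus>\<^bsub>V\<^esub> p \<odot>\<^bsub>V\<^esub> (p \<odot>\<^bsub>V\<^esub> S x)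
    \<oplus>\<^bsub>V\<^esub> R x \<oplus>\<^bsub>V\<^esub> S x"
  have B: "B \<in> carrier V"
    using assms(4) x c by (simp add: B_def)
  have "P (Q (P x)) \<oplus>\<^bsub>V\<^esub> Q x = R (S (R x)) \<oplus>\<^bsub>V\<^esub> (p \<odot>\<^bsub>V\<^esub> R (S x) \<oplus>\<^bsub>V\<^esub> p \<odot>\<^bsub>V\<^esub> S (R x) \<oplus>\<^bsub>V\<^esub> p \<odot>\<^bsub>V\<^esub> x
    \<oplus>\<^bsub>V\<^esub> p \<odot>\<^bsub>V\<^esub> x \<oplus>\<^bsub>V\<^esub> p \<odot>\<^bsub>V\<^esub> (p \<odot>\<^bsub>V\<^esub> (p \<odot>\<^bsub>V\<^esub> x)) \<oplus>\<^bsub>V\<^esub> p \<odot>\<^bsub>V\<^esub> (p \<odot>\<^bsub>V\<^esub> R x)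
    \<oplus>\<^bsub>V\<^esub> p \<odot>\<^bsub>V\<^esub> (p \<odot>\<^bsub>V\<^esub> S x) \<oplus>\<^bsub>V\<^esub> (p \<odot>\<^bsub>V\<^esub> (l \<odot>\<^bsub>V\<^esub> R x) \<oplus>\<^bsub>V\<^esub> p \<odot>\<^bsub>V\<^esub> (p \<odot>\<^bsub>V\<^esub> R x)) \<oplus>\<^bsub>V\<^esub> S x)"
    using assms(4) x c l
    by (simp add: P Q R S RR[folded l_def] V.smult_r_distr V.a_ac)
  then have 1: "P (Q (P x)) \<oplus>\<^bsub>V\<^esub> Q x = R (S (R x)) \<oplus>\<^bsub>V\<^esub> B"
    using x c by (simp add: unit B_def)
  have "Q (P (Q x)) \<oplus>\<^bsub>V\<^esub> P x = S (R (S x)) \<oplus>\<^bsub>V\<^esub> (p \<odot>\<^bsub>V\<^esub> R (S x) \<oplus>\<^bsub>V\<^esub> p \<odot>\<^bsub>V\<^esub> S (R x) \<oplus>\<^bsub>V\<^esub> p \<odot>\<^bsub>V\<^esub> x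
    \<oplus>\<^bsub>V\<^esub> p \<odot>\<^bsub>V\<^esub> x \<oplus>\<^bsub>V\<^esub> p \<odot>\<^bsub>V\<^esub> (p \<odot>\<^bsub>V\<^esub> (p \<odot>\<^bsub>V\<^esub> x)) \<oplus>\<^bsub>V\<^esub> p \<odot>\<^bsub>V\<^esub> (p \<odot>\<^bsub>V\<^esub> R x)
    \<oplus>\<^bsub>V\<^esub> p \<odot>\<^bsub>V\<^esub> (p \<odot>\<^bsub>V\<^esub> S x) \<oplus>\<^bsub>V\<^esub> R x \<oplus>\<^bsub>V\<^esub> (p \<odot>\<^bsub>V\<^esub> (l \<odot>\<^bsub>V\<^esub> S x) \<oplus>\<^bsub>V\<^esub> p \<odot>\<^bsub>V\<^esub> (p \<odot>\<^bsub>V\<^esub> S x)))"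
    using assms(4) x c l
    by (simp add: P Q R S SS[folded l_def] V.smult_r_distr V.a_ac)
  then have 2: "Q (P (Q x)) \<oplus>\<^bsub>V\<^esub> P x = S (R (S x)) \<oplus>\<^bsub>V\<^esub> B"
    using x c by (simp add: unit B_def)
  show ?thesis
    using TL x c B unfolding 1 2 by simp
qed

lemma (in field) nonzero_inverse:
  assumes "q \<in> carrier R" "q \<noteq> \<zero>"
  shows "inv q \<in> carrier R" "inv q \<otimes> q = \<one>" "q \<otimes> inv q = \<one>"
  using assms field_Units by simp_all

lemma (in field) smult_inverse_cancel:
  assumes "module R V" "v \<in> carrier V" "q \<in> carrier R" "q \<noteq> \<zero>"
  shows "inv q \<odot>\<^bsub>V\<^esub> (q \<odot>\<^bsub>V\<^esub> v) = v" "q \<odot>\<^bsub>V\<^esub> (inv q \<odot>\<^bsub>V\<^esub> v) = v"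
  using assms nonzero_inverse[OF assms(3,4)]
  by (simp_all add: module.smult_assoc1[symmetric] module.smult_one)

section \<open>The operator of an algebra\<close>

text \<open>The operator \<open>P\<close> with \<open>R = P - p\<close>, where \<open>p\<close> is the inverse of \<open>q\<close>:
  it sends \<open>a \<otimes> b\<close> to \<open>p (ab \<otimes> 1) + q (1 \<otimes> ab)\<close>.\<close>

definition alg_op_P ::
  "('k, 'm) ring_scheme \<Rightarrow> ('k, 'a) module \<Rightarrow> 'k \<Rightarrow> ('a \<times> 'a \<Rightarrow> 'k) set \<Rightarrow> ('a \<times> 'a \<Rightarrow> 'k) set"
  where "alg_op_P K A q X =
    (inv\<^bsub>K\<^esub> q) \<odot>\<^bsub>A \<boxtimes>\<^bsub>K\<^esub> A\<^esub> tensor K A A (product_map K A X) \<one>\<^bsub>A\<^esub>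
    \<oplus>\<^bsub>A \<boxtimes>\<^bsub>K\<^esub> A\<^esub> q \<odot>\<^bsub>A \<boxtimes>\<^bsub>K\<^esub> A\<^esub> tensor K A A \<one>\<^bsub>A\<^esub> (product_map K A X)"

context assoc_algebra
begin

lemma algebra_module: "module K A"
  by (rule module_axioms)

lemma mult_bilinear: "bilinear_map K A A A (\<lambda>x y. x \<otimes>\<^bsub>A\<^esub> y)"
  by (intro bilinear_mapI linear_mapI)
    (simp_all add: A.l_distr A.r_distr smult_mult_l smult_mult_r)

lemma product_map_linear: "linear_map K (A \<boxtimes> A) A (product_map K A)"
  unfolding product_map_def by (intro tensor_lift_linear mult_bilinear algebra_module)

lemma product_map_tensor:
  "\<lbrakk>a \<in> carrier A; b \<in> carrier A\<rbrakk> \<Longrightarrow> product_map K A (tensor K A A a b) = a \<otimes>\<^bsub>A\<^esub> b"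
  unfolding product_map_def by (intro tensor_lift_tensor mult_bilinear algebra_module)

context
  fixes q assumes q: "q \<in> carrier K" "q \<noteq> \<zero>"
begin

private lemmas inv_scalar = K.nonzero_inverse[OF q]

lemma alg_op_W_bilinear: "bilinear_map K A A (A \<boxtimes> A) (\<lambda>a b.
    inv q \<odot>\<^bsub>A \<boxtimes> A\<^esub> tensor K A A (b \<otimes>\<^bsub>A\<^esub> a) \<one>\<^bsub>A\<^esub>
    \<oplus>\<^bsub>A \<boxtimes> A\<^esub> q \<odot>\<^bsub>A \<boxtimes> A\<^esub> tensor K A A \<one>\<^bsub>A\<^esub> (b \<otimes>\<^bsub>A\<^esub> a)
    \<ominus>\<^bsub>A \<boxtimes> A\<^esub> inv q \<odot>\<^bsub>A \<boxtimes> A\<^esub> tensor K A A b a)"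
  by (intro bilinear_mapI linear_map_minus_fun linear_map_add linear_map_smult tensor_space_module
      algebra_module q inv_scalar tensor_linear A.one_closed
      linear_map_comp(2)[OF bilinear_mapD(1)[OF mult_bilinear]]
      linear_map_comp(2)[OF bilinear_mapD(2)[OF mult_bilinear]])

lemma alg_op_R_linear: "linear_map K (A \<boxtimes> A) (A \<boxtimes> A) (alg_op_R K A q)"
  unfolding alg_op_R_def alg_op_W_def
  by (intro linear_map_comp(1)[OF flip_linear] tensor_lift_linear alg_op_W_bilinear
      tensor_space_module algebra_module)

lemma alg_op_P_linear: "linear_map K (A \<boxtimes> A) (A \<boxtimes> A) (alg_op_P K A q)"
  unfolding alg_op_P_def
  by (intro linear_map_add linear_map_smult tensor_space_module algebra_module q inv_scalar
      linear_map_comp(2)[OF product_map_linear] tensor_linear A.one_closed)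

lemma alg_op_P_R:
  assumes "X \<in> carrier (A \<boxtimes> A)"
  shows "alg_op_P K A q X = alg_op_R K A q X \<oplus>\<^bsub>A \<boxtimes> A\<^esub> inv q \<odot>\<^bsub>A \<boxtimes> A\<^esub> X"
proof -
  interpret AA: module K "A \<boxtimes> A"
    by (intro tensor_space_module algebra_module)
  have R: "alg_op_R K A q (tensor K A A a b) =
      inv q \<odot>\<^bsub>A \<boxtimes> A\<^esub> tensor K A A (a \<otimes>\<^bsub>A\<^esub> b) \<one>\<^bsub>A\<^esub>
      \<oplus>\<^bsub>A \<boxtimes> A\<^esub> q \<odot>\<^bsub>A \<boxtimes> A\<^esub> tensor K A A \<one>\<^bsub>A\<^esub> (a \<otimes>\<^bsub>A\<^esub> b)
      \<ominus>\<^bsub>A \<boxtimes> A\<^esub> inv q \<odot>\<^bsub>A \<boxtimes> A\<^esub> tensor K A A a b"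
    if "a \<in> carrier A" "b \<in> carrier A" for a b
    using that by (simp add: alg_op_R_def alg_op_W_def flip_tensor algebra_module
        tensor_lift_tensor[OF algebra_module algebra_module AA.module_axioms alg_op_W_bilinear])
  show ?thesis
    by (rule linear_map_eqI[OF algebra_module algebra_module alg_op_P_linear
          linear_map_add[OF AA.module_axioms alg_op_R_linear
            linear_map_smult[OF AA.module_axioms linear_map_id inv_scalar(1)]] _ assms])
      (simp add: R alg_op_P_def product_map_tensor a_minus_def AA.a_assoc AA.l_neg tensor_closed
        algebra_module q inv_scalar)
qed

private lemmas smult_inv_cancel = K.smult_inverse_cancel[OF _ _ q]

lemma alg_op_P_P:
  assumes "X \<in> carrier (A \<boxtimes> A)"
  shows "alg_op_P K A q (alg_op_P K A q X) = inv q \<odot>\<^bsub>A \<boxtimes> A\<^esub> alg_op_P K A q X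
    \<oplus>\<^bsub>A \<boxtimes> A\<^esub> q \<odot>\<^bsub>A \<boxtimes> A\<^esub> alg_op_P K A q X"
proof -
  interpret AA: module K "A \<boxtimes> A"
    by (intro tensor_space_module algebra_module)
  let ?m = "product_map K A"
  note m = linear_mapD[OF product_map_linear]
  have x: "?m X \<in> carrier A" using assms by (rule m)
  have "?m (alg_op_P K A q X) = inv q \<odot>\<^bsub>A\<^esub> ?m X \<oplus>\<^bsub>A\<^esub> q \<odot>\<^bsub>A\<^esub> ?m X"
    using x q inv_scalar
    by (simp add: alg_op_P_def m product_map_tensor tensor_closed algebra_module)
  then show ?thesis
    using x q inv_scalar
    by (simp add: alg_op_P_def tensor_simps tensor_closed algebra_module AA.smult_r_distr
        AA.smult_l_distr AA.a_ac smult_inv_cancel[OF AA.module_axioms])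
qed

lemma alg_op_R_quadratic:
  assumes "X \<in> carrier (A \<boxtimes> A)"
  shows "alg_op_R K A q (alg_op_R K A q X) =
    X \<oplus>\<^bsub>A \<boxtimes> A\<^esub> (q \<ominus> inv q) \<odot>\<^bsub>A \<boxtimes> A\<^esub> alg_op_R K A q X"
  by (rule quadratic_relation[OF _ alg_op_R_linear inv_scalar(1) q(1) inv_scalar(2) alg_op_P_R
        alg_op_P_P assms]) (simp_all add: tensor_space_module algebra_module)

lemma alg_op_P_temperley_lieb:
  defines "P12 \<equiv> map12 K A A A A A (alg_op_P K A q)"
    and "P23 \<equiv> map23 K A A A A A (alg_op_P K A q)"
  assumes "X \<in> carrier (A \<boxtimes> A \<boxtimes> A)"
  shows "P12 (P23 (P12 X)) \<oplus>\<^bsub>A \<boxtimes> A \<boxtimes> A\<^esub> P23 X = P23 (P12 (P23 X)) \<oplus>\<^bsub>A \<boxtimes> A \<boxtimes> A\<^esub> P12 X"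
proof -
  let ?M = "A \<boxtimes> A \<boxtimes> A"
  note m = algebra_module
  interpret AA: module K "A \<boxtimes> A"
    by (intro tensor_space_module m)
  interpret M: module K ?M
    by (intro tensor_space_module m)
  let ?t = "\<lambda>a b c. tensor K A (A \<boxtimes> A) a (tensor K A A b c)"
  have lin: "linear_map K ?M ?M P12" "linear_map K ?M ?M P23"
    unfolding P12_def P23_def by (intro map12_linear map23_linear m alg_op_P_linear)+
  note D = linear_mapD[OF lin(1)] linear_mapD[OF lin(2)]
  have tc: "?t a b c \<in> carrier ?M" if "a \<in> carrier A" "b \<in> carrier A" "c \<in> carrier A" for a b c
    using that by (simp add: tensor_closed tensor_space_module m)
  note g = linear_mapD[OF assoc_r_tensor_linear[OF m m m]]
  have t12: "P12 (?t a b c) = inv q \<odot>\<^bsub>?M\<^esub> ?t (a \<otimes>\<^bsub>A\<^esub> b) \<one>\<^bsub>A\<^esub> c \<oplus>\<^bsub>?M\<^esub> q \<odot>\<^bsub>?M\<^esub> ?t \<one>\<^bsub>A\<^esub> (a \<otimes>\<^bsub>A\<^esub> b) c"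
    if "a \<in> carrier A" "b \<in> carrier A" "c \<in> carrier A" for a b c
    using that q inv_scalar unfolding P12_def
    by (simp add: map12_tensor m alg_op_P_linear alg_op_P_def[of K A q "tensor K A A a b"]
        product_map_tensor g assoc_r_tensor tensor_closed)
  have t23: "P23 (?t a b c) = inv q \<odot>\<^bsub>?M\<^esub> ?t a (b \<otimes>\<^bsub>A\<^esub> c) \<one>\<^bsub>A\<^esub> \<oplus>\<^bsub>?M\<^esub> q \<odot>\<^bsub>?M\<^esub> ?t a \<one>\<^bsub>A\<^esub> (b \<otimes>\<^bsub>A\<^esub> c)"
    if "a \<in> carrier A" "b \<in> carrier A" "c \<in> carrier A" for a b c
    using that q inv_scalar unfolding P23_def
    by (simp add: map23_tensor m alg_op_P_linear alg_op_P_def[of K A q "tensor K A A b c"]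
        product_map_tensor tensor_simps tensor_space_module tensor_closed)
  show ?thesis
  proof (rule linear_map_eqI_right[OF m m m linear_map_add[OF M.module_axioms
          linear_map_comp(2)[OF linear_map_comp(2)[OF lin(1,2)] lin(1)] lin(2)]
        linear_map_add[OF M.module_axioms
          linear_map_comp(2)[OF linear_map_comp(2)[OF lin(2,1)] lin(2)] lin(1)] _ assms(3)])
    fix a b c assume abc: "a \<in> carrier A" "b \<in> carrier A" "c \<in> carrier A"
    show "P12 (P23 (P12 (?t a b c))) \<oplus>\<^bsub>?M\<^esub> P23 (?t a b c) =
        P23 (P12 (P23 (?t a b c))) \<oplus>\<^bsub>?M\<^esub> P12 (?t a b c)"
      using abc q inv_scalar
      by (simp add: t12 t23 tc D M.smult_r_distr smult_inv_cancel[OF M.module_axioms] A.m_assoc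
          M.a_ac)
  qed
qed

lemma alg_op_R_braid:
  defines "R12 \<equiv> map12 K A A A A A (alg_op_R K A q)"
    and "R23 \<equiv> map23 K A A A A A (alg_op_R K A q)"
  assumes "X \<in> carrier (A \<boxtimes> A \<boxtimes> A)"
  shows "R12 (R23 (R12 X)) = R23 (R12 (R23 X))"
proof -
  note m = algebra_module and l = inv_scalar(1) q(1) inv_scalar(2)
  have "q \<ominus> inv q \<in> carrier K"
    using q inv_scalar by simp
  then show ?thesis
    unfolding R12_def R23_def
    by (intro braid_relation[OF _ _ _ l map12_shift[OF m m m alg_op_R_linear alg_op_P_linear l(1) alg_op_P_R]
          map23_shift[OF m m m alg_op_R_linear alg_op_P_linear l(1) alg_op_P_R]
          map12_quadratic[OF m m m alg_op_R_linear _ alg_op_R_quadratic]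
          map23_quadratic[OF m m m alg_op_R_linear _ alg_op_R_quadratic]]
        map12_linear map23_linear tensor_space_module m alg_op_R_linear assms(3)
        alg_op_P_temperley_lieb)
qed

end

end

section \<open>The operator of a coalgebra\<close>

text \<open>The maps \<open>id \<otimes> \<epsilon>\<close> from \<open>V \<otimes> C\<close> to \<open>V\<close> and \<open>\<epsilon> \<otimes> id\<close> from \<open>C \<otimes> V\<close> to \<open>V\<close>, after the
  identification of \<open>V \<otimes> k\<close> and of \<open>k \<otimes> V\<close> with \<open>V\<close>.\<close>

definition counit_r ::
  "('k, 'm) ring_scheme \<Rightarrow> ('k, 'c) module \<Rightarrow> ('c \<Rightarrow> 'k) \<Rightarrow> ('k, 'v) module \<Rightarrow>
   ('v \<times> 'c \<Rightarrow> 'k) set \<Rightarrow> 'v"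
  where "counit_r K C \<epsilon> V X =
    unit_r K V (tensor_map K V C V (ground_space K) (\<lambda>x. x) \<epsilon> X)"

definition counit_l ::
  "('k, 'm) ring_scheme \<Rightarrow> ('k, 'c) module \<Rightarrow> ('c \<Rightarrow> 'k) \<Rightarrow> ('k, 'v) module \<Rightarrow>
   ('c \<times> 'v \<Rightarrow> 'k) set \<Rightarrow> 'v"
  where "counit_l K C \<epsilon> V X =
    unit_l K V (tensor_map K C V (ground_space K) V \<epsilon> (\<lambda>x. x) X)"

text \<open>The operator \<open>P'\<close> with \<open>R' = P' - p\<close>, where \<open>p\<close> is the inverse of \<open>q\<close>:
  it sends \<open>c \<otimes> d\<close> to \<open>q \<epsilon>(d) \<Delta>(c) + p \<epsilon>(c) \<Delta>(d)\<close>.\<close>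

definition coalg_op_P ::
  "('k, 'm) ring_scheme \<Rightarrow> ('k, 'c) module \<Rightarrow> ('c \<Rightarrow> ('c \<times> 'c \<Rightarrow> 'k) set) \<Rightarrow> ('c \<Rightarrow> 'k) \<Rightarrow> 'k \<Rightarrow>
   ('c \<times> 'c \<Rightarrow> 'k) set \<Rightarrow> ('c \<times> 'c \<Rightarrow> 'k) set"
  where "coalg_op_P K C \<Delta> \<epsilon> q X =
    q \<odot>\<^bsub>C \<boxtimes>\<^bsub>K\<^esub> C\<^esub> \<Delta> (counit_r K C \<epsilon> C X)
    \<oplus>\<^bsub>C \<boxtimes>\<^bsub>K\<^esub> C\<^esub> (inv\<^bsub>K\<^esub> q) \<odot>\<^bsub>C \<boxtimes>\<^bsub>K\<^esub> C\<^esub> \<Delta> (counit_l K C \<epsilon> C X)"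

context coalgebra
begin

lemma coalgebra_module: "module K C"
  by (rule module_axioms)

lemma counit_closed: "c \<in> carrier C \<Longrightarrow> \<epsilon> c \<in> carrier K"
  using linear_mapD(1)[OF counit_linear] by (simp add: ground_space_simps)

lemma counit_r_linear:
  assumes "module K V"
  shows "linear_map K (V \<boxtimes> C) V (counit_r K C \<epsilon> V)"
  unfolding counit_r_def
  by (intro linear_map_comp(2)[OF tensor_map_linear unit_r_linear] assms coalgebra_module
      ground_space_module K.cring_axioms linear_map_id counit_linear)

lemma counit_l_linear:
  assumes "module K V"
  shows "linear_map K (C \<boxtimes> V) V (counit_l K C \<epsilon> V)"
  unfolding counit_l_def
  by (intro linear_map_comp(2)[OF tensor_map_linear unit_l_linear] assms coalgebra_module
      ground_space_module K.cring_axioms linear_map_id counit_linear)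

lemma counit_r_tensor:
  assumes "module K V" "v \<in> carrier V" "c \<in> carrier C"
  shows "counit_r K C \<epsilon> V (tensor K V C v c) = \<epsilon> c \<odot>\<^bsub>V\<^esub> v"
  using assms by (simp add: counit_r_def tensor_map_tensor coalgebra_module ground_space_module
      K.cring_axioms linear_map_id counit_linear unit_r_tensor counit_closed)

lemma counit_l_tensor:
  assumes "module K V" "v \<in> carrier V" "c \<in> carrier C"
  shows "counit_l K C \<epsilon> V (tensor K C V c v) = \<epsilon> c \<odot>\<^bsub>V\<^esub> v"
  using assms by (simp add: counit_l_def tensor_map_tensor coalgebra_module ground_space_module
      K.cring_axioms linear_map_id counit_linear unit_l_tensor counit_closed)

lemma counit_coproduct:
  assumes "c \<in> carrier C"
  shows "counit_l K C \<epsilon> C (\<Delta> c) = c" "counit_r K C \<epsilon> C (\<Delta> c) = c"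
  using counit_left[OF assms] counit_right[OF assms] by (simp_all add: counit_l_def counit_r_def)

context
  fixes q assumes q: "q \<in> carrier K" "q \<noteq> \<zero>"
begin

private lemmas inv_scalar = K.nonzero_inverse[OF q]
private lemmas smult_inv_cancel = K.smult_inverse_cancel[OF _ _ q]

lemma counit_smult_linear:
  assumes "module K V" "v \<in> carrier V" "r \<in> carrier K"
  shows "linear_map K C V (\<lambda>c. (r \<otimes> \<epsilon> c) \<odot>\<^bsub>V\<^esub> v)"
proof -
  interpret V: module K V by fact
  note e = linear_mapD(2,3)[OF counit_linear, unfolded ground_space_simps]
  show ?thesis
    using assms(2,3)
    by (intro linear_mapI)
      (simp_all add: e counit_closed K.r_distr V.smult_l_distr V.smult_assoc1[symmetric] K.m_ac)
qed

lemma coalg_op_Z_bilinear: "bilinear_map K C C (C \<boxtimes> C) (\<lambda>c d.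
    (q \<otimes> \<epsilon> c) \<odot>\<^bsub>C \<boxtimes> C\<^esub> \<Delta> d
    \<oplus>\<^bsub>C \<boxtimes> C\<^esub> (inv q \<otimes> \<epsilon> d) \<odot>\<^bsub>C \<boxtimes> C\<^esub> \<Delta> c
    \<ominus>\<^bsub>C \<boxtimes> C\<^esub> inv q \<odot>\<^bsub>C \<boxtimes> C\<^esub> tensor K C C d c)"
  by (intro bilinear_mapI linear_map_minus_fun linear_map_add linear_map_smult tensor_space_module
      counit_smult_linear coproduct_linear linear_mapD(1)[OF coproduct_linear]
      coalgebra_module q inv_scalar tensor_linear K.m_closed counit_closed)

lemma coalg_op_R'_linear: "linear_map K (C \<boxtimes> C) (C \<boxtimes> C) (coalg_op_R' K C \<Delta> \<epsilon> q)"
  unfolding coalg_op_R'_def coalg_op_Z_def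
  by (intro linear_map_comp(1)[OF flip_linear] tensor_lift_linear coalg_op_Z_bilinear
      tensor_space_module coalgebra_module)

lemma coalg_op_P_linear: "linear_map K (C \<boxtimes> C) (C \<boxtimes> C) (coalg_op_P K C \<Delta> \<epsilon> q)"
  unfolding coalg_op_P_def
  by (intro linear_map_add linear_map_smult tensor_space_module coalgebra_module q inv_scalar
      linear_map_comp(2)[OF counit_r_linear coproduct_linear]
      linear_map_comp(2)[OF counit_l_linear coproduct_linear])

lemma coalg_op_P_R':
  assumes "X \<in> carrier (C \<boxtimes> C)"
  shows "coalg_op_P K C \<Delta> \<epsilon> q X =
    coalg_op_R' K C \<Delta> \<epsilon> q X \<oplus>\<^bsub>C \<boxtimes> C\<^esub> inv q \<odot>\<^bsub>C \<boxtimes> C\<^esub> X"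
proof -
  note m = coalgebra_module
  interpret CC: module K "C \<boxtimes> C"
    by (intro tensor_space_module m)
  note D = linear_mapD[OF coproduct_linear]
  have R: "coalg_op_R' K C \<Delta> \<epsilon> q (tensor K C C c d) =
      (q \<otimes> \<epsilon> d) \<odot>\<^bsub>C \<boxtimes> C\<^esub> \<Delta> c
      \<oplus>\<^bsub>C \<boxtimes> C\<^esub> (inv q \<otimes> \<epsilon> c) \<odot>\<^bsub>C \<boxtimes> C\<^esub> \<Delta> d
      \<ominus>\<^bsub>C \<boxtimes> C\<^esub> inv q \<odot>\<^bsub>C \<boxtimes> C\<^esub> tensor K C C c d"
    if "c \<in> carrier C" "d \<in> carrier C" for c d
    using that by (simp add: coalg_op_R'_def coalg_op_Z_def flip_tensor m
        tensor_lift_tensor[OF m m CC.module_axioms coalg_op_Z_bilinear])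
  show ?thesis
    by (rule linear_map_eqI[OF m m coalg_op_P_linear
          linear_map_add[OF CC.module_axioms coalg_op_R'_linear
            linear_map_smult[OF CC.module_axioms linear_map_id inv_scalar(1)]] _ assms])
      (simp add: R coalg_op_P_def counit_l_tensor counit_r_tensor a_minus_def CC.a_assoc CC.l_neg
        tensor_closed m q inv_scalar D counit_closed CC.smult_assoc1)
qed

lemma coalg_op_P_P:
  assumes "X \<in> carrier (C \<boxtimes> C)"
  shows "coalg_op_P K C \<Delta> \<epsilon> q (coalg_op_P K C \<Delta> \<epsilon> q X) =
    inv q \<odot>\<^bsub>C \<boxtimes> C\<^esub> coalg_op_P K C \<Delta> \<epsilon> q X
    \<oplus>\<^bsub>C \<boxtimes> C\<^esub> q \<odot>\<^bsub>C \<boxtimes> C\<^esub> coalg_op_P K C \<Delta> \<epsilon> q X"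
proof -
  note m = coalgebra_module
  interpret CC: module K "C \<boxtimes> C"
    by (intro tensor_space_module m)
  note D = linear_mapD[OF coproduct_linear] and r = linear_mapD[OF counit_r_linear[OF m]]
    and l = linear_mapD[OF counit_l_linear[OF m]]
  show ?thesis
    using assms q inv_scalar
    by (simp add: coalg_op_P_def D r l counit_coproduct CC.smult_r_distr
        smult_inv_cancel[OF CC.module_axioms] smult_inv_cancel[OF m] CC.a_ac)
qed

lemma coalg_op_R'_quadratic:
  assumes "X \<in> carrier (C \<boxtimes> C)"
  shows "coalg_op_R' K C \<Delta> \<epsilon> q (coalg_op_R' K C \<Delta> \<epsilon> q X) =
    X \<oplus>\<^bsub>C \<boxtimes> C\<^esub> (q \<ominus> inv q) \<odot>\<^bsub>C \<boxtimes> C\<^esub> coalg_op_R' K C \<Delta> \<epsilon> q X"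
  by (rule quadratic_relation[OF _ coalg_op_R'_linear inv_scalar(1) q(1) inv_scalar(2)
        coalg_op_P_R' coalg_op_P_P assms]) (simp_all add: tensor_space_module coalgebra_module)

text \<open>Both amplifications are sums of a counit applied to one factor followed by a coproduct, so the
  relation follows from rules for composing one coproduct with one counit in \<open>C \<otimes> C \<otimes> C\<close>, without
  choosing representatives of coproducts.\<close>

lemma coalg_op_P_temperley_lieb:
  defines "P12 \<equiv> map12 K C C C C C (coalg_op_P K C \<Delta> \<epsilon> q)"
    and "P23 \<equiv> map23 K C C C C C (coalg_op_P K C \<Delta> \<epsilon> q)"
  assumes "X \<in> carrier (C \<boxtimes> C \<boxtimes> C)"
  shows "P12 (P23 (P12 X)) \<oplus>\<^bsub>C \<boxtimes> C \<boxtimes> C\<^esub> P23 X = P23 (P12 (P23 X)) \<oplus>\<^bsub>C \<boxtimes> C \<boxtimes> C\<^esub> P12 X"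
proof -
  let ?W = "C \<boxtimes> C" and ?M = "C \<boxtimes> C \<boxtimes> C"
  note m = coalgebra_module
  have mW: "module K ?W" and mM: "module K ?M"
    by (intro tensor_space_module m)+
  interpret W: module K ?W by (rule mW)
  interpret M: module K ?M by (rule mM)
  \<comment> \<open>coproducts applied to one factor of \<open>C \<otimes> C\<close>, counits applied to one factor of
    \<open>C \<otimes> C \<otimes> C\<close> (\<open>E\<close>) and of \<open>C \<otimes> C\<close> (\<open>l\<close>, \<open>r\<close>)\<close>
  define D12 where "D12 = (\<lambda>X. assoc_r K C C C (tensor_map K C C ?W C \<Delta> (\<lambda>x. x) X))"
  define D23 where "D23 = tensor_map K C C C ?W (\<lambda>x. x) \<Delta>"
  define E1 where "E1 = counit_l K C \<epsilon> ?W"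
  define E2 where "E2 = tensor_map K C ?W C C (\<lambda>x. x) (counit_l K C \<epsilon> C)"
  define E3 where "E3 = tensor_map K C ?W C C (\<lambda>x. x) (counit_r K C \<epsilon> C)"
  define l where "l = counit_l K C \<epsilon> C"
  define r where "r = counit_r K C \<epsilon> C"
  note defs = D12_def D23_def E1_def E2_def E3_def l_def r_def
  have D12_lin: "linear_map K ?W ?M D12"
    unfolding D12_def by (intro linear_map_comp(2)[OF tensor_map_linear assoc_r_linear] m mW
        coproduct_linear linear_map_id)
  have D23_lin: "linear_map K ?W ?M D23"
    unfolding D23_def by (intro tensor_map_linear m mW coproduct_linear linear_map_id)
  have E1_lin: "linear_map K ?M ?W E1"
    unfolding E1_def by (intro counit_l_linear mW)
  have E2_lin: "linear_map K ?M ?W E2"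
    unfolding E2_def by (intro tensor_map_linear m mW counit_l_linear linear_map_id)
  have E3_lin: "linear_map K ?M ?W E3"
    unfolding E3_def by (intro tensor_map_linear m mW counit_r_linear linear_map_id)
  have l_lin: "linear_map K ?W C l" and r_lin: "linear_map K ?W C r"
    unfolding l_def r_def by (intro counit_l_linear counit_r_linear m)+
  note L = linear_mapD[OF D12_lin] linear_mapD[OF D23_lin] linear_mapD[OF E1_lin]
    linear_mapD[OF E2_lin] linear_mapD[OF E3_lin] linear_mapD[OF l_lin] linear_mapD[OF r_lin]
    linear_mapD[OF coproduct_linear]
  note g = linear_mapD[OF assoc_r_tensor_linear[OF m m m]]
  have D12: "D12 (tensor K C C c d) = assoc_r K C C C (tensor K ?W C (\<Delta> c) d)"
    and D23: "D23 (tensor K C C c d) = tensor K C ?W c (\<Delta> d)"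
    and l: "l (tensor K C C c d) = \<epsilon> c \<odot>\<^bsub>C\<^esub> d"
    and r: "r (tensor K C C c d) = \<epsilon> d \<odot>\<^bsub>C\<^esub> c"
    if "c \<in> carrier C" "d \<in> carrier C" for c d
    using that by (simp_all add: defs tensor_map_tensor m mW coproduct_linear linear_map_id
        counit_l_tensor counit_r_tensor)
  have E1: "E1 (tensor K C ?W c X) = \<epsilon> c \<odot>\<^bsub>?W\<^esub> X"
    and E2: "E2 (tensor K C ?W c X) = tensor K C C c (l X)"
    and E3: "E3 (tensor K C ?W c X) = tensor K C C c (r X)"
    if "c \<in> carrier C" "X \<in> carrier ?W" for c X
    using that by (simp_all add: defs tensor_map_tensor m mW linear_map_id counit_l_tensor
        counit_l_linear counit_r_linear)
  have a1: "E1 (assoc_r K C C C (tensor K ?W C X d)) = tensor K C C (l X) d"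
    and a2: "E2 (assoc_r K C C C (tensor K ?W C X d)) = tensor K C C (r X) d"
    and a3: "E3 (assoc_r K C C C (tensor K ?W C X d)) = \<epsilon> d \<odot>\<^bsub>?W\<^esub> X"
    if d: "d \<in> carrier C" and X: "X \<in> carrier ?W" for X d
  proof -
    note t = linear_map_comp(2)[OF assoc_r_tensor_linear[OF m m m d]] tensor_linear(2)[OF m m d]
    show "E1 (assoc_r K C C C (tensor K ?W C X d)) = tensor K C C (l X) d"
      by (rule linear_map_eqI[OF m m t(1)[OF E1_lin] linear_map_comp(2)[OF l_lin t(2)] _ X])
        (simp add: assoc_r_tensor m d E1 l tensor_closed tensor_simps counit_closed)
    show "E2 (assoc_r K C C C (tensor K ?W C X d)) = tensor K C C (r X) d"
      by (rule linear_map_eqI[OF m m t(1)[OF E2_lin] linear_map_comp(2)[OF r_lin t(2)] _ X])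
        (simp add: assoc_r_tensor m d E2 l r tensor_closed tensor_simps counit_closed)
    show "E3 (assoc_r K C C C (tensor K ?W C X d)) = \<epsilon> d \<odot>\<^bsub>?W\<^esub> X"
      by (rule linear_map_eqI[OF m m t(1)[OF E3_lin]
            linear_map_smult[OF mW linear_map_id counit_closed[OF d]] _ X])
        (simp add: assoc_r_tensor m d E3 r tensor_closed tensor_simps counit_closed)
  qed
  have lr: "l (\<Delta> c) = c" "r (\<Delta> c) = c" if "c \<in> carrier C" for c
    using that by (simp_all add: l_def r_def counit_coproduct)
  have ED: "E1 (D12 Y) = Y" "E2 (D12 Y) = Y" "E3 (D12 Y) = \<Delta> (r Y)"
    "E1 (D23 Y) = \<Delta> (l Y)" "E2 (D23 Y) = Y" "E3 (D23 Y) = Y" if Y: "Y \<in> carrier ?W" for Y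
  proof -
    note c = linear_map_comp(2)
    show "E1 (D12 Y) = Y"
      by (rule linear_map_eqI[OF m m c[OF D12_lin E1_lin] linear_map_id _ Y])
        (simp add: D12 a1 L lr)
    show "E2 (D12 Y) = Y"
      by (rule linear_map_eqI[OF m m c[OF D12_lin E2_lin] linear_map_id _ Y])
        (simp add: D12 a2 L lr)
    show "E3 (D12 Y) = \<Delta> (r Y)"
      by (rule linear_map_eqI[OF m m c[OF D12_lin E3_lin] c[OF r_lin coproduct_linear] _ Y])
        (simp add: D12 a3 L r counit_closed)
    show "E1 (D23 Y) = \<Delta> (l Y)"
      by (rule linear_map_eqI[OF m m c[OF D23_lin E1_lin] c[OF l_lin coproduct_linear] _ Y])
        (simp add: D23 E1 L l counit_closed)
    show "E2 (D23 Y) = Y"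
      by (rule linear_map_eqI[OF m m c[OF D23_lin E2_lin] linear_map_id _ Y])
        (simp add: D23 E2 L lr)
    show "E3 (D23 Y) = Y"
      by (rule linear_map_eqI[OF m m c[OF D23_lin E3_lin] linear_map_id _ Y])
        (simp add: D23 E3 L lr)
  qed
  have coassoc: "D12 (\<Delta> c) = D23 (\<Delta> c)" if "c \<in> carrier C" for c
    using coassociative[OF that] by (simp add: D12_def D23_def)
  have EE: "l (E2 Z) = l (E1 Z)" "r (E3 Z) = r (E2 Z)" "l (E3 Z) = r (E1 Z)"
    if Z: "Z \<in> carrier ?M" for Z
  proof -
    note c = linear_map_comp(2)
    show "l (E2 Z) = l (E1 Z)"
      by (rule linear_map_eqI_right[OF m m m c[OF E2_lin l_lin] c[OF E1_lin l_lin] _ Z])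
        (simp add: E1 E2 l r tensor_closed m L counit_closed)
    show "r (E3 Z) = r (E2 Z)"
      by (rule linear_map_eqI_right[OF m m m c[OF E3_lin r_lin] c[OF E2_lin r_lin] _ Z])
        (simp add: E2 E3 l r tensor_closed m L counit_closed tensor_simps smult_assoc1[symmetric]
          K.m_comm linear_mapD(3)[OF counit_linear, unfolded ground_space_simps])
    show "l (E3 Z) = r (E1 Z)"
      by (rule linear_map_eqI_right[OF m m m c[OF E3_lin l_lin] c[OF E1_lin r_lin] _ Z])
        (simp add: E1 E3 l r tensor_closed m L counit_closed smult_assoc1[symmetric] K.m_comm)
  qed
  have P12: "P12 Z = q \<odot>\<^bsub>?M\<^esub> D12 (E2 Z) \<oplus>\<^bsub>?M\<^esub> inv q \<odot>\<^bsub>?M\<^esub> D12 (E1 Z)"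
    if Z: "Z \<in> carrier ?M" for Z
    unfolding P12_def
    by (rule linear_map_eqI_right[OF m m m map12_linear[OF m m m m m coalg_op_P_linear]
          linear_map_add[OF mM linear_map_smult[OF mM linear_map_comp(2)[OF E2_lin D12_lin] q(1)]
            linear_map_smult[OF mM linear_map_comp(2)[OF E1_lin D12_lin] inv_scalar(1)]] _ Z])
      (simp add: map12_tensor m coalg_op_P_linear coalg_op_P_def[of K C \<Delta> \<epsilon> q "tensor K C C _ _"]
        l_def[symmetric] r_def[symmetric] l r E1 E2 D12 L tensor_closed counit_closed q inv_scalar g
        tensor_simps)
  have P23: "P23 Z = q \<odot>\<^bsub>?M\<^esub> D23 (E3 Z) \<oplus>\<^bsub>?M\<^esub> inv q \<odot>\<^bsub>?M\<^esub> D23 (E2 Z)"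
    if Z: "Z \<in> carrier ?M" for Z
    unfolding P23_def
    by (rule linear_map_eqI_right[OF m m m map23_linear[OF m m m m m coalg_op_P_linear]
          linear_map_add[OF mM linear_map_smult[OF mM linear_map_comp(2)[OF E3_lin D23_lin] q(1)]
            linear_map_smult[OF mM linear_map_comp(2)[OF E2_lin D23_lin] inv_scalar(1)]] _ Z])
      (simp add: map23_tensor m mW coalg_op_P_linear
        coalg_op_P_def[of K C \<Delta> \<epsilon> q "tensor K C C _ _"]
        l_def[symmetric] r_def[symmetric] l r E3 E2 D23 L tensor_closed counit_closed q inv_scalar
        tensor_simps)
  show ?thesis
    using assms(3) q inv_scalar
    by (simp add: P12 P23 L ED EE lr coassoc M.smult_r_distr W.smult_r_distr smult_r_distr
        smult_inv_cancel[OF mM] smult_inv_cancel[OF mW] smult_inv_cancel[OF m] M.a_ac)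
qed

lemma coalg_op_R'_braid:
  defines "R12 \<equiv> map12 K C C C C C (coalg_op_R' K C \<Delta> \<epsilon> q)"
    and "R23 \<equiv> map23 K C C C C C (coalg_op_R' K C \<Delta> \<epsilon> q)"
  assumes "X \<in> carrier (C \<boxtimes> C \<boxtimes> C)"
  shows "R12 (R23 (R12 X)) = R23 (R12 (R23 X))"
proof -
  note m = coalgebra_module and l = inv_scalar(1) q(1) inv_scalar(2)
    and R = coalg_op_R'_linear coalg_op_P_linear
  have "q \<ominus> inv q \<in> carrier K"
    using q inv_scalar by simp
  then show ?thesis
    unfolding R12_def R23_def
    by (intro braid_relation[OF _ _ _ l map12_shift[OF m m m R l(1) coalg_op_P_R']
          map23_shift[OF m m m R l(1) coalg_op_P_R']
          map12_quadratic[OF m m m R(1) _ coalg_op_R'_quadratic]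
          map23_quadratic[OF m m m R(1) _ coalg_op_R'_quadratic]]
        map12_linear map23_linear tensor_space_module m R(1) assms(3)
        coalg_op_P_temperley_lieb)
qed

end

end

section \<open>The entwining map intertwines the operators\<close>

context entwining_structure
begin

context
  fixes q assumes q: "q \<in> carrier K" "q \<noteq> \<zero>"
begin

private lemmas inverse_scalar = K.nonzero_inverse[OF q]

text \<open>The operator \<open>P\<close> multiplies and then inserts a unit. The product axiom moves \<open>\<psi>\<close> past the
  multiplication, the unit axiom moves it past the two insertions.\<close>

lemma entwining_alg_op_P:
  assumes "X \<in> carrier (C \<boxtimes> A \<boxtimes> A)"
  shows "map12 K A A C A A (alg_op_P K A q) (map23 K A C A A C \<psi> (map12 K C A A A C \<psi> X)) =
    map23 K A C A A C \<psi> (map12 K C A A A C \<psi> (map23 K C A A A A (alg_op_P K A q) X))"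
proof -
  note mA = algebra_module and mC = coalgebra_module
  note m = mA mC tensor_space_module
  have mAA: "module K (A \<boxtimes> A)" and mAC: "module K (A \<boxtimes> C)" and mCA: "module K (C \<boxtimes> A)"
    and mCAA: "module K (C \<boxtimes> A \<boxtimes> A)" and mAAC: "module K (A \<boxtimes> A \<boxtimes> C)"
    by (intro m)+
  note one = A.one_closed
  note comp = linear_map_comp(2)
  let ?p12 = "map12 K C A A A C \<psi>" and ?p23 = "map23 K A C A A C \<psi>"
  define m12 where "m12 = (\<lambda>Y. tensor_map K (A \<boxtimes> A) C A C (product_map K A) (\<lambda>x. x) (assoc_l K A A C Y))"
  define m23 where "m23 = tensor_map K C (A \<boxtimes> A) C A (\<lambda>x. x) (product_map K A)"
  \<comment> \<open>insertions of the unit to the right (\<open>r\<close>) and to the left (\<open>l\<close>) of the factor \<open>A\<close>, in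
    \<open>A \<otimes> C\<close> and in \<open>C \<otimes> A\<close>\<close>
  define r12 where "r12 = tensor_map K A C A (A \<boxtimes> C) (\<lambda>x. x) (tensor K A C \<one>\<^bsub>A\<^esub>)"
  define l12 where "l12 = tensor K A (A \<boxtimes> C) \<one>\<^bsub>A\<^esub>"
  define r23 where "r23 = tensor_map K C A C (A \<boxtimes> A) (\<lambda>x. x) (\<lambda>a. tensor K A A a \<one>\<^bsub>A\<^esub>)"
  define l23 where "l23 = tensor_map K C A C (A \<boxtimes> A) (\<lambda>x. x) (tensor K A A \<one>\<^bsub>A\<^esub>)"
  note defs = m12_def m23_def r12_def l12_def r23_def l23_def
  have m12_lin: "linear_map K (A \<boxtimes> A \<boxtimes> C) (A \<boxtimes> C) m12"
    unfolding m12_def by (intro comp[OF assoc_l_linear tensor_map_linear] m product_map_linear linear_map_id)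
  have m23_lin: "linear_map K (C \<boxtimes> A \<boxtimes> A) (C \<boxtimes> A) m23"
    unfolding m23_def by (intro tensor_map_linear m product_map_linear linear_map_id)
  have r12_lin: "linear_map K (A \<boxtimes> C) (A \<boxtimes> A \<boxtimes> C) r12"
    and l12_lin: "linear_map K (A \<boxtimes> C) (A \<boxtimes> A \<boxtimes> C) l12"
    and r23_lin: "linear_map K (C \<boxtimes> A) (C \<boxtimes> A \<boxtimes> A) r23"
    and l23_lin: "linear_map K (C \<boxtimes> A) (C \<boxtimes> A \<boxtimes> A) l23"
    unfolding defs by (intro tensor_map_linear tensor_linear m linear_map_id one)+
  have p12_lin: "linear_map K (C \<boxtimes> A \<boxtimes> A) (A \<boxtimes> C \<boxtimes> A) ?p12"
    and p23_lin: "linear_map K (A \<boxtimes> C \<boxtimes> A) (A \<boxtimes> A \<boxtimes> C) ?p23"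
    by (intro map12_linear map23_linear m entwining_linear)+
  have L23: "map23 K C A A A A (alg_op_P K A q) Y =
      inv q \<odot>\<^bsub>C \<boxtimes> A \<boxtimes> A\<^esub> r23 (m23 Y) \<oplus>\<^bsub>C \<boxtimes> A \<boxtimes> A\<^esub> q \<odot>\<^bsub>C \<boxtimes> A \<boxtimes> A\<^esub> l23 (m23 Y)"
    if Y: "Y \<in> carrier (C \<boxtimes> A \<boxtimes> A)" for Y
  proof -
    interpret AA: module K "A \<boxtimes> A" by (rule mAA)
    show ?thesis
      by (rule linear_map_eqI_right[OF mC mA mA map23_linear[OF mC mA mA mA mA alg_op_P_linear[OF q]]
          linear_map_add[OF mCAA linear_map_smult[OF mCAA comp[OF m23_lin r23_lin] inverse_scalar(1)]
            linear_map_smult[OF mCAA comp[OF m23_lin l23_lin] q(1)]] _ Y])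
      (simp add: map23_tensor m alg_op_P_linear[OF q] alg_op_P_def[of K A q "tensor K A A _ _"]
        defs tensor_map_tensor product_map_linear product_map_tensor linear_map_id tensor_linear
        tensor_closed tensor_simps q inverse_scalar)
  qed
  have L12: "map12 K A A C A A (alg_op_P K A q) Y =
      inv q \<odot>\<^bsub>A \<boxtimes> A \<boxtimes> C\<^esub> r12 (m12 Y) \<oplus>\<^bsub>A \<boxtimes> A \<boxtimes> C\<^esub> q \<odot>\<^bsub>A \<boxtimes> A \<boxtimes> C\<^esub> l12 (m12 Y)"
    if Y: "Y \<in> carrier (A \<boxtimes> A \<boxtimes> C)" for Y
  proof -
    interpret AA: module K "A \<boxtimes> A" by (rule mAA)
    note g = linear_mapD[OF assoc_r_tensor_linear[OF mA mA mC]]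
    show ?thesis
      by (rule linear_map_eqI_right[OF mA mA mC map12_linear[OF mA mA mC mA mA alg_op_P_linear[OF q]]
          linear_map_add[OF mAAC linear_map_smult[OF mAAC comp[OF m12_lin r12_lin] inverse_scalar(1)]
            linear_map_smult[OF mAAC comp[OF m12_lin l12_lin] q(1)]] _ Y])
      (simp add: map12_tensor m alg_op_P_linear[OF q] alg_op_P_def[of K A q "tensor K A A _ _"]
        defs tensor_map_tensor product_map_linear product_map_tensor linear_map_id tensor_linear
        tensor_closed assoc_l_tensor assoc_r_tensor g q inverse_scalar)
  qed
  have r: "?p23 (?p12 (r23 Y)) = r12 (\<psi> Y)" if Y: "Y \<in> carrier (C \<boxtimes> A)" for Y
  proof (rule linear_map_eqI[OF mC mA comp[OF comp[OF r23_lin p12_lin] p23_lin]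
        comp[OF entwining_linear r12_lin] _ Y])
    fix c a assume ca: "c \<in> carrier C" "a \<in> carrier A"
    have "?p23 (assoc_r K A C A (tensor K (A \<boxtimes> C) A u \<one>\<^bsub>A\<^esub>)) = r12 u"
      if u: "u \<in> carrier (A \<boxtimes> C)" for u
      by (rule linear_map_eqI[OF mA mC comp[OF assoc_r_tensor_linear[OF mA mC mA one] p23_lin]
            r12_lin _ u])
        (simp add: assoc_r_tensor m one map23_tensor entwining_linear tensor_closed entwining_unit
          r12_def tensor_map_tensor linear_map_id tensor_linear)
    then show "?p23 (?p12 (r23 (tensor K C A c a))) = r12 (\<psi> (tensor K C A c a))"
      using ca linear_mapD(1)[OF entwining_linear]
      by (simp add: r23_def tensor_map_tensor m one linear_map_id tensor_linear map12_tensor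
          entwining_linear tensor_closed)
  qed
  have l: "?p23 (?p12 (l23 Y)) = l12 (\<psi> Y)" if Y: "Y \<in> carrier (C \<boxtimes> A)" for Y
    by (rule linear_map_eqI[OF mC mA comp[OF comp[OF l23_lin p12_lin] p23_lin]
        comp[OF entwining_linear l12_lin] _ Y])
      (simp add: l23_def l12_def tensor_map_tensor m one linear_map_id tensor_linear map12_tensor
          entwining_linear tensor_closed entwining_unit assoc_r_tensor map23_tensor)
  have psi_m: "\<psi> (m23 X) = m12 (?p23 (?p12 X))"
    using entwining_product[OF assms] by (simp add: m12_def m23_def map12_def map23_def)
  show ?thesis
    using assms q inverse_scalar linear_mapD(1)[OF p12_lin] linear_mapD(1)[OF p23_lin]
      linear_mapD(1)[OF m23_lin] linear_mapD(1)[OF l23_lin] linear_mapD(1)[OF r23_lin]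
    by (simp add: L12 L23 linear_mapD[OF p12_lin] linear_mapD[OF p23_lin] r l psi_m
        module.smult_closed[OF mCAA] module.smult_closed[OF tensor_space_module[OF mA mCA]])
qed

text \<open>Dually, \<open>P'\<close> applies a counit to one factor and then the coproduct to the other. The counit axiom
  moves \<open>\<psi>\<close> past the two counits, the coproduct axiom moves it past the coproduct.\<close>

lemma entwining_coalg_op_P:
  assumes "X \<in> carrier (C \<boxtimes> C \<boxtimes> A)"
  shows "map23 K A C C C C (coalg_op_P K C \<Delta> \<epsilon> q) (map12 K C A C A C \<psi> (map23 K C C A A C \<psi> X)) =
    map12 K C A C A C \<psi> (map23 K C C A A C \<psi> (map12 K C C A C C (coalg_op_P K C \<Delta> \<epsilon> q) X))"
proof -
  note mA = algebra_module and mC = coalgebra_module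
  note m = mA mC tensor_space_module
  have mCC: "module K (C \<boxtimes> C)" and mAC: "module K (A \<boxtimes> C)" and mCA: "module K (C \<boxtimes> A)"
    and mCCA: "module K (C \<boxtimes> C \<boxtimes> A)" and mACC: "module K (A \<boxtimes> C \<boxtimes> C)"
    and mCAC: "module K (C \<boxtimes> A \<boxtimes> C)"
    by (intro m)+
  note comp = linear_map_comp(2)
  let ?p12 = "map12 K C A C A C \<psi>" and ?p23 = "map23 K C C A A C \<psi>"
  define D12 where "D12 = (\<lambda>X. assoc_r K C C A (tensor_map K C A (C \<boxtimes> C) A \<Delta> (\<lambda>x. x) X))"
  define D23 where "D23 = tensor_map K A C A (C \<boxtimes> C) (\<lambda>x. x) \<Delta>"
  define F1 where "F1 = counit_l K C \<epsilon> (C \<boxtimes> A)"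
  define F2 where "F2 = tensor_map K C (C \<boxtimes> A) C A (\<lambda>x. x) (counit_l K C \<epsilon> A)"
  define E2 where "E2 = tensor_map K A (C \<boxtimes> C) A C (\<lambda>x. x) (counit_l K C \<epsilon> C)"
  define E3 where "E3 = tensor_map K A (C \<boxtimes> C) A C (\<lambda>x. x) (counit_r K C \<epsilon> C)"
  define e where "e = counit_r K C \<epsilon> A"
  note defs = D12_def D23_def F1_def F2_def E2_def E3_def
  have D12_lin: "linear_map K (C \<boxtimes> A) (C \<boxtimes> C \<boxtimes> A) D12"
    unfolding D12_def
    by (intro comp[OF tensor_map_linear assoc_r_linear] m coproduct_linear linear_map_id)
  have D23_lin: "linear_map K (A \<boxtimes> C) (A \<boxtimes> C \<boxtimes> C) D23"
    and F1_lin: "linear_map K (C \<boxtimes> C \<boxtimes> A) (C \<boxtimes> A) F1"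
    and F2_lin: "linear_map K (C \<boxtimes> C \<boxtimes> A) (C \<boxtimes> A) F2"
    and E2_lin: "linear_map K (A \<boxtimes> C \<boxtimes> C) (A \<boxtimes> C) E2"
    and E3_lin: "linear_map K (A \<boxtimes> C \<boxtimes> C) (A \<boxtimes> C) E3"
    and e_lin: "linear_map K (A \<boxtimes> C) A e"
    unfolding defs e_def
    by (intro tensor_map_linear counit_l_linear counit_r_linear m coproduct_linear linear_map_id)+
  have p12_lin: "linear_map K (C \<boxtimes> A \<boxtimes> C) (A \<boxtimes> C \<boxtimes> C) ?p12"
    and p23_lin: "linear_map K (C \<boxtimes> C \<boxtimes> A) (C \<boxtimes> A \<boxtimes> C) ?p23"
    by (intro map12_linear map23_linear m entwining_linear)+
  note psi = linear_mapD[OF entwining_linear]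
  note D = linear_mapD[OF coproduct_linear]
  note counit = counit_l_linear counit_r_linear counit_l_tensor counit_r_tensor counit_closed
  have L23: "map23 K A C C C C (coalg_op_P K C \<Delta> \<epsilon> q) Y =
      q \<odot>\<^bsub>A \<boxtimes> C \<boxtimes> C\<^esub> D23 (E3 Y) \<oplus>\<^bsub>A \<boxtimes> C \<boxtimes> C\<^esub> inv q \<odot>\<^bsub>A \<boxtimes> C \<boxtimes> C\<^esub> D23 (E2 Y)"
    if Y: "Y \<in> carrier (A \<boxtimes> C \<boxtimes> C)" for Y
  proof -
    interpret CC: module K "C \<boxtimes> C" by (rule mCC)
    have D23t: "D23 (tensor K A C a c) = tensor K A (C \<boxtimes> C) a (\<Delta> c)"
      if "a \<in> carrier A" "c \<in> carrier C" for a c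
      using that by (simp add: D23_def tensor_map_tensor m coproduct_linear linear_map_id)
    show ?thesis
      by (rule linear_map_eqI_right[OF mA mC mC map23_linear[OF mA mC mC mC mC coalg_op_P_linear[OF q]]
          linear_map_add[OF mACC linear_map_smult[OF mACC comp[OF E3_lin D23_lin] q(1)]
            linear_map_smult[OF mACC comp[OF E2_lin D23_lin] inverse_scalar(1)]] _ Y])
      (simp add: map23_tensor m coalg_op_P_linear[OF q]
        coalg_op_P_def[of K C \<Delta> \<epsilon> q "tensor K C C _ _"] E2_def E3_def D23t linear_mapD[OF D23_lin]
        tensor_map_tensor counit
        linear_map_id coproduct_linear D module.smult_closed[OF mC] tensor_closed tensor_simps q inverse_scalar)
  qed
  have L12: "map12 K C C A C C (coalg_op_P K C \<Delta> \<epsilon> q) Y =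
      q \<odot>\<^bsub>C \<boxtimes> C \<boxtimes> A\<^esub> D12 (F2 Y) \<oplus>\<^bsub>C \<boxtimes> C \<boxtimes> A\<^esub> inv q \<odot>\<^bsub>C \<boxtimes> C \<boxtimes> A\<^esub> D12 (F1 Y)"
    if Y: "Y \<in> carrier (C \<boxtimes> C \<boxtimes> A)" for Y
  proof -
    interpret CC: module K "C \<boxtimes> C" by (rule mCC)
    note g = linear_mapD[OF assoc_r_tensor_linear[OF mC mC mA]]
    have D12t: "D12 (tensor K C A c a) = assoc_r K C C A (tensor K (C \<boxtimes> C) A (\<Delta> c) a)"
      if "c \<in> carrier C" "a \<in> carrier A" for c a
      using that by (simp add: D12_def tensor_map_tensor m coproduct_linear linear_map_id)
    show ?thesis
      by (rule linear_map_eqI_right[OF mC mC mA map12_linear[OF mC mC mA mC mC coalg_op_P_linear[OF q]]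
          linear_map_add[OF mCCA linear_map_smult[OF mCCA comp[OF F2_lin D12_lin] q(1)]
            linear_map_smult[OF mCCA comp[OF F1_lin D12_lin] inverse_scalar(1)]] _ Y])
      (simp add: map12_tensor m coalg_op_P_linear[OF q]
        coalg_op_P_def[of K C \<Delta> \<epsilon> q "tensor K C C _ _"] F1_def F2_def D12t linear_mapD[OF D12_lin]
        tensor_map_tensor counit
        linear_map_id coproduct_linear D module.smult_closed[OF mC] tensor_closed tensor_simps(4)[OF mC mA] g q inverse_scalar)
  qed
  have aE2: "E2 (assoc_r K A C C (tensor K (A \<boxtimes> C) C w d)) = tensor K A C (e w) d"
    and aE3: "E3 (assoc_r K A C C (tensor K (A \<boxtimes> C) C w d)) = \<epsilon> d \<odot>\<^bsub>A \<boxtimes> C\<^esub> w"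
    if w: "w \<in> carrier (A \<boxtimes> C)" and d: "d \<in> carrier C" for w d
  proof -
    note t = comp[OF assoc_r_tensor_linear[OF mA mC mC d]]
    show "E2 (assoc_r K A C C (tensor K (A \<boxtimes> C) C w d)) = tensor K A C (e w) d"
      by (rule linear_map_eqI[OF mA mC t[OF E2_lin] comp[OF e_lin tensor_linear(2)[OF mA mC d]] _ w])
        (simp add: assoc_r_tensor m d E2_def e_def tensor_map_tensor linear_map_id counit
          tensor_closed tensor_simps)
    show "E3 (assoc_r K A C C (tensor K (A \<boxtimes> C) C w d)) = \<epsilon> d \<odot>\<^bsub>A \<boxtimes> C\<^esub> w"
      by (rule linear_map_eqI[OF mA mC t[OF E3_lin]
            linear_map_smult[OF mAC linear_map_id counit_closed[OF d]] _ w])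
        (simp add: assoc_r_tensor m d E3_def tensor_map_tensor linear_map_id counit
          tensor_closed tensor_simps)
  qed
  have e_psi: "e (\<psi> (tensor K C A c a)) = \<epsilon> c \<odot>\<^bsub>A\<^esub> a" if "c \<in> carrier C" "a \<in> carrier A" for c a
    using entwining_counit[OF that] by (simp add: e_def counit_r_def)
  have u: "E2 (?p12 (tensor K C (A \<boxtimes> C) c u)) = \<epsilon> c \<odot>\<^bsub>A \<boxtimes> C\<^esub> u"
    "E3 (?p12 (tensor K C (A \<boxtimes> C) c u)) = \<psi> (tensor K C A c (e u))"
    if c: "c \<in> carrier C" and u: "u \<in> carrier (A \<boxtimes> C)" for c u
  proof -
    note t = comp[OF comp[OF tensor_linear(1)[OF mC mAC c] p12_lin]]
    show "E2 (?p12 (tensor K C (A \<boxtimes> C) c u)) = \<epsilon> c \<odot>\<^bsub>A \<boxtimes> C\<^esub> u"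
      by (rule linear_map_eqI[OF mA mC t[OF E2_lin]
            linear_map_smult[OF mAC linear_map_id counit_closed[OF c]] _ u])
        (simp add: c map12_tensor m entwining_linear aE2 psi tensor_closed e_psi tensor_simps
          counit_closed)
    show "E3 (?p12 (tensor K C (A \<boxtimes> C) c u)) = \<psi> (tensor K C A c (e u))"
      by (rule linear_map_eqI[OF mA mC t[OF E3_lin]
            comp[OF comp[OF e_lin tensor_linear(1)[OF mC mA c]] entwining_linear] _ u])
        (simp add: c map12_tensor m entwining_linear aE3 psi tensor_closed e_def counit tensor_simps)
  qed
  have EF: "E2 (?p12 (?p23 Y)) = \<psi> (F1 Y)" "E3 (?p12 (?p23 Y)) = \<psi> (F2 Y)"
    if Y: "Y \<in> carrier (C \<boxtimes> C \<boxtimes> A)" for Y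
  proof -
    note t = comp[OF comp[OF p23_lin p12_lin]]
    show "E2 (?p12 (?p23 Y)) = \<psi> (F1 Y)"
      by (rule linear_map_eqI_right[OF mC mC mA t[OF E2_lin] comp[OF F1_lin entwining_linear] _ Y])
        (simp add: map23_tensor m entwining_linear u psi tensor_closed F1_def counit)
    show "E3 (?p12 (?p23 Y)) = \<psi> (F2 Y)"
      by (rule linear_map_eqI_right[OF mC mC mA t[OF E3_lin] comp[OF F2_lin entwining_linear] _ Y])
        (simp add: map23_tensor m entwining_linear u psi tensor_closed F2_def counit
          tensor_map_tensor linear_map_id e_psi)
  qed
  have psi_D: "D23 (\<psi> Y) = ?p12 (?p23 (D12 Y))" if "Y \<in> carrier (C \<boxtimes> A)" for Y
    using entwining_coproduct[OF that] by (simp add: D12_def D23_def map12_def map23_def)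
  show ?thesis
    using assms q inverse_scalar
    by (simp add: L12 L23 linear_mapD[OF p12_lin] linear_mapD[OF p23_lin] linear_mapD(1)[OF D12_lin]
        linear_mapD(1)[OF F1_lin] linear_mapD(1)[OF F2_lin] EF psi_D
        module.smult_closed[OF mCCA] module.smult_closed[OF mCAC])
qed

lemma entwining_alg_op_R:
  assumes "X \<in> carrier (C \<boxtimes> A \<boxtimes> A)"
  shows "map12 K A A C A A (alg_op_R K A q) (map23 K A C A A C \<psi> (map12 K C A A A C \<psi> X)) =
    map23 K A C A A C \<psi> (map12 K C A A A C \<psi> (map23 K C A A A A (alg_op_R K A q) X))"
proof -
  note mA = algebra_module and mC = coalgebra_module
  note m = mA mC tensor_space_module
  interpret M: module K "A \<boxtimes> A \<boxtimes> C" by (intro m)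
  interpret N: module K "C \<boxtimes> A \<boxtimes> A" by (intro m)
  note p12 = linear_mapD[OF map12_linear[OF mC mA mA mA mC entwining_linear]]
    and p23 = linear_mapD[OF map23_linear[OF mA mC mA mA mC entwining_linear]]
  note R12 = linear_mapD(1)[OF map12_linear[OF mA mA mC mA mA alg_op_R_linear[OF q]]]
    and R23 = linear_mapD(1)[OF map23_linear[OF mC mA mA mA mA alg_op_R_linear[OF q]]]
  interpret N': module K "A \<boxtimes> C \<boxtimes> A" by (intro m)
  note s12 = map12_shift[OF mA mA mC alg_op_R_linear[OF q] alg_op_P_linear[OF q] inverse_scalar(1)
      alg_op_P_R[OF q]]
    and s23 = map23_shift[OF mC mA mA alg_op_R_linear[OF q] alg_op_P_linear[OF q] inverse_scalar(1)
      alg_op_P_R[OF q]]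
  show ?thesis
    using entwining_alg_op_P[OF assms] assms inverse_scalar(1)
    by (simp add: s12 s23 p12 p23 R12 R23)
qed

lemma entwining_coalg_op_R':
  assumes "X \<in> carrier (C \<boxtimes> C \<boxtimes> A)"
  shows "map23 K A C C C C (coalg_op_R' K C \<Delta> \<epsilon> q) (map12 K C A C A C \<psi> (map23 K C C A A C \<psi> X)) =
    map12 K C A C A C \<psi> (map23 K C C A A C \<psi> (map12 K C C A C C (coalg_op_R' K C \<Delta> \<epsilon> q) X))"
proof -
  note mA = algebra_module and mC = coalgebra_module
  note m = mA mC tensor_space_module
  interpret M: module K "A \<boxtimes> C \<boxtimes> C" by (intro m)
  interpret N: module K "C \<boxtimes> C \<boxtimes> A" by (intro m)
  interpret N': module K "C \<boxtimes> A \<boxtimes> C" by (intro m)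
  note p12 = linear_mapD[OF map12_linear[OF mC mA mC mA mC entwining_linear]]
    and p23 = linear_mapD[OF map23_linear[OF mC mC mA mA mC entwining_linear]]
  note R12 = linear_mapD(1)[OF map12_linear[OF mC mC mA mC mC coalg_op_R'_linear[OF q]]]
    and R23 = linear_mapD(1)[OF map23_linear[OF mA mC mC mC mC coalg_op_R'_linear[OF q]]]
  note s12 = map12_shift[OF mC mC mA coalg_op_R'_linear[OF q] coalg_op_P_linear[OF q] inverse_scalar(1)
      coalg_op_P_R'[OF q]]
    and s23 = map23_shift[OF mA mC mC coalg_op_R'_linear[OF q] coalg_op_P_linear[OF q] inverse_scalar(1)
      coalg_op_P_R'[OF q]]
  show ?thesis
    using entwining_coalg_op_P[OF assms] assms inverse_scalar(1)
    by (simp add: s12 s23 p12 p23 R12 R23)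
qed

end

end

section \<open>Amplifications restricted to summands\<close>

text \<open>The tensor product of three maps \<open>i\<close>, \<open>j\<close>, \<open>k\<close> into the same space \<open>V\<close>.\<close>

definition tensor_map3 ::
  "('k, 'm) ring_scheme \<Rightarrow> ('k, 'x) module \<Rightarrow> ('k, 'y) module \<Rightarrow> ('k, 'z) module \<Rightarrow>
   ('k, 'v) module \<Rightarrow> ('x \<Rightarrow> 'v) \<Rightarrow> ('y \<Rightarrow> 'v) \<Rightarrow> ('z \<Rightarrow> 'v) \<Rightarrow>
   ('x \<times> ('y \<times> 'z \<Rightarrow> 'k) set \<Rightarrow> 'k) set \<Rightarrow> ('v \<times> ('v \<times> 'v \<Rightarrow> 'k) set \<Rightarrow> 'k) set"
  where "tensor_map3 K X Y Z V i j k =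
    tensor_map K X (Y \<boxtimes>\<^bsub>K\<^esub> Z) V (V \<boxtimes>\<^bsub>K\<^esub> V) i (tensor_map K Y Z V V j k)"

lemma tensor_map3_linear:
  assumes "module K X" "module K Y" "module K Z" "module K V"
    and "linear_map K X V i" "linear_map K Y V j" "linear_map K Z V k"
  shows "linear_map K (X \<boxtimes>\<^bsub>K\<^esub> Y \<boxtimes>\<^bsub>K\<^esub> Z) (V \<boxtimes>\<^bsub>K\<^esub> V \<boxtimes>\<^bsub>K\<^esub> V) (tensor_map3 K X Y Z V i j k)"
  unfolding tensor_map3_def by (intro tensor_map_linear tensor_space_module assms)

lemma tensor_map3_tensor:
  assumes "module K X" "module K Y" "module K Z" "module K V"
    and "linear_map K X V i" "linear_map K Y V j" "linear_map K Z V k"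
    and "x \<in> carrier X" "y \<in> carrier Y" "z \<in> carrier Z"
  shows "tensor_map3 K X Y Z V i j k (tensor K X (Y \<boxtimes>\<^bsub>K\<^esub> Z) x (tensor K Y Z y z)) =
    tensor K V (V \<boxtimes>\<^bsub>K\<^esub> V) (i x) (tensor K V V (j y) (k z))"
  using assms by (simp add: tensor_map3_def tensor_map_tensor tensor_space_module tensor_map_linear
      tensor_closed)

lemma op12_eq_map12: "op12 K V T = map12 K V V V V V T"
  by (simp add: op12_def map12_def)

lemma op23_eq_map23: "op23 K V T = map23 K V V V V V T"
  by (simp add: op23_def map23_def)

text \<open>If \<open>T\<close> acts on the image of \<open>X \<otimes> Y\<close> as a map \<open>f\<close> into the image of \<open>X' \<otimes> Y'\<close> plus a scalar \<open>r\<close>,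
  then its amplification acts on the image of \<open>X \<otimes> Y \<otimes> Z\<close> in the same way. The summand \<open>C \<otimes> A\<close> needs
  \<open>r = q - p\<close> with \<open>p\<close> the inverse of \<open>q\<close>; the variants below are the case \<open>r = 0\<close>.\<close>

lemma op12_tensor_map3:
  assumes m: "module K X" "module K Y" "module K Z" "module K X'" "module K Y'" "module K V"
    and lin: "linear_map K X V i" "linear_map K Y V j" "linear_map K Z V k"
      "linear_map K X' V i'" "linear_map K Y' V j'"
    and f: "linear_map K (X \<boxtimes>\<^bsub>K\<^esub> Y) (X' \<boxtimes>\<^bsub>K\<^esub> Y') f"
    and T: "linear_map K (V \<boxtimes>\<^bsub>K\<^esub> V) (V \<boxtimes>\<^bsub>K\<^esub> V) T" and r: "r \<in> carrier K"
    and Tf: "\<And>s. s \<in> carrier (X \<boxtimes>\<^bsub>K\<^esub> Y) \<Longrightarrow> T (tensor_map K X Y V V i j s) =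
      tensor_map K X' Y' V V i' j' (f s) \<oplus>\<^bsub>V \<boxtimes>\<^bsub>K\<^esub> V\<^esub> r \<odot>\<^bsub>V \<boxtimes>\<^bsub>K\<^esub> V\<^esub> tensor_map K X Y V V i j s"
    and t: "t \<in> carrier (X \<boxtimes>\<^bsub>K\<^esub> Y \<boxtimes>\<^bsub>K\<^esub> Z)"
  shows "op12 K V T (tensor_map3 K X Y Z V i j k t) =
    tensor_map3 K X' Y' Z V i' j' k (map12 K X Y Z X' Y' f t)
    \<oplus>\<^bsub>V \<boxtimes>\<^bsub>K\<^esub> V \<boxtimes>\<^bsub>K\<^esub> V\<^esub> r \<odot>\<^bsub>V \<boxtimes>\<^bsub>K\<^esub> V \<boxtimes>\<^bsub>K\<^esub> V\<^esub> tensor_map3 K X Y Z V i j k t"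
  unfolding op12_eq_map12
proof (rule linear_map_eqI_right[OF m(1-3) _ _ _ t])
  have mV: "module K (V \<boxtimes>\<^bsub>K\<^esub> V)" "module K (V \<boxtimes>\<^bsub>K\<^esub> V \<boxtimes>\<^bsub>K\<^esub> V)"
    by (intro tensor_space_module m)+
  interpret VV: module K "V \<boxtimes>\<^bsub>K\<^esub> V" by (rule mV)
  note J = tensor_map3_linear[OF m(1-3,6) lin(1-3)]
  note T12 = map12_linear[OF m(6,6,6,6,6) T]
  show "linear_map K (X \<boxtimes>\<^bsub>K\<^esub> Y \<boxtimes>\<^bsub>K\<^esub> Z) (V \<boxtimes>\<^bsub>K\<^esub> V \<boxtimes>\<^bsub>K\<^esub> V)
      (\<lambda>t. map12 K V V V V V T (tensor_map3 K X Y Z V i j k t))"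
    by (rule linear_map_comp(2)[OF J T12])
  show "linear_map K (X \<boxtimes>\<^bsub>K\<^esub> Y \<boxtimes>\<^bsub>K\<^esub> Z) (V \<boxtimes>\<^bsub>K\<^esub> V \<boxtimes>\<^bsub>K\<^esub> V)
      (\<lambda>t. tensor_map3 K X' Y' Z V i' j' k (map12 K X Y Z X' Y' f t)
        \<oplus>\<^bsub>V \<boxtimes>\<^bsub>K\<^esub> V \<boxtimes>\<^bsub>K\<^esub> V\<^esub> r \<odot>\<^bsub>V \<boxtimes>\<^bsub>K\<^esub> V \<boxtimes>\<^bsub>K\<^esub> V\<^esub> tensor_map3 K X Y Z V i j k t)"
    by (rule linear_map_add[OF mV(2) linear_map_comp(2)[OF map12_linear[OF m(1-5) f]
          tensor_map3_linear[OF m(4,5,3,6) lin(4,5,3)]] linear_map_smult[OF mV(2) J r]])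
  fix x y z assume xyz: "x \<in> carrier X" "y \<in> carrier Y" "z \<in> carrier Z"
  note g = linear_mapD[OF assoc_r_tensor_linear[OF m(6,6,6)]]
  have c: "i x \<in> carrier V" "j y \<in> carrier V" "k z \<in> carrier V"
    using xyz linear_mapD(1)[OF lin(1)] linear_mapD(1)[OF lin(2)] linear_mapD(1)[OF lin(3)] by auto
  have fc: "f (tensor K X Y x y) \<in> carrier (X' \<boxtimes>\<^bsub>K\<^esub> Y')"
    by (rule linear_mapD(1)[OF f tensor_closed[OF m(1,2) xyz(1,2)]])
  have "tensor_map K X' Y' V V i' j' (f (tensor K X Y x y)) \<in> carrier (V \<boxtimes>\<^bsub>K\<^esub> V)"
    by (rule linear_mapD(1)[OF tensor_map_linear[OF m(4,5,6,6) lin(4,5)] fc])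
  moreover have "T (tensor K V V (i x) (j y)) = tensor_map K X' Y' V V i' j' (f (tensor K X Y x y))
      \<oplus>\<^bsub>V \<boxtimes>\<^bsub>K\<^esub> V\<^esub> r \<odot>\<^bsub>V \<boxtimes>\<^bsub>K\<^esub> V\<^esub> tensor K V V (i x) (j y)"
    using Tf[OF tensor_closed[OF m(1,2) xyz(1,2)]] xyz by (simp add: tensor_map_tensor m lin)
  moreover have "tensor_map3 K X' Y' Z V i' j' k
        (assoc_r K X' Y' Z (tensor K (X' \<boxtimes>\<^bsub>K\<^esub> Y') Z (f (tensor K X Y x y)) z)) =
      assoc_r K V V V (tensor K (V \<boxtimes>\<^bsub>K\<^esub> V) V
        (tensor_map K X' Y' V V i' j' (f (tensor K X Y x y))) (k z))"
    unfolding tensor_map3_def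
    by (rule tensor_map_assoc_r[OF m(4,5,3,6,6,6) lin(4,5,3) fc xyz(3)])
  ultimately show "map12 K V V V V V T
        (tensor_map3 K X Y Z V i j k (tensor K X (Y \<boxtimes>\<^bsub>K\<^esub> Z) x (tensor K Y Z y z))) =
      tensor_map3 K X' Y' Z V i' j' k
        (map12 K X Y Z X' Y' f (tensor K X (Y \<boxtimes>\<^bsub>K\<^esub> Z) x (tensor K Y Z y z)))
      \<oplus>\<^bsub>V \<boxtimes>\<^bsub>K\<^esub> V \<boxtimes>\<^bsub>K\<^esub> V\<^esub> r \<odot>\<^bsub>V \<boxtimes>\<^bsub>K\<^esub> V \<boxtimes>\<^bsub>K\<^esub> V\<^esub>
        tensor_map3 K X Y Z V i j k (tensor K X (Y \<boxtimes>\<^bsub>K\<^esub> Z) x (tensor K Y Z y z))"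
    using xyz c r
    by (simp add: tensor_map3_tensor map12_tensor m lin f T g tensor_closed assoc_r_tensor)
qed

lemma op23_tensor_map3:
  assumes m: "module K X" "module K Y" "module K Z" "module K Y'" "module K Z'" "module K V"
    and lin: "linear_map K X V i" "linear_map K Y V j" "linear_map K Z V k"
      "linear_map K Y' V j'" "linear_map K Z' V k'"
    and f: "linear_map K (Y \<boxtimes>\<^bsub>K\<^esub> Z) (Y' \<boxtimes>\<^bsub>K\<^esub> Z') f"
    and T: "linear_map K (V \<boxtimes>\<^bsub>K\<^esub> V) (V \<boxtimes>\<^bsub>K\<^esub> V) T" and r: "r \<in> carrier K"
    and Tf: "\<And>s. s \<in> carrier (Y \<boxtimes>\<^bsub>K\<^esub> Z) \<Longrightarrow> T (tensor_map K Y Z V V j k s) =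
      tensor_map K Y' Z' V V j' k' (f s) \<oplus>\<^bsub>V \<boxtimes>\<^bsub>K\<^esub> V\<^esub> r \<odot>\<^bsub>V \<boxtimes>\<^bsub>K\<^esub> V\<^esub> tensor_map K Y Z V V j k s"
    and t: "t \<in> carrier (X \<boxtimes>\<^bsub>K\<^esub> Y \<boxtimes>\<^bsub>K\<^esub> Z)"
  shows "op23 K V T (tensor_map3 K X Y Z V i j k t) =
    tensor_map3 K X Y' Z' V i j' k' (map23 K X Y Z Y' Z' f t)
    \<oplus>\<^bsub>V \<boxtimes>\<^bsub>K\<^esub> V \<boxtimes>\<^bsub>K\<^esub> V\<^esub> r \<odot>\<^bsub>V \<boxtimes>\<^bsub>K\<^esub> V \<boxtimes>\<^bsub>K\<^esub> V\<^esub> tensor_map3 K X Y Z V i j k t"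
  unfolding op23_eq_map23
proof (rule linear_map_eqI[OF m(1) tensor_space_module[OF m(2,3)] _ _ _ t])
  have mV: "module K (V \<boxtimes>\<^bsub>K\<^esub> V)" "module K (V \<boxtimes>\<^bsub>K\<^esub> V \<boxtimes>\<^bsub>K\<^esub> V)"
    by (intro tensor_space_module m)+
  interpret VV: module K "V \<boxtimes>\<^bsub>K\<^esub> V" by (rule mV)
  note J = tensor_map3_linear[OF m(1-3,6) lin(1-3)]
  note T23 = map23_linear[OF m(6,6,6,6,6) T]
  show "linear_map K (X \<boxtimes>\<^bsub>K\<^esub> Y \<boxtimes>\<^bsub>K\<^esub> Z) (V \<boxtimes>\<^bsub>K\<^esub> V \<boxtimes>\<^bsub>K\<^esub> V)
      (\<lambda>t. map23 K V V V V V T (tensor_map3 K X Y Z V i j k t))"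
    by (rule linear_map_comp(2)[OF J T23])
  show "linear_map K (X \<boxtimes>\<^bsub>K\<^esub> Y \<boxtimes>\<^bsub>K\<^esub> Z) (V \<boxtimes>\<^bsub>K\<^esub> V \<boxtimes>\<^bsub>K\<^esub> V)
      (\<lambda>t. tensor_map3 K X Y' Z' V i j' k' (map23 K X Y Z Y' Z' f t)
        \<oplus>\<^bsub>V \<boxtimes>\<^bsub>K\<^esub> V \<boxtimes>\<^bsub>K\<^esub> V\<^esub> r \<odot>\<^bsub>V \<boxtimes>\<^bsub>K\<^esub> V \<boxtimes>\<^bsub>K\<^esub> V\<^esub> tensor_map3 K X Y Z V i j k t)"
    by (rule linear_map_add[OF mV(2) linear_map_comp(2)[OF map23_linear[OF m(1-5) f]
          tensor_map3_linear[OF m(1,4,5,6) lin(1,4,5)]] linear_map_smult[OF mV(2) J r]])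
  fix x s assume xs: "x \<in> carrier X" "s \<in> carrier (Y \<boxtimes>\<^bsub>K\<^esub> Z)"
  note c = linear_mapD(1)[OF lin(1)] linear_mapD(1)[OF f]
    linear_mapD(1)[OF tensor_map_linear[OF m(2,3,6,6) lin(2,3)]]
    linear_mapD(1)[OF tensor_map_linear[OF m(4,5,6,6) lin(4,5)]]
  show "map23 K V V V V V T (tensor_map3 K X Y Z V i j k (tensor K X (Y \<boxtimes>\<^bsub>K\<^esub> Z) x s)) =
      tensor_map3 K X Y' Z' V i j' k' (map23 K X Y Z Y' Z' f (tensor K X (Y \<boxtimes>\<^bsub>K\<^esub> Z) x s))
      \<oplus>\<^bsub>V \<boxtimes>\<^bsub>K\<^esub> V \<boxtimes>\<^bsub>K\<^esub> V\<^esub> r \<odot>\<^bsub>V \<boxtimes>\<^bsub>K\<^esub> V \<boxtimes>\<^bsub>K\<^esub> V\<^esub>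
        tensor_map3 K X Y Z V i j k (tensor K X (Y \<boxtimes>\<^bsub>K\<^esub> Z) x s)"
    using xs r
    by (simp add: tensor_map3_def tensor_map_tensor map23_tensor m mV tensor_space_module lin f T
        tensor_map_linear c Tf tensor_simps)
qed

lemma op12_tensor_map3_pure:
  assumes m: "module K X" "module K Y" "module K Z" "module K X'" "module K Y'" "module K V"
    and lin: "linear_map K X V i" "linear_map K Y V j" "linear_map K Z V k"
      "linear_map K X' V i'" "linear_map K Y' V j'"
    and f: "linear_map K (X \<boxtimes>\<^bsub>K\<^esub> Y) (X' \<boxtimes>\<^bsub>K\<^esub> Y') f"
    and T: "linear_map K (V \<boxtimes>\<^bsub>K\<^esub> V) (V \<boxtimes>\<^bsub>K\<^esub> V) T"
    and Tf: "\<And>s. s \<in> carrier (X \<boxtimes>\<^bsub>K\<^esub> Y) \<Longrightarrow>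
      T (tensor_map K X Y V V i j s) = tensor_map K X' Y' V V i' j' (f s)"
    and t: "t \<in> carrier (X \<boxtimes>\<^bsub>K\<^esub> Y \<boxtimes>\<^bsub>K\<^esub> Z)"
  shows "op12 K V T (tensor_map3 K X Y Z V i j k t) =
    tensor_map3 K X' Y' Z V i' j' k (map12 K X Y Z X' Y' f t)"
proof -
  interpret VV: module K "V \<boxtimes>\<^bsub>K\<^esub> V" by (intro tensor_space_module m)
  interpret M: module K "V \<boxtimes>\<^bsub>K\<^esub> V \<boxtimes>\<^bsub>K\<^esub> V" by (intro tensor_space_module m)
  note c = linear_mapD(1)[OF tensor_map_linear[OF m(1,2,6,6) lin(1,2)]]
    linear_mapD(1)[OF tensor_map_linear[OF m(4,5,6,6) lin(4,5)]] linear_mapD(1)[OF f]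
    linear_mapD(1)[OF tensor_map3_linear[OF m(1-3,6) lin(1-3)]]
    linear_mapD(1)[OF tensor_map3_linear[OF m(4,5,3,6) lin(4,5,3)]]
    linear_mapD(1)[OF map12_linear[OF m(1-5) f]]
  show ?thesis
    using op12_tensor_map3[OF m lin f T VV.R.zero_closed _ t] t by (simp add: Tf c)
qed

lemma op23_tensor_map3_pure:
  assumes m: "module K X" "module K Y" "module K Z" "module K Y'" "module K Z'" "module K V"
    and lin: "linear_map K X V i" "linear_map K Y V j" "linear_map K Z V k"
      "linear_map K Y' V j'" "linear_map K Z' V k'"
    and f: "linear_map K (Y \<boxtimes>\<^bsub>K\<^esub> Z) (Y' \<boxtimes>\<^bsub>K\<^esub> Z') f"
    and T: "linear_map K (V \<boxtimes>\<^bsub>K\<^esub> V) (V \<boxtimes>\<^bsub>K\<^esub> V) T"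
    and Tf: "\<And>s. s \<in> carrier (Y \<boxtimes>\<^bsub>K\<^esub> Z) \<Longrightarrow>
      T (tensor_map K Y Z V V j k s) = tensor_map K Y' Z' V V j' k' (f s)"
    and t: "t \<in> carrier (X \<boxtimes>\<^bsub>K\<^esub> Y \<boxtimes>\<^bsub>K\<^esub> Z)"
  shows "op23 K V T (tensor_map3 K X Y Z V i j k t) =
    tensor_map3 K X Y' Z' V i j' k' (map23 K X Y Z Y' Z' f t)"
proof -
  interpret VV: module K "V \<boxtimes>\<^bsub>K\<^esub> V" by (intro tensor_space_module m)
  interpret M: module K "V \<boxtimes>\<^bsub>K\<^esub> V \<boxtimes>\<^bsub>K\<^esub> V" by (intro tensor_space_module m)
  note c = linear_mapD(1)[OF tensor_map_linear[OF m(2,3,6,6) lin(2,3)]]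
    linear_mapD(1)[OF tensor_map_linear[OF m(4,5,6,6) lin(4,5)]] linear_mapD(1)[OF f]
    linear_mapD(1)[OF tensor_map3_linear[OF m(1-3,6) lin(1-3)]]
    linear_mapD(1)[OF tensor_map3_linear[OF m(1,4,5,6) lin(1,4,5)]]
    linear_mapD(1)[OF map23_linear[OF m(1-5) f]]
  show ?thesis
    using op23_tensor_map3[OF m lin f T VV.R.zero_closed _ t] t by (simp add: Tf c)
qed

text \<open>A linear map on a tensor power of \<open>V\<close> is determined by its values on pure tensors of elements of
  a set \<open>G\<close> such that every element of \<open>V\<close> is a sum of two elements of \<open>G\<close>. Below, \<open>G\<close> is the union
  of the two summands of \<open>A \<oplus> C\<close>.\<close>

lemma linear_map_eqI_generators2:
  assumes m: "module K V" and G: "G \<subseteq> carrier V"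
    and dec: "\<And>v. v \<in> carrier V \<Longrightarrow> \<exists>x\<in>G. \<exists>y\<in>G. v = x \<oplus>\<^bsub>V\<^esub> y"
    and f: "linear_map K (V \<boxtimes>\<^bsub>K\<^esub> V) Y f" and g: "linear_map K (V \<boxtimes>\<^bsub>K\<^esub> V) Y g"
    and eq: "\<And>x y. \<lbrakk>x \<in> G; y \<in> G\<rbrakk> \<Longrightarrow> f (tensor K V V x y) = g (tensor K V V x y)"
    and X: "X \<in> carrier (V \<boxtimes>\<^bsub>K\<^esub> V)"
  shows "f X = g X"
proof (rule linear_map_eqI[OF m m f g _ X])
  note fg = linear_mapD(2)[OF f] linear_mapD(2)[OF g] tensor_simps[OF m m] tensor_closed[OF m m]
  have 1: "f (tensor K V V x w) = g (tensor K V V x w)" if x: "x \<in> G" and w: "w \<in> carrier V" for x w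
  proof -
    obtain y z where yz: "y \<in> G" "z \<in> G" "w = y \<oplus>\<^bsub>V\<^esub> z"
      using dec[OF w] by blast
    then have "x \<in> carrier V" "y \<in> carrier V" "z \<in> carrier V"
      using x G by auto
    then show ?thesis
      using x yz by (simp add: fg eq)
  qed
  fix v w assume v: "v \<in> carrier V" and w: "w \<in> carrier V"
  obtain y z where yz: "y \<in> G" "z \<in> G" "v = y \<oplus>\<^bsub>V\<^esub> z"
    using dec[OF v] by blast
  then have "y \<in> carrier V" "z \<in> carrier V"
    using G by auto
  then show "f (tensor K V V v w) = g (tensor K V V v w)"
    using w yz by (simp add: fg 1)
qed

lemma linear_map_eqI_generators3:
  assumes m: "module K V" and G: "G \<subseteq> carrier V"
    and dec: "\<And>v. v \<in> carrier V \<Longrightarrow> \<exists>x\<in>G. \<exists>y\<in>G. v = x \<oplus>\<^bsub>V\<^esub> y"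
    and f: "linear_map K (V \<boxtimes>\<^bsub>K\<^esub> V \<boxtimes>\<^bsub>K\<^esub> V) Y f" and g: "linear_map K (V \<boxtimes>\<^bsub>K\<^esub> V \<boxtimes>\<^bsub>K\<^esub> V) Y g"
    and eq: "\<And>x y z. \<lbrakk>x \<in> G; y \<in> G; z \<in> G\<rbrakk> \<Longrightarrow>
      f (tensor K V (V \<boxtimes>\<^bsub>K\<^esub> V) x (tensor K V V y z)) =
      g (tensor K V (V \<boxtimes>\<^bsub>K\<^esub> V) x (tensor K V V y z))"
    and X: "X \<in> carrier (V \<boxtimes>\<^bsub>K\<^esub> V \<boxtimes>\<^bsub>K\<^esub> V)"
  shows "f X = g X"
proof (rule linear_map_eqI[OF m tensor_space_module[OF m m] f g _ X])
  fix v S assume v: "v \<in> carrier V" and S: "S \<in> carrier (V \<boxtimes>\<^bsub>K\<^esub> V)"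
  let ?t = "tensor K V (V \<boxtimes>\<^bsub>K\<^esub> V)"
  have mVV: "module K (V \<boxtimes>\<^bsub>K\<^esub> V)"
    by (rule tensor_space_module[OF m m])
  have 1: "f (?t x S) = g (?t x S)" if x: "x \<in> G" for x
  proof -
    have t: "linear_map K (V \<boxtimes>\<^bsub>K\<^esub> V) (V \<boxtimes>\<^bsub>K\<^esub> V \<boxtimes>\<^bsub>K\<^esub> V) (?t x)"
      using x G by (intro tensor_linear m mVV) auto
    show ?thesis
      by (rule linear_map_eqI_generators2[OF m G dec linear_map_comp(2)[OF t f]
            linear_map_comp(2)[OF t g] eq[OF x] S])
  qed
  obtain y z where yz: "y \<in> G" "z \<in> G" "v = y \<oplus>\<^bsub>V\<^esub> z"
    using dec[OF v] by blast
  then have "y \<in> carrier V" "z \<in> carrier V"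
    using G by auto
  then show "f (?t v S) = g (?t v S)"
    using S yz by (simp add: linear_mapD(2)[OF f] linear_mapD(2)[OF g] tensor_simps[OF m mVV]
        tensor_closed[OF m mVV] 1)
qed

lemma tensor_map_retract:
  assumes "module K U" "module K W" "module K V" "module K V'"
    and "linear_map K U V i" "linear_map K W V' j" "linear_map K V U f" "linear_map K V' W g"
    and "\<And>u. u \<in> carrier U \<Longrightarrow> f (i u) = u" "\<And>w. w \<in> carrier W \<Longrightarrow> g (j w) = w"
    and "s \<in> carrier (U \<boxtimes>\<^bsub>K\<^esub> W)"
  shows "tensor_map K V V' U W f g (tensor_map K U W V V' i j s) = s"
  by (rule linear_map_eqI[OF assms(1,2) linear_map_comp(2)[OF tensor_map_linear tensor_map_linear]
        linear_map_id _ assms(11)])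
    (simp_all add: assms tensor_map_tensor linear_mapD(1)[OF assms(5)] linear_mapD(1)[OF assms(6)])

lemma linear_map_const_zero: "module K W \<Longrightarrow> linear_map K V W (\<lambda>x. \<zero>\<^bsub>W\<^esub>)"
proof -
  assume "module K W"
  then interpret W: module K W .
  show ?thesis by (rule linear_mapI) auto
qed

lemma tensor_zero:
  assumes "module K V" "module K W"
  shows "w \<in> carrier W \<Longrightarrow> tensor K V W \<zero>\<^bsub>V\<^esub> w = \<zero>\<^bsub>V \<boxtimes>\<^bsub>K\<^esub> W\<^esub>"
    and "v \<in> carrier V \<Longrightarrow> tensor K V W v \<zero>\<^bsub>W\<^esub> = \<zero>\<^bsub>V \<boxtimes>\<^bsub>K\<^esub> W\<^esub>"
  using linear_map_zero[OF _ tensor_space_module[OF assms] tensor_linear(2)[OF assms]]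
    linear_map_zero[OF _ tensor_space_module[OF assms] tensor_linear(1)[OF assms]] assms
  by auto

lemma tensor_map_vanish:
  assumes "module K U" "module K W" "module K V" "module K V'" "module K X" "module K Y"
    and "linear_map K U V i" "linear_map K W V' j" "linear_map K V X f" "linear_map K V' Y g"
    and "(\<forall>u\<in>carrier U. f (i u) = \<zero>\<^bsub>X\<^esub>) \<or> (\<forall>w\<in>carrier W. g (j w) = \<zero>\<^bsub>Y\<^esub>)"
    and "s \<in> carrier (U \<boxtimes>\<^bsub>K\<^esub> W)"
  shows "tensor_map K V V' X Y f g (tensor_map K U W V V' i j s) = \<zero>\<^bsub>X \<boxtimes>\<^bsub>K\<^esub> Y\<^esub>"
  by (rule linear_map_eqI[OF assms(1,2) linear_map_comp(2)[OF tensor_map_linear tensor_map_linear]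
        linear_map_const_zero _ assms(12)])
    (use assms(11) in \<open>auto simp: assms(1-10) tensor_map_tensor linear_mapD(1)[OF assms(7)]
      linear_mapD(1)[OF assms(8)] linear_mapD(1)[OF assms(9)] linear_mapD(1)[OF assms(10)]
      tensor_zero tensor_space_module\<close>)

section \<open>The operator on \<open>A \<oplus> C\<close>\<close>

context entwining_structure
begin

context
  fixes q assumes q: "q \<in> carrier K" "q \<noteq> \<zero>"
    and bij: "bij_betw \<psi> (carrier (C \<boxtimes> A)) (carrier (A \<boxtimes> C))"
begin

text \<open>Here \<open>S\<close> stands for the operator \<open>R'\<close> of the coalgebra and \<open>\<phi>\<close> for the inverse of \<open>\<psi>\<close>.\<close>

private abbreviation "V \<equiv> direct_sum A C"
private abbreviation "inA \<equiv> (\<lambda>a. (a, \<zero>\<^bsub>C\<^esub>))"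
private abbreviation "inC \<equiv> (\<lambda>c. (\<zero>\<^bsub>A\<^esub>, c))"
private abbreviation "R \<equiv> alg_op_R K A q"
private abbreviation "S \<equiv> coalg_op_R' K C \<Delta> \<epsilon> q"
private abbreviation "\<phi> \<equiv> inv_into (carrier (C \<boxtimes> A)) \<psi>"
private abbreviation "T \<equiv> entwined_sum K A C \<psi> q R S"
private abbreviation "l \<equiv> q \<ominus> inv q"

private lemmas inverse_q = K.nonzero_inverse[OF q]
private lemmas mA = algebra_module
private lemmas mC = coalgebra_module
private lemmas mV = direct_sum_module[OF mA mC]
private lemmas m = mA mC mV tensor_space_module
private lemmas incl = direct_sum_linear[OF mA mC]
private lemmas R_lin = alg_op_R_linear[OF q]
private lemmas S_lin = coalg_op_R'_linear[OF q]

private lemma l: "l \<in> carrier K"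
  using q inverse_q by simp

private lemma \<phi>_lin: "linear_map K (A \<boxtimes> C) (C \<boxtimes> A) \<phi>"
  by (rule linear_map_inv_into[OF _ entwining_linear bij]) (intro m)

private lemma \<phi>_\<psi>: "s \<in> carrier (C \<boxtimes> A) \<Longrightarrow> \<phi> (\<psi> s) = s"
  and \<psi>_\<phi>: "t \<in> carrier (A \<boxtimes> C) \<Longrightarrow> \<psi> (\<phi> t) = t"
  using bij by (simp_all add: bij_betw_inv_into_left bij_betw_inv_into_right)

lemma entwined_sum_linear: "linear_map K (V \<boxtimes> V) (V \<boxtimes> V) T"
  unfolding entwined_sum_def Let_def
  by (intro linear_map_add linear_map_smult l m
      linear_map_comp(2)[OF _ tensor_map_linear] linear_map_comp(2)[OF tensor_map_linear R_lin]
      linear_map_comp(2)[OF tensor_map_linear S_lin]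
      linear_map_comp(2)[OF tensor_map_linear \<phi>_lin]
      linear_map_comp(2)[OF tensor_map_linear entwining_linear] tensor_map_linear incl)

private lemmas T_lin = entwined_sum_linear

text \<open>The values of \<open>T\<close> on the four summands: on each of them, all but one of the four projections
  in its definition vanish.\<close>

lemma entwined_sum_incl:
  shows entwined_sum_AA: "s \<in> carrier (A \<boxtimes> A) \<Longrightarrow>
      T (tensor_map K A A V V inA inA s) = tensor_map K A A V V inA inA (R s)"
    and entwined_sum_CC: "t \<in> carrier (C \<boxtimes> C) \<Longrightarrow>
      T (tensor_map K C C V V inC inC t) = tensor_map K C C V V inC inC (S t)"
    and entwined_sum_AC: "u \<in> carrier (A \<boxtimes> C) \<Longrightarrow>
      T (tensor_map K A C V V inA inC u) = tensor_map K C A V V inC inA (\<phi> u)"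
    and entwined_sum_CA: "v \<in> carrier (C \<boxtimes> A) \<Longrightarrow>
      T (tensor_map K C A V V inC inA v) = tensor_map K A C V V inA inC (\<psi> v)
        \<oplus>\<^bsub>V \<boxtimes> V\<^esub> l \<odot>\<^bsub>V \<boxtimes> V\<^esub> tensor_map K C A V V inC inA v"
proof -
  have mVV: "module K (V \<boxtimes> V)"
    by (intro m)
  interpret VV: module K "V \<boxtimes> V"
    by (rule mVV)
  note zeros = linear_map_zero[OF _ _ R_lin] linear_map_zero[OF _ _ S_lin]
    linear_map_zero[OF _ _ \<phi>_lin] linear_map_zero[OF _ _ entwining_linear]
    linear_map_zero[OF _ mVV tensor_map_linear]
  note J = linear_mapD(1)[OF tensor_map_linear[OF mA mA mV mV incl(1,1)]]
    linear_mapD(1)[OF tensor_map_linear[OF mC mC mV mV incl(2,2)]]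
    linear_mapD(1)[OF tensor_map_linear[OF mA mC mV mV incl(1,2)]]
    linear_mapD(1)[OF tensor_map_linear[OF mC mA mV mV incl(2,1)]]
  note c = linear_mapD(1)[OF R_lin] linear_mapD(1)[OF S_lin] linear_mapD(1)[OF \<phi>_lin]
    linear_mapD(1)[OF entwining_linear]
  note simps = entwined_sum_def Let_def zeros m incl tensor_map_retract tensor_map_vanish J c l
  show "T (tensor_map K A A V V inA inA s) = tensor_map K A A V V inA inA (R s)"
    if "s \<in> carrier (A \<boxtimes> A)"
    using that by (simp add: simps)
  show "T (tensor_map K C C V V inC inC t) = tensor_map K C C V V inC inC (S t)"
    if "t \<in> carrier (C \<boxtimes> C)"
    using that by (simp add: simps)
  show "T (tensor_map K A C V V inA inC u) = tensor_map K C A V V inC inA (\<phi> u)"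
    if "u \<in> carrier (A \<boxtimes> C)"
    using that by (simp add: simps)
  show "T (tensor_map K C A V V inC inA v) = tensor_map K A C V V inA inC (\<psi> v)
        \<oplus>\<^bsub>V \<boxtimes> V\<^esub> l \<odot>\<^bsub>V \<boxtimes> V\<^esub> tensor_map K C A V V inC inA v"
    if "v \<in> carrier (C \<boxtimes> A)"
    using that by (simp add: simps)
qed

private abbreviation "G \<equiv> inA ` carrier A \<union> inC ` carrier C"

private lemma G: "G \<subseteq> carrier V"
  using linear_mapD(1)[OF incl(1)] linear_mapD(1)[OF incl(2)] by auto

private lemma decompose:
  assumes "v \<in> carrier V"
  shows "\<exists>x\<in>G. \<exists>y\<in>G. v = x \<oplus>\<^bsub>V\<^esub> y"
proof -
  have "v = inA (fst v) \<oplus>\<^bsub>V\<^esub> inC (snd v)" "fst v \<in> carrier A" "snd v \<in> carrier C"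
    using assms by (auto simp: direct_sum_def)
  then show ?thesis
    by blast
qed

lemma entwined_sum_quadratic:
  assumes "X \<in> carrier (V \<boxtimes> V)"
  shows "T (T X) = X \<oplus>\<^bsub>V \<boxtimes> V\<^esub> l \<odot>\<^bsub>V \<boxtimes> V\<^esub> T X"
proof (rule linear_map_eqI_generators2[OF mV G decompose _ _ _ assms])
  have mVV: "module K (V \<boxtimes> V)"
    by (intro m)
  interpret VV: module K "V \<boxtimes> V"
    by (rule mVV)
  show "linear_map K (V \<boxtimes> V) (V \<boxtimes> V) (\<lambda>X. T (T X))"
    by (rule linear_map_comp(2)[OF T_lin T_lin])
  show "linear_map K (V \<boxtimes> V) (V \<boxtimes> V) (\<lambda>X. X \<oplus>\<^bsub>V \<boxtimes> V\<^esub> l \<odot>\<^bsub>V \<boxtimes> V\<^esub> T X)"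
    by (intro linear_map_add linear_map_id linear_map_smult T_lin mVV l)
  note J = linear_mapD[OF tensor_map_linear[OF mA mA mV mV incl(1,1)]]
    linear_mapD[OF tensor_map_linear[OF mC mC mV mV incl(2,2)]]
    linear_mapD[OF tensor_map_linear[OF mA mC mV mV incl(1,2)]]
    linear_mapD[OF tensor_map_linear[OF mC mA mV mV incl(2,1)]]
  note c = linear_mapD(1)[OF R_lin] linear_mapD(1)[OF S_lin] linear_mapD(1)[OF \<phi>_lin]
    linear_mapD(1)[OF entwining_linear]
  interpret AA: module K "A \<boxtimes> A" by (intro m)
  interpret CC: module K "C \<boxtimes> C" by (intro m)
  note simps = linear_mapD[OF T_lin] entwined_sum_incl J c l \<phi>_\<psi> \<psi>_\<phi>
    alg_op_R_quadratic[OF q] coalg_op_R'_quadratic[OF q] VV.a_ac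
  have AA: "T (T (tensor_map K A A V V inA inA s)) =
      tensor_map K A A V V inA inA s \<oplus>\<^bsub>V \<boxtimes> V\<^esub> l \<odot>\<^bsub>V \<boxtimes> V\<^esub> T (tensor_map K A A V V inA inA s)"
    if "s \<in> carrier (A \<boxtimes> A)" for s
    using that by (simp add: simps)
  have CC: "T (T (tensor_map K C C V V inC inC s)) =
      tensor_map K C C V V inC inC s \<oplus>\<^bsub>V \<boxtimes> V\<^esub> l \<odot>\<^bsub>V \<boxtimes> V\<^esub> T (tensor_map K C C V V inC inC s)"
    if "s \<in> carrier (C \<boxtimes> C)" for s
    using that by (simp add: simps)
  have AC: "T (T (tensor_map K A C V V inA inC s)) =
      tensor_map K A C V V inA inC s \<oplus>\<^bsub>V \<boxtimes> V\<^esub> l \<odot>\<^bsub>V \<boxtimes> V\<^esub> T (tensor_map K A C V V inA inC s)"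
    if "s \<in> carrier (A \<boxtimes> C)" for s
    using that by (simp add: simps)
  have CA: "T (T (tensor_map K C A V V inC inA s)) =
      tensor_map K C A V V inC inA s \<oplus>\<^bsub>V \<boxtimes> V\<^esub> l \<odot>\<^bsub>V \<boxtimes> V\<^esub> T (tensor_map K C A V V inC inA s)"
    if "s \<in> carrier (C \<boxtimes> A)" for s
    using that by (simp add: simps)
  have pure: "T (T (tensor K V V (i u) (j v))) =
      tensor K V V (i u) (j v) \<oplus>\<^bsub>V \<boxtimes> V\<^esub> l \<odot>\<^bsub>V \<boxtimes> V\<^esub> T (tensor K V V (i u) (j v))"
    if "module K X" "module K Y" "linear_map K X V i" "linear_map K Y V j"
      "\<And>s. s \<in> carrier (X \<boxtimes> Y) \<Longrightarrow> T (T (tensor_map K X Y V V i j s)) =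
        tensor_map K X Y V V i j s \<oplus>\<^bsub>V \<boxtimes> V\<^esub> l \<odot>\<^bsub>V \<boxtimes> V\<^esub> T (tensor_map K X Y V V i j s)"
      "u \<in> carrier X" "v \<in> carrier Y"
    for X Y i j u v
    using that(5)[of "tensor K X Y u v"] that(1-4,6,7)
    by (simp add: tensor_map_tensor mV tensor_closed)
  fix x y assume "x \<in> G" "y \<in> G"
  then show "T (T (tensor K V V x y)) =
      tensor K V V x y \<oplus>\<^bsub>V \<boxtimes> V\<^esub> l \<odot>\<^bsub>V \<boxtimes> V\<^esub> T (tensor K V V x y)"
    by (elim UnE imageE; hypsubst)
      (rule pure[OF mA mA incl(1,1) AA] pure[OF mC mC incl(2,2) CC]
        pure[OF mA mC incl(1,2) AC] pure[OF mC mA incl(2,1) CA]; assumption)+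
qed

lemma entwined_sum_braid:
  assumes "X \<in> carrier (V \<boxtimes> V \<boxtimes> V)"
  shows "op12 K V T (op23 K V T (op12 K V T X)) = op23 K V T (op12 K V T (op23 K V T X))"
proof -
  let ?M = "V \<boxtimes> V \<boxtimes> V" and ?B = "op12 K V T" and ?D = "op23 K V T"
  interpret M: module K ?M by (intro m)
  have B_lin: "linear_map K ?M ?M ?B" and D_lin: "linear_map K ?M ?M ?D"
    unfolding op12_eq_map12 op23_eq_map23 by (intro map12_linear map23_linear m T_lin)+
  \<comment> \<open>the inclusions of the eight summands of \<open>V \<otimes> (V \<otimes> V)\<close>\<close>
  define aaa where "aaa = tensor_map3 K A A A V inA inA inA"
  define aac where "aac = tensor_map3 K A A C V inA inA inC"
  define aca where "aca = tensor_map3 K A C A V inA inC inA"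
  define caa where "caa = tensor_map3 K C A A V inC inA inA"
  define acc where "acc = tensor_map3 K A C C V inA inC inC"
  define cac where "cac = tensor_map3 K C A C V inC inA inC"
  define cca where "cca = tensor_map3 K C C A V inC inC inA"
  define ccc where "ccc = tensor_map3 K C C C V inC inC inC"
  note defs = aaa_def aac_def aca_def caa_def acc_def cac_def cca_def ccc_def
  have "linear_map K (A \<boxtimes> A \<boxtimes> A) ?M aaa" "linear_map K (A \<boxtimes> A \<boxtimes> C) ?M aac"
    "linear_map K (A \<boxtimes> C \<boxtimes> A) ?M aca" "linear_map K (C \<boxtimes> A \<boxtimes> A) ?M caa"
    "linear_map K (A \<boxtimes> C \<boxtimes> C) ?M acc" "linear_map K (C \<boxtimes> A \<boxtimes> C) ?M cac"
    "linear_map K (C \<boxtimes> C \<boxtimes> A) ?M cca" "linear_map K (C \<boxtimes> C \<boxtimes> C) ?M ccc"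
    unfolding defs by (intro tensor_map3_linear m incl)+
  note J = this[THEN linear_mapD(1)] this[THEN linear_mapD(2)] this[THEN linear_mapD(3)]
  \<comment> \<open>the amplifications of \<open>R\<close> (\<open>r\<close>), \<open>S\<close> (\<open>s\<close>), \<open>\<psi>\<close> (\<open>p\<close>) and \<open>\<phi>\<close> (\<open>f\<close>) to the triple products;
    the last letter names the additional third factor\<close>
  define r12a where "r12a = map12 K A A A A A R"
  define r12c where "r12c = map12 K A A C A A R"
  define r23a where "r23a = map23 K A A A A A R"
  define r23c where "r23c = map23 K C A A A A R"
  define s12a where "s12a = map12 K C C A C C S"
  define s12c where "s12c = map12 K C C C C C S"
  define s23a where "s23a = map23 K A C C C C S"
  define s23c where "s23c = map23 K C C C C C S"
  define p12a where "p12a = map12 K C A A A C \<psi>"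
  define p12c where "p12c = map12 K C A C A C \<psi>"
  define p23a where "p23a = map23 K A C A A C \<psi>"
  define p23c where "p23c = map23 K C C A A C \<psi>"
  define f12a where "f12a = map12 K A C A C A \<phi>"
  define f12c where "f12c = map12 K A C C C A \<phi>"
  define f23a where "f23a = map23 K A A C C A \<phi>"
  define f23c where "f23c = map23 K C A C C A \<phi>"
  note ops = r12a_def r12c_def r23a_def r23c_def s12a_def s12c_def s23a_def s23c_def
    p12a_def p12c_def p23a_def p23c_def f12a_def f12c_def f23a_def f23c_def
  have "linear_map K (A \<boxtimes> A \<boxtimes> A) (A \<boxtimes> A \<boxtimes> A) r12a"
    "linear_map K (A \<boxtimes> A \<boxtimes> C) (A \<boxtimes> A \<boxtimes> C) r12c"
    "linear_map K (A \<boxtimes> A \<boxtimes> A) (A \<boxtimes> A \<boxtimes> A) r23a"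
    "linear_map K (C \<boxtimes> A \<boxtimes> A) (C \<boxtimes> A \<boxtimes> A) r23c"
    "linear_map K (C \<boxtimes> C \<boxtimes> A) (C \<boxtimes> C \<boxtimes> A) s12a"
    "linear_map K (C \<boxtimes> C \<boxtimes> C) (C \<boxtimes> C \<boxtimes> C) s12c"
    "linear_map K (A \<boxtimes> C \<boxtimes> C) (A \<boxtimes> C \<boxtimes> C) s23a"
    "linear_map K (C \<boxtimes> C \<boxtimes> C) (C \<boxtimes> C \<boxtimes> C) s23c"
    "linear_map K (C \<boxtimes> A \<boxtimes> A) (A \<boxtimes> C \<boxtimes> A) p12a"
    "linear_map K (C \<boxtimes> A \<boxtimes> C) (A \<boxtimes> C \<boxtimes> C) p12c"
    "linear_map K (A \<boxtimes> C \<boxtimes> A) (A \<boxtimes> A \<boxtimes> C) p23a"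
    "linear_map K (C \<boxtimes> C \<boxtimes> A) (C \<boxtimes> A \<boxtimes> C) p23c"
    "linear_map K (A \<boxtimes> C \<boxtimes> A) (C \<boxtimes> A \<boxtimes> A) f12a"
    "linear_map K (A \<boxtimes> C \<boxtimes> C) (C \<boxtimes> A \<boxtimes> C) f12c"
    "linear_map K (A \<boxtimes> A \<boxtimes> C) (A \<boxtimes> C \<boxtimes> A) f23a"
    "linear_map K (C \<boxtimes> A \<boxtimes> C) (C \<boxtimes> C \<boxtimes> A) f23c"
    unfolding ops
    by (intro map12_linear map23_linear m R_lin S_lin entwining_linear \<phi>_lin)+
  note L = this[THEN linear_mapD(1)]
  have B_aaa: "?B (aaa t) = aaa (r12a t)"
    if "t \<in> carrier (A \<boxtimes> A \<boxtimes> A)" for t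
    unfolding defs ops
    by (rule op12_tensor_map3_pure[OF m(1,1,1,1,1,3) incl(1,1,1,1,1) R_lin T_lin entwined_sum_AA that])
  have B_aac: "?B (aac t) = aac (r12c t)"
    if "t \<in> carrier (A \<boxtimes> A \<boxtimes> C)" for t
    unfolding defs ops
    by (rule op12_tensor_map3_pure[OF m(1,1,2,1,1,3) incl(1,1,2,1,1) R_lin T_lin entwined_sum_AA that])
  have D_aaa: "?D (aaa t) = aaa (r23a t)"
    if "t \<in> carrier (A \<boxtimes> A \<boxtimes> A)" for t
    unfolding defs ops
    by (rule op23_tensor_map3_pure[OF m(1,1,1,1,1,3) incl(1,1,1,1,1) R_lin T_lin entwined_sum_AA that])
  have D_caa: "?D (caa t) = caa (r23c t)"
    if "t \<in> carrier (C \<boxtimes> A \<boxtimes> A)" for t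
    unfolding defs ops
    by (rule op23_tensor_map3_pure[OF m(2,1,1,1,1,3) incl(2,1,1,1,1) R_lin T_lin entwined_sum_AA that])
  have B_cca: "?B (cca t) = cca (s12a t)"
    if "t \<in> carrier (C \<boxtimes> C \<boxtimes> A)" for t
    unfolding defs ops
    by (rule op12_tensor_map3_pure[OF m(2,2,1,2,2,3) incl(2,2,1,2,2) S_lin T_lin entwined_sum_CC that])
  have B_ccc: "?B (ccc t) = ccc (s12c t)"
    if "t \<in> carrier (C \<boxtimes> C \<boxtimes> C)" for t
    unfolding defs ops
    by (rule op12_tensor_map3_pure[OF m(2,2,2,2,2,3) incl(2,2,2,2,2) S_lin T_lin entwined_sum_CC that])
  have D_acc: "?D (acc t) = acc (s23a t)"
    if "t \<in> carrier (A \<boxtimes> C \<boxtimes> C)" for t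
    unfolding defs ops
    by (rule op23_tensor_map3_pure[OF m(1,2,2,2,2,3) incl(1,2,2,2,2) S_lin T_lin entwined_sum_CC that])
  have D_ccc: "?D (ccc t) = ccc (s23c t)"
    if "t \<in> carrier (C \<boxtimes> C \<boxtimes> C)" for t
    unfolding defs ops
    by (rule op23_tensor_map3_pure[OF m(2,2,2,2,2,3) incl(2,2,2,2,2) S_lin T_lin entwined_sum_CC that])
  have B_caa: "?B (caa t) = aca (p12a t) \<oplus>\<^bsub>?M\<^esub> l \<odot>\<^bsub>?M\<^esub> caa t"
    if "t \<in> carrier (C \<boxtimes> A \<boxtimes> A)" for t
    unfolding defs ops
    by (rule op12_tensor_map3[OF m(2,1,1,1,2,3) incl(2,1,1,1,2) entwining_linear T_lin l entwined_sum_CA that])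
  have B_cac: "?B (cac t) = acc (p12c t) \<oplus>\<^bsub>?M\<^esub> l \<odot>\<^bsub>?M\<^esub> cac t"
    if "t \<in> carrier (C \<boxtimes> A \<boxtimes> C)" for t
    unfolding defs ops
    by (rule op12_tensor_map3[OF m(2,1,2,1,2,3) incl(2,1,2,1,2) entwining_linear T_lin l entwined_sum_CA that])
  have D_aca: "?D (aca t) = aac (p23a t) \<oplus>\<^bsub>?M\<^esub> l \<odot>\<^bsub>?M\<^esub> aca t"
    if "t \<in> carrier (A \<boxtimes> C \<boxtimes> A)" for t
    unfolding defs ops
    by (rule op23_tensor_map3[OF m(1,2,1,1,2,3) incl(1,2,1,1,2) entwining_linear T_lin l entwined_sum_CA that])
  have D_cca: "?D (cca t) = cac (p23c t) \<oplus>\<^bsub>?M\<^esub> l \<odot>\<^bsub>?M\<^esub> cca t"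
    if "t \<in> carrier (C \<boxtimes> C \<boxtimes> A)" for t
    unfolding defs ops
    by (rule op23_tensor_map3[OF m(2,2,1,1,2,3) incl(2,2,1,1,2) entwining_linear T_lin l entwined_sum_CA that])
  have B_aca: "?B (aca t) = caa (f12a t)"
    if "t \<in> carrier (A \<boxtimes> C \<boxtimes> A)" for t
    unfolding defs ops
    by (rule op12_tensor_map3_pure[OF m(1,2,1,2,1,3) incl(1,2,1,2,1) \<phi>_lin T_lin entwined_sum_AC that])
  have B_acc: "?B (acc t) = cac (f12c t)"
    if "t \<in> carrier (A \<boxtimes> C \<boxtimes> C)" for t
    unfolding defs ops
    by (rule op12_tensor_map3_pure[OF m(1,2,2,2,1,3) incl(1,2,2,2,1) \<phi>_lin T_lin entwined_sum_AC that])
  have D_aac: "?D (aac t) = aca (f23a t)"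
    if "t \<in> carrier (A \<boxtimes> A \<boxtimes> C)" for t
    unfolding defs ops
    by (rule op23_tensor_map3_pure[OF m(1,1,2,2,1,3) incl(1,1,2,2,1) \<phi>_lin T_lin entwined_sum_AC that])
  have D_cac: "?D (cac t) = cca (f23c t)"
    if "t \<in> carrier (C \<boxtimes> A \<boxtimes> C)" for t
    unfolding defs ops
    by (rule op23_tensor_map3_pure[OF m(2,1,2,2,1,3) incl(2,1,2,2,1) \<phi>_lin T_lin entwined_sum_AC that])
  note BD = B_aaa B_aac D_aaa D_caa B_cca B_ccc D_acc D_ccc
    B_caa B_cac D_aca D_cca B_aca B_acc D_aac D_cac
  have f12a_p12a: "f12a (p12a t) = t" if "t \<in> carrier (C \<boxtimes> A \<boxtimes> A)" for t
    unfolding ops by (rule map12_inverse[OF m(2,1,1,1,2) entwining_linear \<phi>_lin \<phi>_\<psi> that])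
  have f12c_p12c: "f12c (p12c t) = t" if "t \<in> carrier (C \<boxtimes> A \<boxtimes> C)" for t
    unfolding ops by (rule map12_inverse[OF m(2,1,2,1,2) entwining_linear \<phi>_lin \<phi>_\<psi> that])
  have f23a_p23a: "f23a (p23a t) = t" if "t \<in> carrier (A \<boxtimes> C \<boxtimes> A)" for t
    unfolding ops by (rule map23_inverse[OF m(1,2,1,1,2) entwining_linear \<phi>_lin \<phi>_\<psi> that])
  have f23c_p23c: "f23c (p23c t) = t" if "t \<in> carrier (C \<boxtimes> C \<boxtimes> A)" for t
    unfolding ops by (rule map23_inverse[OF m(2,2,1,1,2) entwining_linear \<phi>_lin \<phi>_\<psi> that])
  have p12a_f12a: "p12a (f12a t) = t" if "t \<in> carrier (A \<boxtimes> C \<boxtimes> A)" for t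
    unfolding ops by (rule map12_inverse[OF m(1,2,1,2,1) \<phi>_lin entwining_linear \<psi>_\<phi> that])
  have p12c_f12c: "p12c (f12c t) = t" if "t \<in> carrier (A \<boxtimes> C \<boxtimes> C)" for t
    unfolding ops by (rule map12_inverse[OF m(1,2,2,2,1) \<phi>_lin entwining_linear \<psi>_\<phi> that])
  have p23a_f23a: "p23a (f23a t) = t" if "t \<in> carrier (A \<boxtimes> A \<boxtimes> C)" for t
    unfolding ops by (rule map23_inverse[OF m(1,1,2,2,1) \<phi>_lin entwining_linear \<psi>_\<phi> that])
  have p23c_f23c: "p23c (f23c t) = t" if "t \<in> carrier (C \<boxtimes> A \<boxtimes> C)" for t
    unfolding ops by (rule map23_inverse[OF m(2,1,2,2,1) \<phi>_lin entwining_linear \<psi>_\<phi> that])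
  note inv = f12a_p12a f12c_p12c f23a_p23a f23c_p23c p12a_f12a p12c_f12c p23a_f23a p23c_f23c
  have rr: "r23c (r23c t) = t \<oplus>\<^bsub>C \<boxtimes> A \<boxtimes> A\<^esub> l \<odot>\<^bsub>C \<boxtimes> A \<boxtimes> A\<^esub> r23c t"
    if "t \<in> carrier (C \<boxtimes> A \<boxtimes> A)" for t
    unfolding ops by (rule map23_quadratic[OF m(2,1,1) R_lin l alg_op_R_quadratic[OF q] that])
  have ss: "s12a (s12a t) = t \<oplus>\<^bsub>C \<boxtimes> C \<boxtimes> A\<^esub> l \<odot>\<^bsub>C \<boxtimes> C \<boxtimes> A\<^esub> s12a t"
    if "t \<in> carrier (C \<boxtimes> C \<boxtimes> A)" for t
    unfolding ops by (rule map12_quadratic[OF m(2,2,1) S_lin l coalg_op_R'_quadratic[OF q] that])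
  have braid_a: "r12a (r23a (r12a t)) = r23a (r12a (r23a t))"
    if "t \<in> carrier (A \<boxtimes> A \<boxtimes> A)" for t
    unfolding ops by (rule alg_op_R_braid[OF q that])
  have braid_c: "s12c (s23c (s12c t)) = s23c (s12c (s23c t))"
    if "t \<in> carrier (C \<boxtimes> C \<boxtimes> C)" for t
    unfolding ops by (rule coalg_op_R'_braid[OF q that])
  have key_a: "r12c (p23a (p12a t)) = p23a (p12a (r23c t))"
    if "t \<in> carrier (C \<boxtimes> A \<boxtimes> A)" for t
    unfolding ops by (rule entwining_alg_op_R[OF q that])
  have key_c: "s23a (p12c (p23c t)) = p12c (p23c (s12a t))"
    if "t \<in> carrier (C \<boxtimes> C \<boxtimes> A)" for t
    unfolding ops by (rule entwining_coalg_op_R'[OF q that])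
  \<comment> \<open>the remaining relations are conjugates of these two by \<open>\<psi>\<close>\<close>
  have key_aca: "f23a (r12c (p23a t)) = p12a (r23c (f12a t))"
    if "t \<in> carrier (A \<boxtimes> C \<boxtimes> A)" for t
    using key_a[of "f12a t"] that by (simp add: L inv)
  have key_aac: "f12a (f23a (r12c t)) = r23c (f12a (f23a t))"
    if "t \<in> carrier (A \<boxtimes> A \<boxtimes> C)" for t
    using key_a[of "f12a (f23a t)"] that by (simp add: L inv)
  have key_cac: "f12c (s23a (p12c t)) = p23c (s12a (f23c t))"
    if "t \<in> carrier (C \<boxtimes> A \<boxtimes> C)" for t
    using key_c[of "f23c t"] that by (simp add: L inv)
  have key_acc: "f23c (f12c (s23a t)) = s12a (f23c (f12c t))"
    if "t \<in> carrier (A \<boxtimes> C \<boxtimes> C)" for t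
    using key_c[of "f23c (f12c t)"] that by (simp add: L inv)
  interpret CAA: module K "C \<boxtimes> A \<boxtimes> A" by (intro m)
  interpret CCA: module K "C \<boxtimes> C \<boxtimes> A" by (intro m)
  note D = linear_mapD(2,3)[OF B_lin] linear_mapD(2,3)[OF D_lin]
  note simps = BD D J L l inv M.smult_r_distr M.a_ac
  have AAA: "?B (?D (?B (aaa t))) = ?D (?B (?D (aaa t)))"
    if "t \<in> carrier (A \<boxtimes> A \<boxtimes> A)" for t
    using that by (simp add: simps braid_a)
  have AAC: "?B (?D (?B (aac t))) = ?D (?B (?D (aac t)))"
    if "t \<in> carrier (A \<boxtimes> A \<boxtimes> C)" for t
    using that by (simp add: simps key_aac)
  have ACA: "?B (?D (?B (aca t))) = ?D (?B (?D (aca t)))"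
    if "t \<in> carrier (A \<boxtimes> C \<boxtimes> A)" for t
    using that by (simp add: simps key_aca)
  have CAA: "?B (?D (?B (caa t))) = ?D (?B (?D (caa t)))"
    if "t \<in> carrier (C \<boxtimes> A \<boxtimes> A)" for t
    using that by (simp add: simps rr key_a)
  have ACC: "?B (?D (?B (acc t))) = ?D (?B (?D (acc t)))"
    if "t \<in> carrier (A \<boxtimes> C \<boxtimes> C)" for t
    using that by (simp add: simps key_acc)
  have CAC: "?B (?D (?B (cac t))) = ?D (?B (?D (cac t)))"
    if "t \<in> carrier (C \<boxtimes> A \<boxtimes> C)" for t
    using that by (simp add: simps key_cac)
  have CCA: "?B (?D (?B (cca t))) = ?D (?B (?D (cca t)))"
    if "t \<in> carrier (C \<boxtimes> C \<boxtimes> A)" for t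
    using that by (simp add: simps ss key_c)
  have CCC: "?B (?D (?B (ccc t))) = ?D (?B (?D (ccc t)))"
    if "t \<in> carrier (C \<boxtimes> C \<boxtimes> C)" for t
    using that by (simp add: simps braid_c)
  show ?thesis
  proof (rule linear_map_eqI_generators3[OF mV G decompose
        linear_map_comp(2)[OF linear_map_comp(2)[OF B_lin D_lin] B_lin]
        linear_map_comp(2)[OF linear_map_comp(2)[OF D_lin B_lin] D_lin] _ assms])
    have pure: "?B (?D (?B (tensor K V (V \<boxtimes> V) (i u) (tensor K V V (j v) (k w))))) =
        ?D (?B (?D (tensor K V (V \<boxtimes> V) (i u) (tensor K V V (j v) (k w)))))"
      if "module K X" "module K Y" "module K Z"
        "linear_map K X V i" "linear_map K Y V j" "linear_map K Z V k"
        "\<And>t. t \<in> carrier (X \<boxtimes> Y \<boxtimes> Z) \<Longrightarrow>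
          ?B (?D (?B (tensor_map3 K X Y Z V i j k t))) = ?D (?B (?D (tensor_map3 K X Y Z V i j k t)))"
        "u \<in> carrier X" "v \<in> carrier Y" "w \<in> carrier Z"
      for X Y Z i j k u v w
      using that(7)[of "tensor K X (Y \<boxtimes> Z) u (tensor K Y Z v w)"] that(1-6,8-10)
      by (simp add: tensor_map3_tensor mV tensor_closed tensor_space_module)
    fix x y z assume "x \<in> G" "y \<in> G" "z \<in> G"
    then show "?B (?D (?B (tensor K V (V \<boxtimes> V) x (tensor K V V y z)))) =
        ?D (?B (?D (tensor K V (V \<boxtimes> V) x (tensor K V V y z))))"
      by (elim UnE imageE; hypsubst)
        (rule pure[OF mA mA mA incl(1,1,1) AAA[unfolded defs]]
          pure[OF mA mA mC incl(1,1,2) AAC[unfolded defs]]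
          pure[OF mA mC mA incl(1,2,1) ACA[unfolded defs]]
          pure[OF mC mA mA incl(2,1,1) CAA[unfolded defs]]
          pure[OF mA mC mC incl(1,2,2) ACC[unfolded defs]]
          pure[OF mC mA mC incl(2,1,2) CAC[unfolded defs]]
          pure[OF mC mC mA incl(2,2,1) CCA[unfolded defs]]
          pure[OF mC mC mC incl(2,2,2) CCC[unfolded defs]]; assumption)+
  qed
qed

lemma entwined_sum_hecke: "hecke_operator K V q T"
proof -
  let ?W = "V \<boxtimes> V"
  interpret W: module K ?W
    by (intro m)
  note T = linear_mapD[OF entwined_sum_linear]
    linear_map_diff[OF W.module_axioms W.module_axioms entwined_sum_linear]
  \<comment> \<open>the quadratic relation makes \<open>T - l\<close> a two-sided inverse of \<open>T\<close>\<close>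
  have bij_T: "bij_betw T (carrier ?W) (carrier ?W)"
  proof (rule bij_betw_byWitness[where f' = "\<lambda>X. T X \<ominus>\<^bsub>?W\<^esub> l \<odot>\<^bsub>?W\<^esub> X"])
    have cancel: "(X \<oplus>\<^bsub>?W\<^esub> Y) \<ominus>\<^bsub>?W\<^esub> Y = X" if "X \<in> carrier ?W" "Y \<in> carrier ?W" for X Y
      using that by (simp add: a_minus_def W.a_assoc W.r_neg)
    show "\<forall>X\<in>carrier ?W. T (T X) \<ominus>\<^bsub>?W\<^esub> l \<odot>\<^bsub>?W\<^esub> T X = X"
      by (simp add: entwined_sum_quadratic cancel T l)
    show "\<forall>X\<in>carrier ?W. T (T X \<ominus>\<^bsub>?W\<^esub> l \<odot>\<^bsub>?W\<^esub> X) = X"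
      by (simp add: entwined_sum_quadratic cancel T l)
  qed (auto simp: T l)
  have hecke: "T (T X \<ominus>\<^bsub>?W\<^esub> q \<odot>\<^bsub>?W\<^esub> X) \<oplus>\<^bsub>?W\<^esub> inv q \<odot>\<^bsub>?W\<^esub> (T X \<ominus>\<^bsub>?W\<^esub> q \<odot>\<^bsub>?W\<^esub> X) = \<zero>\<^bsub>?W\<^esub>"
    if X: "X \<in> carrier ?W" for X
  proof -
    define Y Z where "Y = q \<odot>\<^bsub>?W\<^esub> T X" and "Z = inv q \<odot>\<^bsub>?W\<^esub> T X"
    have YZ: "Y \<in> carrier ?W" "Z \<in> carrier ?W"
      using X q inverse_q by (simp_all add: Y_def Z_def T)
    have TT: "T (T X) = X \<oplus>\<^bsub>?W\<^esub> (Y \<oplus>\<^bsub>?W\<^esub> \<ominus>\<^bsub>?W\<^esub> Z)"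
      using X q inverse_q
      by (simp add: entwined_sum_quadratic T Y_def Z_def a_minus_def W.smult_l_distr W.smult_l_minus)
    have "T (T X \<ominus>\<^bsub>?W\<^esub> q \<odot>\<^bsub>?W\<^esub> X) = X \<oplus>\<^bsub>?W\<^esub> (Y \<oplus>\<^bsub>?W\<^esub> \<ominus>\<^bsub>?W\<^esub> Z) \<oplus>\<^bsub>?W\<^esub> \<ominus>\<^bsub>?W\<^esub> Y"
      using X q by (simp add: T TT) (simp add: a_minus_def Y_def)
    also have "\<dots> = X \<oplus>\<^bsub>?W\<^esub> \<ominus>\<^bsub>?W\<^esub> Z"
      using X YZ by (simp add: W.a_ac W.r_neg1 W.r_neg2)
    finally have 1: "T (T X \<ominus>\<^bsub>?W\<^esub> q \<odot>\<^bsub>?W\<^esub> X) = X \<oplus>\<^bsub>?W\<^esub> \<ominus>\<^bsub>?W\<^esub> Z" .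
    have 2: "inv q \<odot>\<^bsub>?W\<^esub> (T X \<ominus>\<^bsub>?W\<^esub> q \<odot>\<^bsub>?W\<^esub> X) = Z \<oplus>\<^bsub>?W\<^esub> \<ominus>\<^bsub>?W\<^esub> X"
      using X q inverse_q
      by (simp add: Z_def a_minus_def W.smult_r_distr W.smult_r_minus T
          K.smult_inverse_cancel[OF W.module_axioms _ q])
    have "X \<oplus>\<^bsub>?W\<^esub> \<ominus>\<^bsub>?W\<^esub> Z \<oplus>\<^bsub>?W\<^esub> (Z \<oplus>\<^bsub>?W\<^esub> \<ominus>\<^bsub>?W\<^esub> X) = \<zero>\<^bsub>?W\<^esub>"
      using X YZ by (simp add: W.a_assoc W.r_neg1 W.r_neg)
    then show ?thesis
      unfolding 1 2 .
  qed
  show ?thesis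
    unfolding hecke_operator_def yang_baxter_operator_def comp_def
    using entwined_sum_linear bij_T entwined_sum_braid hecke by blast
qed

end

end

theorem proposition2p9:
  fixes K :: "('k, 'm) ring_scheme"
    and A :: "('k, 'a) module"
    and C :: "('k, 'c) module"
    and \<Delta> :: "'c \<Rightarrow> ('c \<times> 'c \<Rightarrow> 'k) set"
    and \<epsilon> :: "'c \<Rightarrow> 'k"
    and \<psi> :: "('c \<times> 'a \<Rightarrow> 'k) set \<Rightarrow> ('a \<times> 'c \<Rightarrow> 'k) set"
    and q :: 'k
  assumes "entwining_structure K A C \<Delta> \<epsilon> \<psi>"
    and "bij_betw \<psi> (carrier (C \<boxtimes>\<^bsub>K\<^esub> A)) (carrier (A \<boxtimes>\<^bsub>K\<^esub> C))"
    and "q \<in> carrier K" and "q \<noteq> \<zero>\<^bsub>K\<^esub>"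
  shows "hecke_operator K (direct_sum A C) q
           (entwined_sum K A C \<psi> q (alg_op_R K A q) (coalg_op_R' K C \<Delta> \<epsilon> q))"
  using assms(1,3,4,2) by (rule entwining_structure.entwined_sum_hecke)

end
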